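(* Let $d\ge1$, $\alpha>1$, and let $R$ be sufficiently large. Let $f\in L^2(\mathbb R^d)$ with $\operatorname{supp}\widehat f\subset\mathcal I=\{\xi\in\mathbb R^d:\frac12\le|\xi|\le2\}$. For $j=0,1,\dots,[R^{\alpha-1}]$ let $t_j=jR$, and set $I_j=[t_j,t_{j+1})$ for $j<[R^{\alpha-1}]$ and $I_{[R^{\alpha-1}]}=[t_{[R^{\alpha-1}]},R^\alpha)$. Let $\varphi\in C_0^\infty(B(0,2R))$ be a smooth function on $\mathbb R^d$ with $\varphi(x')=1$ on the ball $B(0,R)$. Then for any $\varepsilon>0$ there is a constant $C_{\alpha,\varepsilon}>0$ and a family of functions $\{f_j\}_{j=0}^{[R^{\alpha-1}]}$ satisfying $$\operatorname{supp}\widehat f_j\subset\Bigl\{\xi\in\mathbb R^d:\ \frac12-\frac1R\le|\xi|\le2+\frac1R\Bigr\},$$ such that for all $x=(x',x_{d+1})\in\mathbb R^d\times\mathbb R$ with $x_{d+1}\in I_j$, $$\varphi(x')\,Tf(x)=\varphi(x')\,\chi_{I_j}(x_{d+1})\,Tf_j(x',x_{d+1}-t_j)+\mathcal O_{\alpha,\varepsilon}\bigl(R^{-99d}\|f\|_2\bigr).$$ Moreover, there exists a constant $c_d>0$ (depending only on $d$) such that $$\Bigl\|\Bigl(\sum_{j=0}^{[R^{\alpha-1}]}|f_j|^2\Bigr)^{\frac12}\Bigr\|_2\le C_{\alpha,\varepsilon}\,R^{\varepsilon c_d}\,\|f\|_2 .$$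
   Context: For $g\in L^2(\mathbb R^d)$ with compactly supported Fourier transform and $x=(x',x_{d+1})\in\mathbb R^d\times\mathbb R$, $$Tg(x)=Tg(x',x_{d+1})=\int_{\mathbb R^d}e^{i[x'\cdot\xi+x_{d+1}|\xi|^\alpha]}\widehat g(\xi)\,d\xi .$$ $[r]$ denotes the greatest integer not exceeding $r$, $\chi_E$ the characteristic function of $E$, and $B(0,\rho)$ the ball of radius $\rho$ centered at the origin of $\mathbb R^d$. $\mathcal O_{\alpha,\varepsilon}(\eta)$ denotes a quantity bounded in absolute value by $C\eta$, with $C$ depending only on $\alpha$, $\varepsilon$, $d$ and $\sup|\varphi|$ (in particular not on $R$, $j$, $x$ or $f$); $C_{\alpha,\varepsilon}$ may also depend on $d$. "Sufficiently large" for $R$ may depend on $\alpha,\varepsilon,d$. *)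

theory Defs
  imports "HOL-Analysis.Analysis"
begin

text \<open>Elements of \<open>L\<^sup>2\<close> are represented by functions; the norm, Fourier transform,
  essential support and \<open>T_op\<close> do not depend on the representative chosen.\<close>

definition L2 :: "('a::euclidean_space \<Rightarrow> complex) set" where
  "L2 = {f. f \<in> borel_measurable lebesgue \<and> integrable lebesgue (\<lambda>x. (norm (f x))\<^sup>2)}"

definition L2_norm :: "('a::euclidean_space \<Rightarrow> 'b::real_normed_vector) \<Rightarrow> real" where
  "L2_norm f = sqrt (LINT x|lebesgue. (norm (f x))\<^sup>2)"

definition fourier_trunc :: "('a::euclidean_space \<Rightarrow> complex) \<Rightarrow> real \<Rightarrow> 'a \<Rightarrow> complex" where
  "fourier_trunc g r \<xi> = (LINT x:ball 0 r|lebesgue. exp (- \<i> * of_real (x \<bullet> \<xi>)) * g x)"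

text \<open>The \<open>L\<^sup>2\<close> Fourier transform (without normalising factor) is the limit in \<open>L\<^sup>2\<close> of the
  integrals over growing balls. It exists for every \<open>g\<close> in \<open>L\<^sup>2\<close> by Plancherel's theorem
  and is unique up to null sets; \<open>SOME\<close> picks a representative.\<close>

definition fourier_L2 :: "('a::euclidean_space \<Rightarrow> complex) \<Rightarrow> 'a \<Rightarrow> complex" where
  "fourier_L2 g = (SOME h. h \<in> L2 \<and>
     (\<lambda>n. \<integral>\<^sup>+ \<xi>. ennreal ((norm (h \<xi> - fourier_trunc g (real n) \<xi>))\<^sup>2) \<partial>lebesgue)
       \<longlonglongrightarrow> 0)"

definition ess_supp :: "('a::euclidean_space \<Rightarrow> complex) \<Rightarrow> 'a set" where
  "ess_supp h = - \<Union>{U. open U \<and> (AE \<xi> in lebesgue. \<xi> \<in> U \<longrightarrow> h \<xi> = 0)}"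

text \<open>A genuine (convergent) integral for \<open>g\<close> in \<open>L\<^sup>2\<close> whose Fourier transform has compact
  essential support.\<close>

definition T_op :: "real \<Rightarrow> ('a::euclidean_space \<Rightarrow> complex) \<Rightarrow> 'a \<times> real \<Rightarrow> complex" where
  "T_op \<alpha> g = (\<lambda>(x', t). LINT \<xi>|lebesgue.
     exp (\<i> * of_real (x' \<bullet> \<xi> + t * norm \<xi> powr \<alpha>)) * fourier_L2 g \<xi>)"

fun Ck :: "nat \<Rightarrow> ('a::euclidean_space \<Rightarrow> complex) \<Rightarrow> bool" where
  "Ck 0 f \<longleftrightarrow> continuous_on UNIV f"
| "Ck (Suc k) f \<longleftrightarrow> (\<forall>x. f differentiable (at x)) \<and>
     (\<forall>v. Ck k (\<lambda>x. frechet_derivative f (at x) v))"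

definition test_functions :: "'a::euclidean_space set \<Rightarrow> ('a \<Rightarrow> complex) set" where
  "test_functions U = {\<phi>. (\<forall>k. Ck k \<phi>) \<and>
     compact (closure {x. \<phi> x \<noteq> 0}) \<and> closure {x. \<phi> x \<noteq> 0} \<subseteq> U}"

definition last_index :: "real \<Rightarrow> real \<Rightarrow> nat" where
  "last_index \<alpha> R = nat \<lfloor>R powr (\<alpha> - 1)\<rfloor>"

definition time_node :: "real \<Rightarrow> nat \<Rightarrow> real" where
  "time_node R j = real j * R"

definition time_interval :: "real \<Rightarrow> real \<Rightarrow> nat \<Rightarrow> real set" where
  "time_interval \<alpha> R j =
     (if j < last_index \<alpha> R then {time_node R j ..< time_node R (Suc j)}
      else {time_node R j ..< R powr \<alpha>})"

end

theory Submission
  imports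
    Defs
    "HOL-Probability.Characteristic_Functions"
    "HOL-Complex_Analysis.Cauchy_Integral_Formula"
begin

text \<open>Instead of cutting off \<open>e\<^bsup>i t\<^sub>j |D|\<^sup>\<alpha>\<^esup> f\<close> in space at scale \<open>R\<^bsup>1+\<epsilon>\<^esup>\<close>, we cut off in the spectrum
  of the generator of dilations, which only needs averages over radial dilations
  \<open>\<xi> \<mapsto> e\<^bsup>-krv\<^esup> \<xi>\<close>, \<open>0 \<le> v \<le> 1\<close>, \<open>r = R\<^bsup>-1-\<epsilon>\<^esup>\<close>, on the Fourier side. Writing \<open>A\<^sub>k\<close> for the
  average, \<open>\<Sum>\<^bsub>1\<le>k\<le>M\<^esub> (-1)\<^bsup>k+1\<^esup> (M choose k) A\<^sub>k\<close> differs from the identity by an \<open>M\<close>-th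
  finite difference. Paired with \<open>e\<^bsup>i(x\<cdot>\<xi> + s|\<xi>|\<^sup>\<alpha>)\<^esup>\<close>, \<open>|x| \<le> 2R\<close>, \<open>0 \<le> s \<le> R\<close>, which is entire in
  the logarithm of the dilation factor and bounded on the disc of radius \<open>1/R\<close>, it is
  \<open>O((r R)\<^sup>M) = O(R\<^bsup>-\<epsilon>M\<^esup>)\<close>.

  For the square function, fix \<open>\<xi>\<close>: as \<open>v\<close> varies, the phase \<open>j R |e\<^bsup>-krv\<^esup> \<xi>|\<^sup>\<alpha>\<close> is \<open>j\<close> times a
  monotone function of speed about \<open>R r = R\<^bsup>-\<epsilon>\<^esup>\<close>, so Bessel's inequality in \<open>j\<close> loses only
  \<open>R\<^sup>\<epsilon>\<close>; integrating in \<open>\<xi>\<close> and applying Plancherel gives the bound with \<open>c\<^sub>d = 1/2\<close>.\<close>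

section \<open>Affine changes of variables and the Fourier transform of Gaussians\<close>

text \<open>Multiplying the transform of f by exp(i j R |\<xi>|^\<alpha>) alone would reproduce Tf
  exactly on each time interval, but all pieces would have the same norm and the square function
  would grow like the square root of the number of intervals. The cutoff has to create orthogonality
  in j while staying invisible to waves with |x'| at most 2R and time at most R. Invisibility wants
  logarithmic dilation factors well below 1/R; orthogonality wants them comparable to 1/R, so that
  the phase R |\<xi>|^\<alpha> sweeps a fixed part of a period. Stopping short of 1/R by the factor
  R^(-\<epsilon>) is paid once in the sum of squares, whereas a difference of order M gains it M
  times; hence M is chosen with \<epsilon> M at least 99 d. Dilations move frequencies only along
  rays and by bounded factors, so the support condition holds exactly, with no tails to discard. The
  pieces are prescribed by their transforms while the definitions start from functions, so
  Plancherel and L2 inversion for the limit of truncated integrals are established before the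
  argument proper.\<close>

lemma nn_integral_lborel_affine:
  fixes f :: "'a::euclidean_space \<Rightarrow> ennreal"
  assumes [measurable]: "f \<in> borel_measurable borel" and c: "c \<noteq> 0"
  shows "(\<integral>\<^sup>+x. f x \<partial>lborel) = ennreal (\<bar>c\<bar> ^ DIM('a)) * (\<integral>\<^sup>+x. f (t + c *\<^sub>R x) \<partial>lborel)"
  by (subst lborel_affine[OF c, of t])
     (simp add: nn_integral_density nn_integral_distr nn_integral_cmult)

lemma integrable_lborel_affine:
  fixes f :: "'a::euclidean_space \<Rightarrow> 'b::{banach, second_countable_topology}"
  assumes f: "integrable lborel f" and c: "c \<noteq> 0"
  shows "integrable lborel (\<lambda>x. f (t + c *\<^sub>R x))"
proof (rule integrableI_bounded)
  have [measurable]: "f \<in> borel_measurable borel"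
    using borel_measurable_integrable[OF f] by simp
  show "(\<lambda>x. f (t + c *\<^sub>R x)) \<in> borel_measurable lborel" by measurable
  have "ennreal (\<bar>c\<bar> ^ DIM('a)) * (\<integral>\<^sup>+x. norm (f (t + c *\<^sub>R x)) \<partial>lborel) < \<infinity>"
    using f by (subst nn_integral_lborel_affine[symmetric])
      (auto simp: c integrable_iff_bounded)
  then show "(\<integral>\<^sup>+x. norm (f (t + c *\<^sub>R x)) \<partial>lborel) < \<infinity>"
    using c by (auto simp: ennreal_mult_less_top)
qed

lemma integral_lborel_affine:
  fixes f :: "'a::euclidean_space \<Rightarrow> 'b::{banach, second_countable_topology}"
  assumes f: "integrable lborel f" and c: "c \<noteq> 0"
  shows "(\<integral>x. f x \<partial>lborel) = \<bar>c\<bar> ^ DIM('a) *\<^sub>R (\<integral>x. f (t + c *\<^sub>R x) \<partial>lborel)"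
proof -
  have [measurable]: "f \<in> borel_measurable borel"
    using borel_measurable_integrable[OF f] by simp
  show ?thesis
    using integrable_lborel_affine[OF f c, of t]
    by (subst lborel_affine[OF c, of t]) (simp add: integral_density integral_distr)
qed

text \<open>Fubini over coordinates: \<open>lborel\<close> is the image of the product of the
  coordinate measures. It reduces Gaussians to dimension one.\<close>

lemma
  fixes f :: "'a::euclidean_space \<Rightarrow> real \<Rightarrow> 'b::{real_normed_field,banach,second_countable_topology}"
  assumes f: "\<And>b. b \<in> Basis \<Longrightarrow> integrable lborel (f b)"
  shows integrable_lborel_prod: "integrable lborel (\<lambda>x. \<Prod>b\<in>Basis. f b (x \<bullet> b))" (is ?I)
    and integral_lborel_prod:
      "(\<integral>x. (\<Prod>b\<in>Basis. f b (x \<bullet> b)) \<partial>lborel) = (\<Prod>b\<in>Basis. \<integral>x. f b x \<partial>lborel)" (is ?E)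
proof -
  interpret product_sigma_finite "\<lambda>_::'a. lborel :: real measure"
    by standard
  have [measurable]: "f b \<in> borel_measurable borel" if "b \<in> Basis" for b
    using borel_measurable_integrable[OF f[OF that]] by simp
  have T: "(\<lambda>g. \<Sum>b\<in>Basis. g b *\<^sub>R b) \<in> (\<Pi>\<^sub>M b\<in>Basis. lborel) \<rightarrow>\<^sub>M (borel :: 'a measure)"
    by measurable
  have eq: "(\<Prod>b\<in>Basis. f b ((\<Sum>b\<in>Basis. g b *\<^sub>R b) \<bullet> b)) = (\<Prod>b\<in>Basis. f b (g b))" for g
    by (intro prod.cong) auto
  show ?I
    by (subst lborel_eq, subst integrable_distr_eq[OF T]) (auto simp: eq intro!: product_integrable_prod f)
  show ?E
    by (subst lborel_eq, subst integral_distr[OF T]) (auto simp: eq intro!: product_integral_prod f)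
qed

text \<open>The absolutely convergent transform, over \<open>lborel\<close> so that Borel
  measurability is automatic. \<open>fourier_trunc_eq\<close> connects it with the truncated
  integrals over \<open>lebesgue\<close> that define \<open>fourier_L2\<close>.\<close>

definition fourier :: "('a::euclidean_space \<Rightarrow> complex) \<Rightarrow> 'a \<Rightarrow> complex" where
  "fourier f \<xi> = (LINT x|lborel. exp (- \<i> * of_real (x \<bullet> \<xi>)) * f x)"

lemma norm_exp_ii [simp]:
  "norm (exp (- (\<i> * of_real t))) = 1" "norm (exp (\<i> * of_real t)) = 1"
  by (simp_all add: norm_exp_i_times exp_minus norm_inverse)

text \<open>Rescaling by c produces the standard normal density, whose characteristic function is
  known; the frequency w becomes -c w.\<close>

lemma fourier_gaussian_real:
  assumes c: "c > 0"
  shows "integrable lborel (\<lambda>x::real. complex_of_real (exp (- (x\<^sup>2 / (2 * c\<^sup>2)))))"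
    and "(\<integral>x. exp (- \<i> * of_real (x * w)) * complex_of_real (exp (- (x\<^sup>2 / (2 * c\<^sup>2)))) \<partial>lborel)
      = of_real (sqrt (2 * pi) * c * exp (- (c\<^sup>2 * w\<^sup>2 / 2)))"
proof -
  let ?n = "\<lambda>x. complex_of_real (std_normal_density x)"
  have I: "integrable lborel (\<lambda>x. std_normal_density x)"
    using integrable_normal_density[of 1 0] by simp
  have Ic: "integrable lborel ?n"
    using I by auto
  have g: "complex_of_real (exp (- (x\<^sup>2 / (2 * c\<^sup>2)))) = of_real (sqrt (2 * pi)) * ?n (x / c)" for x
  proof -
    have "exp (- (x\<^sup>2 / (2 * c\<^sup>2))) = sqrt (2 * pi) * std_normal_density (x / c)"
      by (simp add: std_normal_density_def power_divide mult.commute)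
    then show ?thesis by (simp only: of_real_mult)
  qed
  have "integrable lborel (\<lambda>x. ?n (0 + (1/c) * x))"
    by (rule lborel_integrable_real_affine[OF Ic]) (use c in auto)
  then show "integrable lborel (\<lambda>x::real. complex_of_real (exp (- (x\<^sup>2 / (2 * c\<^sup>2)))))"
    unfolding g by (intro integrable_mult_right) simp
  have ch: "(\<integral>x. ?n x * iexp (t * x) \<partial>lborel) = of_real (exp (- (t\<^sup>2) / 2))" for t
    using fun_cong[OF char_std_normal_distribution, of t]
    by (simp add: char_def integral_density scaleR_conv_of_real)
  have "(\<integral>x. exp (- \<i> * of_real (x * w)) * complex_of_real (exp (- (x\<^sup>2 / (2 * c\<^sup>2)))) \<partial>lborel)
     = (\<integral>x. of_real (sqrt (2 * pi)) * (?n (0 + (1/c) * x) * iexp ((- c * w) * (0 + (1/c) * x))) \<partial>lborel)"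
    unfolding g using c by (intro Bochner_Integration.integral_cong) (auto simp: mult_ac)
  also have "\<dots> = of_real (sqrt (2 * pi)) * (\<integral>x. (?n (0 + (1/c) * x) * iexp ((- c * w) * (0 + (1/c) * x))) \<partial>lborel)"
    by (rule integral_mult_right_zero)
  also have "\<bar>1/c\<bar> *\<^sub>R (\<integral>x. (?n (0 + (1/c) * x) * iexp ((- c * w) * (0 + (1/c) * x))) \<partial>lborel)
     = (\<integral>x. ?n x * iexp ((- c * w) * x) \<partial>lborel)"
    by (rule lborel_integral_real_affine[symmetric]) (use c in auto)
  then have "(\<integral>x. (?n (0 + (1/c) * x) * iexp ((- c * w) * (0 + (1/c) * x))) \<partial>lborel)
     = of_real c * (\<integral>x. ?n x * iexp ((- c * w) * x) \<partial>lborel)"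
    using c by (simp add: scaleR_conv_of_real field_simps)
  also have "(\<integral>x. ?n x * iexp ((- c * w) * x) \<partial>lborel) = of_real (exp (- ((- c * w)\<^sup>2) / 2))"
    by (rule ch)
  finally show "(\<integral>x. exp (- \<i> * of_real (x * w)) * complex_of_real (exp (- (x\<^sup>2 / (2 * c\<^sup>2)))) \<partial>lborel)
      = of_real (sqrt (2 * pi) * c * exp (- (c\<^sup>2 * w\<^sup>2 / 2)))"
    by (simp add: power_mult_distrib)
qed

text \<open>The squared norm and the inner product are sums over coordinates, so Gaussian and kernel
  are both products and the one-dimensional formula applies to each factor.\<close>

lemma
  fixes w :: "'a::euclidean_space"
  assumes c: "c > 0"
  shows integrable_gaussian:
      "integrable lborel (\<lambda>x::'a. complex_of_real (exp (- ((norm x)\<^sup>2 / (2 * c\<^sup>2)))))" (is ?I)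
    and fourier_gaussian: "fourier (\<lambda>x::'a. of_real (exp (- ((norm x)\<^sup>2 / (2 * c\<^sup>2))))) w
      = of_real ((sqrt (2 * pi) * c) ^ DIM('a) * exp (- (c\<^sup>2 * (norm w)\<^sup>2 / 2)))" (is ?E)
proof -
  have nsq: "(norm x)\<^sup>2 = (\<Sum>b\<in>Basis. (x \<bullet> b)\<^sup>2)" for x :: 'a
    unfolding power2_norm_eq_inner by (subst euclidean_inner) (simp add: power2_eq_square)
  let ?g = "\<lambda>x::real. complex_of_real (exp (- (x\<^sup>2 / (2 * c\<^sup>2))))"
  let ?f = "\<lambda>(b::'a) x::real. exp (- \<i> * of_real (x * (w \<bullet> b))) * ?g x"
  have e1: "complex_of_real (exp (- ((norm x)\<^sup>2 / (2 * c\<^sup>2)))) = (\<Prod>b\<in>Basis. ?g (x \<bullet> b))" for x :: 'a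
    unfolding nsq of_real_prod[symmetric] exp_sum[OF finite_Basis, symmetric] sum_negf sum_divide_distrib ..
  show ?I
    unfolding e1 by (intro integrable_lborel_prod fourier_gaussian_real(1) c)
  have e2: "exp (- \<i> * of_real (x \<bullet> w)) = (\<Prod>b\<in>Basis. exp (- \<i> * of_real ((x \<bullet> b) * (w \<bullet> b))))" for x
    unfolding exp_sum[OF finite_Basis, symmetric]
    by (subst euclidean_inner) (simp add: sum_distrib_left)
  have int: "integrable lborel (?f b)" if "b \<in> Basis" for b
    by (rule Bochner_Integration.integrable_bound[OF fourier_gaussian_real(1)[OF c]]) (auto simp: norm_mult)
  have "fourier (\<lambda>x::'a. of_real (exp (- ((norm x)\<^sup>2 / (2 * c\<^sup>2))))) w
      = (\<integral>x. (\<Prod>b\<in>Basis. ?f b (x \<bullet> b)) \<partial>lborel)"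
    unfolding fourier_def e1 e2 by (simp add: prod.distrib)
  also have "\<dots> = (\<Prod>b\<in>Basis. \<integral>x. ?f b x \<partial>lborel)"
    by (rule integral_lborel_prod[OF int])
  also have "\<dots> = (\<Prod>b\<in>(Basis::'a set). of_real (sqrt (2 * pi) * c * exp (- (c\<^sup>2 * (w \<bullet> b)\<^sup>2 / 2))))"
    by (intro prod.cong fourier_gaussian_real(2) c refl)
  also have "\<dots> = of_real ((sqrt (2 * pi) * c) ^ DIM('a) * exp (- (c\<^sup>2 * (norm w)\<^sup>2 / 2)))"
    unfolding of_real_prod[symmetric] prod.distrib nsq exp_sum[OF finite_Basis, symmetric]
    by (simp add: sum_distrib_left sum_divide_distrib power_mult_distrib sum_negf)
  finally show ?E .
qed

section \<open>Approximation and translation in the mean square\<close>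

text \<open>The squared norm with values in \<open>ennreal\<close>: sums, limits and Fubini need no
  integrability conditions, and finiteness is a separate hypothesis where it matters.\<close>

definition l2sq :: "('a::euclidean_space \<Rightarrow> complex) \<Rightarrow> ennreal" where
  "l2sq f = (\<integral>\<^sup>+x. ennreal ((norm (f x))\<^sup>2) \<partial>lborel)"

lemma norm_add_sq_le: "(norm (a + b :: complex))\<^sup>2 \<le> 2 * (norm a)\<^sup>2 + 2 * (norm b)\<^sup>2"
proof -
  have "(norm (a + b))\<^sup>2 \<le> (norm a + norm b)\<^sup>2"
    by (intro power_mono norm_triangle_ineq) simp
  also have "\<dots> \<le> 2 * (norm a)\<^sup>2 + 2 * (norm b)\<^sup>2"
    using sum_squares_bound[of "norm a" "norm b"] by (simp add: power2_sum)
  finally show ?thesis .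
qed

text \<open>A substitute for Minkowski without square roots; the factor 2 is harmless wherever a
  limit is taken or constants are free.\<close>

lemma l2sq_add:
  assumes [measurable]: "f \<in> borel_measurable borel" "g \<in> borel_measurable borel"
  shows "l2sq (\<lambda>x. f x + g x) \<le> 2 * l2sq f + 2 * l2sq g"
proof -
  have "l2sq (\<lambda>x. f x + g x) \<le> (\<integral>\<^sup>+x. 2 * ennreal ((norm (f x))\<^sup>2) + 2 * ennreal ((norm (g x))\<^sup>2) \<partial>lborel)"
    unfolding l2sq_def
  proof (intro nn_integral_mono)
    fix x
    have "ennreal ((norm (f x + g x))\<^sup>2) \<le> ennreal (2 * (norm (f x))\<^sup>2 + 2 * (norm (g x))\<^sup>2)"
      by (intro ennreal_leI norm_add_sq_le)
    then show "ennreal ((norm (f x + g x))\<^sup>2) \<le> 2 * ennreal ((norm (f x))\<^sup>2) + 2 * ennreal ((norm (g x))\<^sup>2)"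
      by (simp add: ennreal_mult)
  qed
  also have "\<dots> = 2 * l2sq f + 2 * l2sq g"
    by (simp add: nn_integral_add nn_integral_cmult l2sq_def)
  finally show ?thesis .
qed

lemma l2sq_minus: "l2sq (\<lambda>x. - f x) = l2sq f"
  by (simp add: l2sq_def)

lemma l2sq_diff:
  assumes [measurable]: "f \<in> borel_measurable borel" "g \<in> borel_measurable borel"
  shows "l2sq (\<lambda>x. f x - g x) \<le> 2 * l2sq f + 2 * l2sq g"
  using l2sq_add[of f "\<lambda>x. - g x"] by (simp add: l2sq_minus)

lemma l2sq_cutoff_tendsto:
  assumes [measurable]: "f \<in> borel_measurable borel" and fin: "l2sq f < \<infinity>"
    and A[measurable]: "\<And>n::nat. Measurable.pred borel (A n)"
    and ev: "\<And>x. \<forall>\<^sub>F n in sequentially. A n x"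
  shows "(\<lambda>n. l2sq (\<lambda>x. f x - (if A n x then f x else 0))) \<longlonglongrightarrow> 0"
proof -
  have "(\<lambda>n. l2sq (\<lambda>x. f x - (if A n x then f x else 0))) \<longlonglongrightarrow> integral\<^sup>N lborel (\<lambda>x::'a. 0)"
    unfolding l2sq_def
  proof (rule nn_integral_dominated_convergence[where w="\<lambda>x. ennreal ((norm (f x))\<^sup>2)"])
    show "(\<integral>\<^sup>+x. ennreal ((norm (f x))\<^sup>2) \<partial>lborel) < \<infinity>" using fin by (simp add: l2sq_def)
    show "AE x in lborel. (\<lambda>n. ennreal ((norm (f x - (if A n x then f x else 0)))\<^sup>2)) \<longlonglongrightarrow> 0"
    proof (rule AE_I2, rule tendsto_eventually)
      show "\<forall>\<^sub>F n in sequentially. ennreal ((norm (f x - (if A n x then f x else 0)))\<^sup>2) = 0" for x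
        using ev[of x] by eventually_elim simp
    qed
  qed auto
  then show ?thesis by simp
qed

lemma l2_approx_bounded:
  assumes [measurable]: "f \<in> borel_measurable borel" and fin: "l2sq f < \<infinity>" and e: "e > 0"
  obtains N :: nat where
    "l2sq (\<lambda>x. f x - (if norm x \<le> real N \<and> norm (f x) \<le> real N then f x else 0)) < e"
proof -
  have "(\<lambda>n. l2sq (\<lambda>x. f x - (if norm x \<le> real n \<and> norm (f x) \<le> real n then f x else 0))) \<longlonglongrightarrow> 0"
  proof (rule l2sq_cutoff_tendsto[OF _ fin])
    show "\<forall>\<^sub>F n in sequentially. norm x \<le> real n \<and> norm (f x) \<le> real n" for x
      using eventually_ge_at_top[of "nat \<lceil>max (norm x) (norm (f x))\<rceil>"]
      by eventually_elim linarith
  qed measurable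
  then have "\<forall>\<^sub>F n in sequentially. l2sq (\<lambda>x. f x - (if norm x \<le> real n \<and> norm (f x) \<le> real n then f x else 0)) < e"
    using e by (rule order_tendstoD)
  then show ?thesis
    using that by (auto simp: eventually_sequentially)
qed

text \<open>A measurable function is an a.e. limit of continuous ones, but without any uniform
  bound. Composing them with the projection onto a disc and multiplying by a tent function supplies
  a dominating function and does not disturb the limit.\<close>

lemma l2_approx_continuous_bounded:
  fixes f :: "'a::euclidean_space \<Rightarrow> complex"
  assumes [measurable]: "f \<in> borel_measurable borel" and e: "e > 0"
    and b: "\<And>x. norm (f x) \<le> real N" "\<And>x. norm x > real N \<Longrightarrow> f x = 0"
  obtains g where "continuous_on UNIV g" "\<And>x. norm (g x) \<le> real N"
    "\<And>x. norm x > real N + 1 \<Longrightarrow> g x = 0" "l2sq (\<lambda>x. f x - g x) < e"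
proof -
  have "f \<in> borel_measurable lebesgue"
    by (simp add: measurable_completion)
  then have "f measurable_on UNIV"
    by (rule lebesgue_measurable_imp_measurable_on) simp
  then obtain S G where S: "negligible S" and G: "\<And>n::nat. continuous_on UNIV (G n)"
    and lim: "\<And>x. x \<notin> S \<Longrightarrow> (\<lambda>n. G n x) \<longlonglongrightarrow> f x"
    unfolding measurable_on_def by auto
  have AES: "AE x in lborel. x \<notin> S"
    using S by (metis AE_completion_iff AE_not_in negligible_iff_null_sets)
  \<comment> \<open>The nearest-point map to the disc of radius N is continuous and fixes all values
    of f; \<open>cut\<close> equals 1 where f can be nonzero and vanishes beyond radius N +
    1.\<close>
  define clip where "clip = closest_point (cball (0::complex) (real N))"
  define cut where "cut x = max 0 (min 1 (real N + 1 - norm x))" for x :: 'a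
  have cc: "continuous_on UNIV clip"
    unfolding clip_def by (rule continuous_on_closest_point) auto
  have cl: "norm (clip z) \<le> real N" for z
    using closest_point_in_set[of "cball (0::complex) (real N)" z] by (auto simp: clip_def)
  have cid: "clip z = z" if "norm z \<le> real N" for z
    unfolding clip_def by (rule closest_point_self) (use that in auto)
  define g where "g n x = of_real (cut x) * clip (G n x)" for n x
  have gc: "continuous_on UNIV (g n)" for n
    unfolding g_def cut_def
    by (intro continuous_intros continuous_on_compose2[OF cc G]) auto
  have [measurable]: "g n \<in> borel_measurable borel" for n
    using gc by (rule borel_measurable_continuous_onI)
  have gb: "norm (g n x) \<le> real N" for n x
  proof -
    have "cut x * norm (clip (G n x)) \<le> 1 * real N"
      by (intro mult_mono cl) (auto simp: cut_def)
    then show ?thesis by (simp add: g_def norm_mult cut_def)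
  qed
  have g0: "g n x = 0" if "norm x > real N + 1" for n x
    using that by (simp add: g_def cut_def)
  have "(\<lambda>n. l2sq (\<lambda>x. f x - g n x)) \<longlonglongrightarrow> integral\<^sup>N lborel (\<lambda>x::'a. 0)"
    unfolding l2sq_def
  proof (rule nn_integral_dominated_convergence
      [where w="\<lambda>x. ennreal ((2 * real N)\<^sup>2) * indicator (cball 0 (real N + 1)) x"])
    show "(\<integral>\<^sup>+x. ennreal ((2 * real N)\<^sup>2) * indicator (cball (0::'a) (real N + 1)) x \<partial>lborel) < \<infinity>"
      using emeasure_bounded_finite[of "cball (0::'a) (real N + 1)"]
      by (subst nn_integral_cmult) (auto simp: ennreal_mult_less_top intro!: borel_measurable_indicator)
    show "AE x in lborel. ennreal ((norm (f x - g n x))\<^sup>2) \<le> ennreal ((2 * real N)\<^sup>2) * indicator (cball 0 (real N + 1)) x" for n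
    proof (intro always_eventually allI)
      fix x
      have "norm (f x - g n x) \<le> 2 * real N"
        using norm_triangle_ineq4[of "f x" "g n x"] b(1)[of x] gb[of n x] by simp
      then have "(norm (f x - g n x))\<^sup>2 \<le> (2 * real N)\<^sup>2"
        by (rule power_mono) simp
      moreover have "f x - g n x = 0" if "x \<notin> cball 0 (real N + 1)"
        using that b(2)[of x] g0[of x n] by auto
      ultimately show "ennreal ((norm (f x - g n x))\<^sup>2) \<le> ennreal ((2 * real N)\<^sup>2) * indicator (cball 0 (real N + 1)) x"
        by (cases "x \<in> cball 0 (real N + 1)") (auto simp: indicator_def intro!: ennreal_leI)
    qed
    show "AE x in lborel. (\<lambda>n. ennreal ((norm (f x - g n x))\<^sup>2)) \<longlonglongrightarrow> 0"
      using AES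
    proof eventually_elim
      fix x assume "x \<notin> S"
      then have "(\<lambda>n. clip (G n x)) \<longlonglongrightarrow> clip (f x)"
        using cc lim by (intro continuous_on_tendsto_compose[OF cc]) auto
      then have "(\<lambda>n. g n x) \<longlonglongrightarrow> of_real (cut x) * clip (f x)"
        unfolding g_def by (intro tendsto_intros)
      also have "of_real (cut x) * clip (f x) = f x"
        using b[of x] by (cases "norm x > real N") (auto simp: cid cut_def)
      finally have "(\<lambda>n. (norm (f x - g n x))\<^sup>2) \<longlonglongrightarrow> (norm (f x - f x))\<^sup>2"
        by (intro tendsto_intros)
      then show "(\<lambda>n. ennreal ((norm (f x - g n x))\<^sup>2)) \<longlonglongrightarrow> 0"
        using tendsto_ennrealI by fastforce
    qed
  qed (auto intro!: borel_measurable_times_ennreal borel_measurable_indicator)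
  then have "\<forall>\<^sub>F n in sequentially. l2sq (\<lambda>x. f x - g n x) < e"
    using e by (intro order_tendstoD) simp_all
  then obtain n where "l2sq (\<lambda>x. f x - g n x) < e"
    by (auto simp: eventually_sequentially)
  then show ?thesis
    using that[of "g n"] gc gb g0 by blast
qed

lemma l2_approx_continuous:
  fixes f :: "'a::euclidean_space \<Rightarrow> complex"
  assumes [measurable]: "f \<in> borel_measurable borel" and fin: "l2sq f < \<infinity>" and e: "(e::real) > 0"
  obtains g N where "continuous_on UNIV g" "\<And>x. norm (g x) \<le> real N"
    "\<And>x. norm x > real N + 1 \<Longrightarrow> g x = 0" "l2sq (\<lambda>x. f x - g x) < e"
proof -
  obtain N where N: "l2sq (\<lambda>x. f x - (if norm x \<le> real N \<and> norm (f x) \<le> real N then f x else 0)) < ennreal (e/4)"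
    using l2_approx_bounded[OF assms(1,2), of "ennreal (e/4)"] e by (auto simp: ennreal_less_zero_iff)
  define F where "F x = (if norm x \<le> real N \<and> norm (f x) \<le> real N then f x else 0)" for x
  have [measurable]: "F \<in> borel_measurable borel"
    unfolding F_def by measurable
  obtain g where g: "continuous_on UNIV g" "\<And>x. norm (g x) \<le> real N"
    "\<And>x. norm x > real N + 1 \<Longrightarrow> g x = 0" "l2sq (\<lambda>x. F x - g x) < ennreal (e/4)"
  proof (rule l2_approx_continuous_bounded[of F "ennreal (e/4)" N])
  qed (use e in \<open>auto simp: F_def\<close>)
  have [measurable]: "g \<in> borel_measurable borel"
    using g(1) by (rule borel_measurable_continuous_onI)
  have "l2sq (\<lambda>x. f x - g x) = l2sq (\<lambda>x. (f x - F x) + (F x - g x))"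
    by simp
  also have "\<dots> \<le> 2 * l2sq (\<lambda>x. f x - F x) + 2 * l2sq (\<lambda>x. F x - g x)"
    by (rule l2sq_add) measurable
  also have "\<dots> < 2 * ennreal (e/4) + 2 * ennreal (e/4)"
    using N[folded F_def] g(4)
    by (intro add_strict_mono) (auto simp: ennreal_mult_strict_left_mono)
  also have "\<dots> = ennreal (2 * (e/4) + 2 * (e/4))"
    using e by (simp add: numeral_mult_ennreal flip: ennreal_plus)
  finally show ?thesis
    using that[OF g(1-3)] by simp
qed

lemma l2sq_translate:
  fixes f :: "'a::euclidean_space \<Rightarrow> complex"
  assumes [measurable]: "f \<in> borel_measurable borel"
  shows "l2sq (\<lambda>x. f (x + w)) = l2sq f"
  unfolding l2sq_def
  by (subst (2) nn_integral_lborel_affine[where t=w and c=1]) (auto simp: add.commute)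

text \<open>For a continuous g of bounded support this is dominated convergence. In general f is
  replaced by a nearby g, and translation invariance makes the two replacement errors equal.\<close>

lemma l2sq_translation_tendsto:
  fixes f :: "'a::euclidean_space \<Rightarrow> complex"
  assumes [measurable]: "f \<in> borel_measurable borel" and fin: "l2sq f < \<infinity>"
    and w: "w \<longlonglongrightarrow> 0"
  shows "(\<lambda>n::nat. l2sq (\<lambda>x. f (x + w n) - f x)) \<longlonglongrightarrow> 0"
proof (rule order_tendstoI)
  fix a :: ennreal assume "0 < a"
  then obtain e where e: "0 < e" "ennreal e < a"
    by (metis ennreal_less_zero_iff dense ennreal_cases top.not_eq_extremum less_top order_less_trans)
  obtain g N where g: "continuous_on UNIV g" "\<And>x. norm (g x) \<le> real N"
    "\<And>x. norm x > real N + 1 \<Longrightarrow> g x = 0" "l2sq (\<lambda>x. f x - g x) < ennreal (e/16)"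
    using l2_approx_continuous[OF assms(1,2), of "e/16"] e by auto
  have [measurable]: "g \<in> borel_measurable borel"
    using g(1) by (rule borel_measurable_continuous_onI)
  have nw: "\<forall>\<^sub>F n in sequentially. norm (w n) < 1"
    using tendstoD[OF w, of 1] by (simp add: dist_norm)
  \<comment> \<open>Only finitely many terms of w change, and all translates of g now live in one
    ball of radius N + 2, as the dominating function requires.\<close>
  define v where "v n = (if norm (w n) < 1 then w n else 0)" for n
  have veq: "\<forall>\<^sub>F n in sequentially. v n = w n"
    using nw by eventually_elim (simp add: v_def)
  have v: "v \<longlonglongrightarrow> 0"
    using w veq by (simp add: filterlim_cong)
  have nv: "norm (v n) \<le> 1" for n by (simp add: v_def)
  have "(\<lambda>n. l2sq (\<lambda>x. g (x + v n) - g x)) \<longlonglongrightarrow> integral\<^sup>N lborel (\<lambda>x::'a. 0)"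
    unfolding l2sq_def
  proof (rule nn_integral_dominated_convergence
      [where w="\<lambda>x. ennreal ((2 * real N)\<^sup>2) * indicator (cball 0 (real N + 2)) x"])
    show "(\<integral>\<^sup>+x. ennreal ((2 * real N)\<^sup>2) * indicator (cball (0::'a) (real N + 2)) x \<partial>lborel) < \<infinity>"
      using emeasure_bounded_finite[of "cball (0::'a) (real N + 2)"]
      by (subst nn_integral_cmult) (auto simp: ennreal_mult_less_top intro!: borel_measurable_indicator)
    show "AE x in lborel. ennreal ((norm (g (x + v n) - g x))\<^sup>2) \<le> ennreal ((2 * real N)\<^sup>2) * indicator (cball 0 (real N + 2)) x" for n
    proof (intro always_eventually allI)
      fix x
      have "norm (g (x + v n) - g x) \<le> 2 * real N"
        using norm_triangle_ineq4[of "g (x + v n)" "g x"] g(2)[of "x + v n"] g(2)[of x] by simp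
      then have "(norm (g (x + v n) - g x))\<^sup>2 \<le> (2 * real N)\<^sup>2"
        by (rule power_mono) simp
      moreover have "g (x + v n) - g x = 0" if "x \<notin> cball 0 (real N + 2)"
        using that g(3)[of x] g(3)[of "x + v n"] nv[of n] norm_triangle_ineq4[of "x + v n" "v n"] by auto
      ultimately show "ennreal ((norm (g (x + v n) - g x))\<^sup>2) \<le> ennreal ((2 * real N)\<^sup>2) * indicator (cball 0 (real N + 2)) x"
        by (cases "x \<in> cball 0 (real N + 2)") (auto simp: indicator_def intro!: ennreal_leI)
    qed
    show "AE x in lborel. (\<lambda>n. ennreal ((norm (g (x + v n) - g x))\<^sup>2)) \<longlonglongrightarrow> 0"
    proof (intro always_eventually allI)
      fix x
      have "(\<lambda>n. x + v n) \<longlonglongrightarrow> x + 0"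
        using v by (intro tendsto_intros)
      then have "(\<lambda>n. g (x + v n)) \<longlonglongrightarrow> g (x + 0)"
        by (intro continuous_on_tendsto_compose[OF g(1)]) auto
      then have "(\<lambda>n. (norm (g (x + v n) - g x))\<^sup>2) \<longlonglongrightarrow> (norm (g (x + 0) - g x))\<^sup>2"
        by (intro tendsto_intros)
      then show "(\<lambda>n. ennreal ((norm (g (x + v n) - g x))\<^sup>2)) \<longlonglongrightarrow> 0"
        using tendsto_ennrealI by fastforce
    qed
  qed (auto intro!: borel_measurable_times_ennreal borel_measurable_indicator)
  then have "\<forall>\<^sub>F n in sequentially. l2sq (\<lambda>x. g (x + v n) - g x) < ennreal (e/16)"
    using e by (intro order_tendstoD) (auto simp: ennreal_less_zero_iff)
  with veq show "\<forall>\<^sub>F n in sequentially. l2sq (\<lambda>x. f (x + w n) - f x) < a"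
  proof eventually_elim
    case (elim n)
    have "l2sq (\<lambda>x. f (x + w n) - f x)
        = l2sq (\<lambda>x. (f (x + w n) - g (x + w n)) + ((g (x + w n) - g x) - (f x - g x)))"
      by simp
    also have "\<dots> \<le> 2 * l2sq (\<lambda>x. f (x + w n) - g (x + w n)) + 2 * l2sq (\<lambda>x. (g (x + w n) - g x) - (f x - g x))"
      by (rule l2sq_add) measurable
    also have "l2sq (\<lambda>x. f (x + w n) - g (x + w n)) = l2sq (\<lambda>x. f x - g x)"
      by (rule l2sq_translate[of "\<lambda>x. f x - g x"]) measurable
    also have "l2sq (\<lambda>x. (g (x + w n) - g x) - (f x - g x)) \<le> 2 * l2sq (\<lambda>x. g (x + w n) - g x) + 2 * l2sq (\<lambda>x. f x - g x)"
      by (rule l2sq_diff) measurable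
    also have "2 * l2sq (\<lambda>x. f x - g x) + 2 * (2 * l2sq (\<lambda>x. g (x + w n) - g x) + 2 * l2sq (\<lambda>x. f x - g x))
      \<le> 2 * ennreal (e/16) + 2 * (2 * ennreal (e/16) + 2 * ennreal (e/16))"
      using elim g(4) by (intro add_mono mult_left_mono) auto
    also have "\<dots> = ennreal (2 * (e/16) + 2 * (2 * (e/16) + 2 * (e/16)))"
      using e by (simp add: numeral_mult_ennreal flip: ennreal_plus)
    also have "\<dots> \<le> ennreal e" using e by (intro ennreal_leI) simp
    also note e(2)
    finally show ?case by (simp add: add_left_mono mult_left_mono)
  qed
qed simp

section \<open>Plancherel's theorem\<close>

lemma fourier_measurable [measurable]:
  assumes [measurable]: "f \<in> borel_measurable borel"
  shows "fourier f \<in> borel_measurable borel"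
  unfolding fourier_def by measurable

lemma borel_measurable_cnj [measurable]:
  assumes "f \<in> borel_measurable M"
  shows "(\<lambda>x. cnj (f x)) \<in> borel_measurable M"
  using assms by (rule measurable_compose) (intro borel_measurable_continuous_onI continuous_intros)

lemma integrable_fourier_kernel:
  assumes "integrable lborel f"
  shows "integrable lborel (\<lambda>x. exp (- \<i> * of_real (x \<bullet> \<xi>)) * f x)"
proof -
  have [measurable]: "f \<in> borel_measurable borel"
    using borel_measurable_integrable[OF assms] by simp
  show ?thesis
    by (rule Bochner_Integration.integrable_bound[OF assms]) (auto simp: norm_mult)
qed

lemma integrable_lborel_pair:
  fixes F :: "'a::euclidean_space \<times> 'b::euclidean_space \<Rightarrow> complex"
  assumes [measurable]: "F \<in> borel_measurable (lborel \<Otimes>\<^sub>M lborel)"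
    and fin: "(\<integral>\<^sup>+x. \<integral>\<^sup>+y. ennreal (norm (F (x, y))) \<partial>lborel \<partial>lborel) < \<infinity>"
  shows "integrable (lborel \<Otimes>\<^sub>M lborel) F"
proof (rule integrableI_bounded)
  show "(\<integral>\<^sup>+x. ennreal (norm (F x)) \<partial>(lborel \<Otimes>\<^sub>M lborel)) < \<infinity>"
    using fin by (subst lborel.nn_integral_fst[symmetric]) simp_all
qed simp

text \<open>Fubini, because the kernel is symmetric in x and \<xi> and has modulus 1.\<close>

lemma fourier_multiplication_formula:
  fixes f g :: "'a::euclidean_space \<Rightarrow> complex"
  assumes f: "integrable lborel f" and g: "integrable lborel g"
  shows "(\<integral>\<xi>. fourier f \<xi> * g \<xi> \<partial>lborel) = (\<integral>x. f x * fourier g x \<partial>lborel)"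
proof -
  have [measurable]: "f \<in> borel_measurable borel" "g \<in> borel_measurable borel"
    using borel_measurable_integrable[OF f] borel_measurable_integrable[OF g] by simp_all
  have I: "integrable (lborel \<Otimes>\<^sub>M lborel) (\<lambda>(\<xi>, x). exp (- \<i> * of_real (x \<bullet> \<xi>)) * f x * g \<xi>)"
  proof (rule integrable_lborel_pair)
    have "(\<integral>\<^sup>+\<xi>. \<integral>\<^sup>+x. ennreal (norm (exp (- \<i> * of_real (x \<bullet> \<xi>)) * f x * g \<xi>)) \<partial>lborel \<partial>lborel)
      = (\<integral>\<^sup>+x. ennreal (norm (f x)) \<partial>lborel) * (\<integral>\<^sup>+\<xi>. ennreal (norm (g \<xi>)) \<partial>lborel)"
      by (simp add: norm_mult ennreal_mult nn_integral_multc nn_integral_cmult)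
    also have "\<dots> < \<infinity>"
      using f g by (auto simp: integrable_iff_bounded ennreal_mult_less_top)
    finally show "(\<integral>\<^sup>+\<xi>. \<integral>\<^sup>+x. ennreal (norm (case (\<xi>, x) of (\<xi>, x) \<Rightarrow> exp (- \<i> * of_real (x \<bullet> \<xi>)) * f x * g \<xi>)) \<partial>lborel \<partial>lborel) < \<infinity>"
      by simp
  qed measurable
  have "(\<integral>\<xi>. fourier f \<xi> * g \<xi> \<partial>lborel) = (\<integral>\<xi>. \<integral>x. exp (- \<i> * of_real (x \<bullet> \<xi>)) * f x * g \<xi> \<partial>lborel \<partial>lborel)"
    unfolding fourier_def by simp
  also have "\<dots> = (\<integral>x. \<integral>\<xi>. exp (- \<i> * of_real (x \<bullet> \<xi>)) * f x * g \<xi> \<partial>lborel \<partial>lborel)"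
    by (rule lborel_pair.Fubini_integral[OF I, symmetric])
  also have "\<dots> = (\<integral>x. \<integral>\<xi>. f x * (exp (- \<i> * of_real (\<xi> \<bullet> x)) * g \<xi>) \<partial>lborel \<partial>lborel)"
    by (simp add: inner_commute mult_ac)
  finally show ?thesis
    unfolding fourier_def by simp
qed

lemma
  fixes f g :: "'a::euclidean_space \<Rightarrow> complex"
  assumes [measurable]: "f \<in> borel_measurable borel" "g \<in> borel_measurable borel"
    and fin: "l2sq f < \<infinity>" "l2sq g < \<infinity>"
  shows integrable_l2_mult: "integrable lborel (\<lambda>x. f x * g x)" (is ?I)
    and l2_Cauchy_Schwarz: "ennreal ((norm (\<integral>x. f x * g x \<partial>lborel))\<^sup>2) \<le> l2sq f * l2sq g" (is ?C)
proof -
  have CS: "(\<integral>\<^sup>+x. ennreal (norm (f x * g x)) \<partial>lborel)\<^sup>2 \<le> l2sq f * l2sq g"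
    using Cauchy_Schwarz_nn_integral[of "\<lambda>x. ennreal (norm (f x))" lborel "\<lambda>x. ennreal (norm (g x))"]
    by (simp add: l2sq_def norm_mult ennreal_mult ennreal_power)
  also have "\<dots> < \<infinity>"
    using fin by (simp add: ennreal_mult_less_top)
  finally show I: ?I
    by (auto simp: integrable_iff_bounded power2_eq_square ennreal_mult_less_top)
  have "(ennreal (norm (\<integral>x. f x * g x \<partial>lborel)))\<^sup>2 \<le> (\<integral>\<^sup>+x. ennreal (norm (f x * g x)) \<partial>lborel)\<^sup>2"
    by (intro power_mono integral_norm_bound_ennreal I) simp
  then show ?C
    using CS by (simp add: ennreal_power)
qed

section \<open>Autocorrelation and Gaussian regularisation\<close>

lemma l2sq_cnj: "l2sq (\<lambda>x. cnj (f x)) = l2sq f"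
  by (simp add: l2sq_def)

text \<open>The convolution of f with its reflected conjugate. Its value at 0 is the squared norm of
  f and its transform is the squared modulus of the transform of f, so Plancherel becomes a
  statement about its value at one point.\<close>

definition autocorr :: "('a::euclidean_space \<Rightarrow> complex) \<Rightarrow> 'a \<Rightarrow> complex" where
  "autocorr f w = (\<integral>y. f (y + w) * cnj (f y) \<partial>lborel)"

lemma autocorr_0:
  assumes [measurable]: "f \<in> borel_measurable borel" and fin: "l2sq f < \<infinity>"
  shows "autocorr f 0 = of_real (enn2real (l2sq f))"
proof -
  have "autocorr f 0 = (\<integral>y. of_real ((norm (f y))\<^sup>2) \<partial>lborel)"
    by (simp only: autocorr_def add_0_right complex_norm_square)
  also have "\<dots> = of_real (\<integral>y. (norm (f y))\<^sup>2 \<partial>lborel)"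
    by (rule integral_complex_of_real)
  also have "(\<integral>y. (norm (f y))\<^sup>2 \<partial>lborel) = enn2real (l2sq f)"
    unfolding l2sq_def by (rule integral_eq_nn_integral) auto
  finally show ?thesis .
qed

lemma norm_autocorr_le:
  assumes [measurable]: "f \<in> borel_measurable borel" and fin: "l2sq f < \<infinity>"
  shows "norm (autocorr f w) \<le> enn2real (l2sq f)"
proof -
  have "ennreal ((norm (autocorr f w))\<^sup>2) \<le> l2sq (\<lambda>x. f (x + w)) * l2sq (\<lambda>x. cnj (f x))"
    unfolding autocorr_def using fin
    by (intro l2_Cauchy_Schwarz) (auto simp: l2sq_translate l2sq_cnj)
  also have "\<dots> = ennreal ((enn2real (l2sq f))\<^sup>2)"
    using fin by (simp add: l2sq_translate l2sq_cnj power2_eq_square ennreal_mult)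
  finally have "(norm (autocorr f w))\<^sup>2 \<le> (enn2real (l2sq f))\<^sup>2"
    by (simp add: ennreal_le_iff)
  then show ?thesis
    by (rule power2_le_imp_le) simp
qed

lemma tendsto_0_le_ennreal:
  fixes g :: "nat \<Rightarrow> ennreal"
  assumes "g \<longlonglongrightarrow> 0" and "\<And>n. f n \<le> g n"
  shows "f \<longlonglongrightarrow> 0"
  by (rule tendsto_sandwich[OF eventuallyI eventuallyI tendsto_const assms(1)]) (simp_all add: assms(2))

text \<open>By Cauchy-Schwarz the increment is controlled by the mean square modulus of translation
  of f. Sequential continuity at 0 is what the approximate identity in \<open>Plancherel\<close>
  consumes.\<close>

lemma autocorr_tendsto:
  assumes [measurable]: "f \<in> borel_measurable borel" and fin: "l2sq f < \<infinity>"
    and w: "w \<longlonglongrightarrow> 0"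
  shows "(\<lambda>n::nat. autocorr f (w n)) \<longlonglongrightarrow> autocorr f 0"
proof -
  have finw: "l2sq (\<lambda>x. f (x + v)) < \<infinity>" for v
    using fin by (simp add: l2sq_translate)
  have b: "ennreal ((norm (autocorr f (w n) - autocorr f 0))\<^sup>2)
      \<le> l2sq (\<lambda>x. f (x + w n) - f x) * l2sq f" for n
  proof -
    have "autocorr f (w n) - autocorr f 0 = (\<integral>y. (f (y + w n) - f y) * cnj (f y) \<partial>lborel)"
      unfolding autocorr_def using fin finw
      by (subst Bochner_Integration.integral_diff[symmetric])
         (auto intro!: integrable_l2_mult Bochner_Integration.integral_cong simp: left_diff_distrib l2sq_cnj l2sq_translate)
    also have "ennreal ((norm \<dots>)\<^sup>2) \<le> l2sq (\<lambda>x. f (x + w n) - f x) * l2sq (\<lambda>x. cnj (f x))"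
    proof (rule l2_Cauchy_Schwarz)
      have "l2sq (\<lambda>x. f (x + w n) - f x) \<le> 2 * l2sq (\<lambda>x. f (x + w n)) + 2 * l2sq f"
        by (rule l2sq_diff) measurable
      also have "\<dots> < \<infinity>" using fin finw by (simp add: ennreal_mult_less_top)
      finally show "l2sq (\<lambda>x. f (x + w n) - f x) < \<infinity>" .
    qed (use fin in \<open>simp_all add: l2sq_cnj\<close>)
    finally show ?thesis by (simp add: l2sq_cnj)
  qed
  have "(\<lambda>n. l2sq (\<lambda>x. f (x + w n) - f x) * l2sq f) \<longlonglongrightarrow> 0 * l2sq f"
    using fin by (intro tendsto_mult_ennreal l2sq_translation_tendsto w tendsto_const) auto
  then have "(\<lambda>n. ennreal ((norm (autocorr f (w n) - autocorr f 0))\<^sup>2)) \<longlonglongrightarrow> 0"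
    by (intro tendsto_0_le_ennreal[OF _ b]) simp
  then have "(\<lambda>n. (norm (autocorr f (w n) - autocorr f 0))\<^sup>2) \<longlonglongrightarrow> 0"
    using tendsto_ennreal_iff[of "\<lambda>n. (norm (autocorr f (w n) - autocorr f 0))\<^sup>2" sequentially 0] by simp
  then have "(\<lambda>n. sqrt ((norm (autocorr f (w n) - autocorr f 0))\<^sup>2)) \<longlonglongrightarrow> sqrt 0"
    by (intro tendsto_intros)
  then show ?thesis
    by (simp add: LIM_zero_iff tendsto_norm_zero_iff)
qed

text \<open>After Fubini, shifting the inner variable by y splits the kernel into one factor for f
  and a conjugate factor for its conjugate.\<close>

lemma
  fixes f :: "'a::euclidean_space \<Rightarrow> complex"
  assumes f: "integrable lborel f"
  shows integrable_autocorr: "integrable lborel (autocorr f)" (is ?I)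
    and fourier_autocorr: "fourier (autocorr f) \<xi> = of_real ((norm (fourier f \<xi>))\<^sup>2)" (is ?E)
proof -
  have [measurable]: "f \<in> borel_measurable borel"
    using borel_measurable_integrable[OF f] by simp
  have aff: "(\<integral>\<^sup>+w. ennreal (norm (f (y + w))) \<partial>lborel) = (\<integral>\<^sup>+w. ennreal (norm (f w)) \<partial>lborel)" for y
    by (subst (2) nn_integral_lborel_affine[where t=y and c=1]) auto
  have I: "integrable (lborel \<Otimes>\<^sub>M lborel) (\<lambda>(y, w). exp (- \<i> * of_real (w \<bullet> \<eta>)) * (f (y + w) * cnj (f y)))" for \<eta>
  proof (rule integrable_lborel_pair)
    have "(\<integral>\<^sup>+y. \<integral>\<^sup>+w. ennreal (norm (exp (- \<i> * of_real (w \<bullet> \<eta>)) * (f (y + w) * cnj (f y)))) \<partial>lborel \<partial>lborel)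
      = (\<integral>\<^sup>+x. ennreal (norm (f x)) \<partial>lborel) * (\<integral>\<^sup>+x. ennreal (norm (f x)) \<partial>lborel)"
      by (simp add: norm_mult ennreal_mult nn_integral_multc nn_integral_cmult aff)
    also have "\<dots> < \<infinity>"
      using f by (auto simp: integrable_iff_bounded ennreal_mult_less_top)
    finally show "(\<integral>\<^sup>+y. \<integral>\<^sup>+w. ennreal (norm (case (y, w) of (y, w) \<Rightarrow> exp (- \<i> * of_real (w \<bullet> \<eta>)) * (f (y + w) * cnj (f y)))) \<partial>lborel \<partial>lborel) < \<infinity>"
      by simp
  qed measurable
  show ?I
    using lborel_pair.integrable_snd[OF I[of 0]] by (simp add: autocorr_def[abs_def])
  have "fourier (autocorr f) \<xi> = (\<integral>w. \<integral>y. exp (- \<i> * of_real (w \<bullet> \<xi>)) * (f (y + w) * cnj (f y)) \<partial>lborel \<partial>lborel)"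
    unfolding fourier_def autocorr_def by simp
  also have "\<dots> = (\<integral>y. \<integral>w. exp (- \<i> * of_real (w \<bullet> \<xi>)) * (f (y + w) * cnj (f y)) \<partial>lborel \<partial>lborel)"
    by (rule lborel_pair.Fubini_integral[OF I])
  also have "\<dots> = (\<integral>y. fourier f \<xi> * cnj (exp (- \<i> * of_real (y \<bullet> \<xi>)) * f y) \<partial>lborel)"
  proof (intro Bochner_Integration.integral_cong refl)
    fix y
    have "fourier f \<xi> = (\<integral>w. exp (- \<i> * of_real ((y + w) \<bullet> \<xi>)) * f (y + w) \<partial>lborel)"
      unfolding fourier_def
      using integral_lborel_affine[OF integrable_fourier_kernel[OF f], of 1 \<xi> y] by simp
    then have "fourier f \<xi> * cnj (exp (- \<i> * of_real (y \<bullet> \<xi>)) * f y)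
      = (\<integral>w. exp (- \<i> * of_real ((y + w) \<bullet> \<xi>)) * f (y + w) * cnj (exp (- \<i> * of_real (y \<bullet> \<xi>)) * f y) \<partial>lborel)"
      by simp
    also have "\<dots> = (\<integral>w. exp (- \<i> * of_real (w \<bullet> \<xi>)) * (f (y + w) * cnj (f y)) \<partial>lborel)"
    proof (intro Bochner_Integration.integral_cong refl)
      fix w
      have X: "exp (- \<i> * of_real ((y + w) \<bullet> \<xi>)) * cnj (exp (- \<i> * of_real (y \<bullet> \<xi>))) = exp (- \<i> * of_real (w \<bullet> \<xi>))"
        by (simp add: exp_cnj inner_add_left algebra_simps flip: exp_add)
      have D: "a * u * (b * v) = (a * b) * (u * v)" for a b u v :: complex
        by (simp add: mult_ac)
      show "exp (- \<i> * of_real ((y + w) \<bullet> \<xi>)) * f (y + w) * cnj (exp (- \<i> * of_real (y \<bullet> \<xi>)) * f y)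
        = exp (- \<i> * of_real (w \<bullet> \<xi>)) * (f (y + w) * cnj (f y))"
        unfolding complex_cnj_mult by (subst D) (simp only: X)
    qed
    finally show "(\<integral>w. exp (- \<i> * of_real (w \<bullet> \<xi>)) * (f (y + w) * cnj (f y)) \<partial>lborel) =
      fourier f \<xi> * cnj (exp (- \<i> * of_real (y \<bullet> \<xi>)) * f y)" by (rule sym)
  qed
  also have "\<dots> = fourier f \<xi> * (\<integral>y. cnj (exp (- \<i> * of_real (y \<bullet> \<xi>)) * f y) \<partial>lborel)"
    by (rule integral_mult_right_zero)
  also have "(\<integral>y. cnj (exp (- \<i> * of_real (y \<bullet> \<xi>)) * f y) \<partial>lborel) = cnj (fourier f \<xi>)"
    unfolding fourier_def by (rule Bochner_Integration.integral_cnj)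
  also have "fourier f \<xi> * cnj (fourier f \<xi>) = of_real ((norm (fourier f \<xi>))\<^sup>2)"
    by (simp only: complex_norm_square)
  finally show ?E .
qed

text \<open>The squared modulus of the transform is paired with a widening Gaussian. The
  multiplication formula turns this into the autocorrelation paired with a narrowing Gaussian, hence
  in the limit into its value at 0.\<close>

theorem Plancherel:
  fixes f :: "'a::euclidean_space \<Rightarrow> complex"
  assumes f: "integrable lborel f" and fin: "l2sq f < \<infinity>"
  shows "l2sq (fourier f) = ennreal ((2 * pi) ^ DIM('a)) * l2sq f"
proof -
  have [measurable]: "f \<in> borel_measurable borel"
    using borel_measurable_integrable[OF f] by simp
  define S where "S = enn2real (l2sq f)"
  define K where "K = sqrt (2 * pi) ^ DIM('a)"
  have KK: "K * K = (2 * pi) ^ DIM('a)"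
    unfolding K_def power_mult_distrib[symmetric] by simp
  define g where "g c x = exp (- ((norm x)\<^sup>2 / (2 * c\<^sup>2)))" for c and x :: 'a
  have [measurable]: "g c \<in> borel_measurable borel" for c
    unfolding g_def by measurable
  let ?c = "\<lambda>n::nat. real (Suc n)"
  let ?A = "autocorr f"
  have gI: "integrable lborel (\<lambda>x. complex_of_real (g c x))" if "c > 0" for c
    unfolding g_def by (rule integrable_gaussian[OF that])
  \<comment> \<open>The transform of the Gaussian of width c has width 1/c and mass independent of
    c. Substituting w = z/c puts the whole dependence on c into the argument of the
    autocorrelation.\<close>
  have eq: "(\<integral>\<xi>. of_real ((norm (fourier f \<xi>))\<^sup>2 * g (?c n) \<xi>) \<partial>lborel)
      = (\<integral>z. of_real K * (?A (z /\<^sub>R ?c n) * of_real (g 1 z)) \<partial>lborel)" for n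
  proof -
    have "(\<integral>\<xi>. of_real ((norm (fourier f \<xi>))\<^sup>2 * g (?c n) \<xi>) \<partial>lborel)
        = (\<integral>\<xi>. fourier ?A \<xi> * of_real (g (?c n) \<xi>) \<partial>lborel)"
      by (simp add: fourier_autocorr[OF f])
    also have "\<dots> = (\<integral>w. ?A w * fourier (\<lambda>x. of_real (g (?c n) x)) w \<partial>lborel)"
      by (intro fourier_multiplication_formula integrable_autocorr f gI) simp
    also have "\<dots> = (\<integral>w. ?A w * of_real (K * ?c n ^ DIM('a) * exp (- ((?c n)\<^sup>2 * (norm w)\<^sup>2 / 2))) \<partial>lborel)"
      unfolding g_def by (subst fourier_gaussian) (auto simp: K_def power_mult_distrib)
    also have "\<dots> = \<bar>1 / ?c n\<bar> ^ DIM('a) *\<^sub>R (\<integral>z. ?A (0 + (1 / ?c n) *\<^sub>R z) *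
        of_real (K * ?c n ^ DIM('a) * exp (- ((?c n)\<^sup>2 * (norm (0 + (1 / ?c n) *\<^sub>R z))\<^sup>2 / 2))) \<partial>lborel)"
    proof (rule integral_lborel_affine)
      have [measurable]: "?A \<in> borel_measurable borel"
        using borel_measurable_integrable[OF integrable_autocorr[OF f]] by simp
      show "integrable lborel (\<lambda>w. ?A w * of_real (K * ?c n ^ DIM('a) * exp (- ((?c n)\<^sup>2 * (norm w)\<^sup>2 / 2))))"
      proof (rule Bochner_Integration.integrable_bound[OF integrable_mult_right[OF integrable_autocorr[OF f]]])
        show "AE w in lborel. norm (?A w * of_real (K * ?c n ^ DIM('a) * exp (- ((?c n)\<^sup>2 * (norm w)\<^sup>2 / 2))))
          \<le> norm (of_real (K * ?c n ^ DIM('a)) * ?A w)"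
        proof (rule AE_I2)
          fix w :: 'a
          define k where "k = K * ?c n ^ DIM('a)"
          have "k \<ge> 0" by (simp add: k_def K_def)
          then have "(k * norm (?A w)) * exp (- ((?c n)\<^sup>2 * (norm w)\<^sup>2 / 2)) \<le> k * norm (?A w)"
            by (intro mult_left_le) auto
          then show "norm (?A w * of_real (K * ?c n ^ DIM('a) * exp (- ((?c n)\<^sup>2 * (norm w)\<^sup>2 / 2))))
            \<le> norm (of_real (K * ?c n ^ DIM('a)) * ?A w)"
            unfolding k_def[symmetric] norm_mult norm_of_real abs_mult using \<open>k \<ge> 0\<close> by (simp add: mult_ac)
        qed
      qed measurable
    qed simp
    also have "\<dots> = \<bar>1 / ?c n\<bar> ^ DIM('a) *\<^sub>R (\<integral>z. of_real (?c n ^ DIM('a)) * (of_real K * (?A (z /\<^sub>R ?c n) * of_real (g 1 z))) \<partial>lborel)"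
    proof -
      have "?A (0 + (1 / ?c n) *\<^sub>R z) * of_real (K * ?c n ^ DIM('a) * exp (- ((?c n)\<^sup>2 * (norm (0 + (1 / ?c n) *\<^sub>R z))\<^sup>2 / 2)))
        = of_real (?c n ^ DIM('a)) * (of_real K * (?A (z /\<^sub>R ?c n) * of_real (g 1 z)))" for z
      proof -
        have "(?c n)\<^sup>2 * (norm (0 + (1 / ?c n) *\<^sub>R z))\<^sup>2 = (norm z)\<^sup>2"
          unfolding power_mult_distrib[symmetric] by simp
        moreover have "0 + (1 / ?c n) *\<^sub>R z = z /\<^sub>R ?c n"
          by (simp add: divide_inverse)
        ultimately show ?thesis
          by (simp only: g_def of_real_mult power_one mult_1_right mult_1_left mult_ac)
      qed
      then show ?thesis by presburger
    qed
    also have "\<dots> = (\<integral>z. of_real K * (?A (z /\<^sub>R ?c n) * of_real (g 1 z)) \<partial>lborel)"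
    proof -
      have c1: "\<bar>1 / ?c n\<bar> ^ DIM('a) * ?c n ^ DIM('a) = 1"
        unfolding power_mult_distrib[symmetric] by simp
      have "(\<integral>z. of_real (?c n ^ DIM('a)) * (of_real K * (?A (z /\<^sub>R ?c n) * of_real (g 1 z))) \<partial>lborel)
        = of_real (?c n ^ DIM('a)) * (\<integral>z. of_real K * (?A (z /\<^sub>R ?c n) * of_real (g 1 z)) \<partial>lborel)"
        by (rule integral_mult_right_zero)
      then show ?thesis
        by (simp only: scaleR_conv_of_real mult.assoc[symmetric] of_real_mult[symmetric] c1) simp
    qed
    finally show ?thesis .
  qed
  have lim0: "(\<lambda>n. z /\<^sub>R ?c n) \<longlonglongrightarrow> 0" for z :: 'a
  proof -
    have "(\<lambda>n. inverse (?c n) *\<^sub>R z) \<longlonglongrightarrow> 0 *\<^sub>R z"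
      by (intro tendsto_scaleR LIMSEQ_inverse_real_of_nat tendsto_const)
    then show ?thesis by simp
  qed
  have "(\<lambda>n. \<integral>z. of_real K * (?A (z /\<^sub>R ?c n) * of_real (g 1 z)) \<partial>lborel)
      \<longlonglongrightarrow> (\<integral>z. of_real K * (?A 0 * of_real (g 1 z)) \<partial>lborel)"
  proof (rule integral_dominated_convergence[where w="\<lambda>z. K * (S * g 1 z)"])
    have [measurable]: "?A \<in> borel_measurable borel"
      using borel_measurable_integrable[OF integrable_autocorr[OF f]] by simp
    show "(\<lambda>z. of_real K * (?A (z /\<^sub>R ?c n) * of_real (g 1 z))) \<in> borel_measurable lborel" for n
      by measurable
    show "integrable lborel (\<lambda>z. K * (S * g 1 z))"
      using gI[of 1] by (intro integrable_mult_right) (simp add: complex_of_real_integrable_eq)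
    show "AE z in lborel. (\<lambda>n. of_real K * (?A (z /\<^sub>R ?c n) * of_real (g 1 z))) \<longlonglongrightarrow> of_real K * (?A 0 * of_real (g 1 z))"
      by (intro AE_I2 tendsto_intros autocorr_tendsto lim0 fin) measurable
    show "AE z in lborel. norm (of_real K * (?A (z /\<^sub>R ?c n) * of_real (g 1 z))) \<le> K * (S * g 1 z)" for n
      using norm_autocorr_le[OF _ fin]
      by (intro AE_I2) (simp add: norm_mult g_def S_def K_def del: of_real_power)
  qed simp
  also have "(\<integral>z. of_real K * (?A 0 * of_real (g 1 z)) \<partial>lborel) = of_real K * (of_real S * (\<integral>z. of_real (g 1 z) \<partial>lborel))"
    using fin by (simp add: autocorr_0 S_def)
  \<comment> \<open>One factor K comes from the height of the transformed Gaussian, the second from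
    the integral of the limiting Gaussian; together they make the Plancherel constant.\<close>
  also have "(\<integral>z. complex_of_real (g 1 z) \<partial>lborel) = of_real K"
    using fourier_gaussian[of 1 "0::'a"] by (simp add: fourier_def g_def K_def)
  also have "of_real K * (of_real S * of_real K) = (of_real ((2 * pi) ^ DIM('a) * S) :: complex)"
    unfolding KK[symmetric] by simp
  finally have "(\<lambda>n. Re (\<integral>\<xi>. of_real ((norm (fourier f \<xi>))\<^sup>2 * g (?c n) \<xi>) \<partial>lborel)) \<longlonglongrightarrow> Re (of_real ((2 * pi) ^ DIM('a) * S))"
    unfolding eq by (rule tendsto_Re)
  then have "(\<lambda>n. \<integral>\<xi>. (norm (fourier f \<xi>))\<^sup>2 * g (?c n) \<xi> \<partial>lborel) \<longlonglongrightarrow> (2 * pi) ^ DIM('a) * S"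
    unfolding integral_complex_of_real by simp
  then have "(\<lambda>n. ennreal (\<integral>\<xi>. (norm (fourier f \<xi>))\<^sup>2 * g (?c n) \<xi> \<partial>lborel)) \<longlonglongrightarrow> ennreal ((2 * pi) ^ DIM('a) * S)"
    by (rule tendsto_ennrealI)
  moreover have "ennreal (\<integral>\<xi>. (norm (fourier f \<xi>))\<^sup>2 * g (?c n) \<xi> \<partial>lborel)
      = (\<integral>\<^sup>+\<xi>. ennreal ((norm (fourier f \<xi>))\<^sup>2 * g (?c n) \<xi>) \<partial>lborel)" for n
  proof (rule nn_integral_eq_integral[symmetric])
    define B where "B = (\<integral>x. norm (f x) \<partial>lborel)"
    have B: "norm (fourier f \<xi>) \<le> B" for \<xi>
      unfolding fourier_def B_def
      using integral_norm_bound[of lborel "\<lambda>x. exp (- \<i> * of_real (x \<bullet> \<xi>)) * f x"] by (simp add: norm_mult)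
    show "integrable lborel (\<lambda>\<xi>. (norm (fourier f \<xi>))\<^sup>2 * g (?c n) \<xi>)"
    proof (rule Bochner_Integration.integrable_bound)
      show "integrable lborel (\<lambda>\<xi>. B\<^sup>2 * g (?c n) \<xi>)"
        using gI[of "?c n"] by (intro integrable_mult_right) (simp add: complex_of_real_integrable_eq)
      show "AE \<xi> in lborel. norm ((norm (fourier f \<xi>))\<^sup>2 * g (?c n) \<xi>) \<le> norm (B\<^sup>2 * g (?c n) \<xi>)"
        by (intro AE_I2) (auto simp: g_def abs_mult intro!: mult_right_mono power_mono B)
    qed measurable
  qed (auto simp: g_def)
  \<comment> \<open>Monotone convergence on this side: the Gaussians increase to 1, so square
    integrability of the transform is a conclusion and need not be known in advance.\<close>
  moreover have "(\<lambda>n. \<integral>\<^sup>+\<xi>. ennreal ((norm (fourier f \<xi>))\<^sup>2 * g (?c n) \<xi>) \<partial>lborel) \<longlonglongrightarrow> l2sq (fourier f)"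
    unfolding l2sq_def
  proof (rule nn_integral_LIMSEQ)
    have "incseq (\<lambda>n. g (?c n) \<xi>)" for \<xi>
      unfolding g_def
      by (intro incseq_SucI) (auto intro!: divide_left_mono power_mono mult_pos_pos)
    then show "incseq (\<lambda>n \<xi>. ennreal ((norm (fourier f \<xi>))\<^sup>2 * g (?c n) \<xi>))"
      by (auto simp: incseq_def le_fun_def intro!: ennreal_leI mult_left_mono)
    show "(\<lambda>n. ennreal ((norm (fourier f \<xi>))\<^sup>2 * g (?c n) \<xi>)) \<longlonglongrightarrow> ennreal ((norm (fourier f \<xi>))\<^sup>2)" for \<xi>
    proof -
      have "(\<lambda>n. (norm (fourier f \<xi>))\<^sup>2 * exp (- ((norm (\<xi> /\<^sub>R ?c n))\<^sup>2 / 2))) \<longlonglongrightarrow> (norm (fourier f \<xi>))\<^sup>2 * exp (- ((norm (0::'a))\<^sup>2 / 2))"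
        by (intro tendsto_intros lim0) simp
      moreover have "exp (- ((norm (\<xi> /\<^sub>R ?c n))\<^sup>2 / 2)) = g (?c n) \<xi>" for n
      proof -
        have "norm (\<xi> /\<^sub>R ?c n) = norm \<xi> / ?c n"
          by (simp add: divide_inverse mult.commute)
        then show ?thesis
          unfolding g_def by (simp only: power_divide) (simp add: mult.commute)
      qed
      ultimately show ?thesis
        by (intro tendsto_ennrealI) (simp only: norm_zero, simp)
    qed
  qed measurable
  ultimately have "l2sq (fourier f) = ennreal ((2 * pi) ^ DIM('a) * S)"
    by (intro LIMSEQ_unique) simp_all
  also have "\<dots> = ennreal ((2 * pi) ^ DIM('a)) * l2sq f"
    using fin by (simp add: S_def ennreal_mult)
  finally show ?thesis .
qed

section \<open>The mean square Fourier transform\<close>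

lemma l2sq_cong_AE: "(AE x in lborel. f x = g x) \<Longrightarrow> l2sq f = l2sq g"
  unfolding l2sq_def by (rule nn_integral_cong_AE) auto

text \<open>The Riesz-Fischer argument, with the Cauchy rate \<open>a\<close> kept explicit because
  Fatou hands the same rate to the limit. A rapidly convergent subsequence converges almost
  everywhere and defines h.\<close>

lemma l2_complete:
  fixes F :: "nat \<Rightarrow> 'a::euclidean_space \<Rightarrow> complex"
  assumes F[measurable]: "\<And>n. F n \<in> borel_measurable borel"
    and le: "\<And>m n. n \<le> m \<Longrightarrow> l2sq (\<lambda>x. F m x - F n x) \<le> a n"
    and a: "a \<longlonglongrightarrow> 0"
  obtains h where "h \<in> borel_measurable borel" "\<And>n. l2sq (\<lambda>x. h x - F n x) \<le> a n"
proof -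
  have "\<exists>N. \<forall>n\<ge>N. a n < ennreal ((1/8)^i)" for i
    using order_tendstoD(2)[OF a, of "ennreal ((1/8)^i)"]
    by (auto simp: eventually_sequentially ennreal_less_zero_iff)
  then obtain N where N: "\<And>i n. n \<ge> N i \<Longrightarrow> a n < ennreal ((1/8)^i)"
    by metis
  \<comment> \<open>Partial sums of N, plus i, make the indices nondecreasing, at least i and at
    least N i at once.\<close>
  define k where "k i = i + (\<Sum>j\<le>i. N j)" for i
  have k_N: "N i \<le> k i" and k_i: "i \<le> k i" and k_Suc: "k i \<le> k (Suc i)" for i
    unfolding k_def using member_le_sum[of i "{..i}" N] by auto
  define D where "D i x = F (k (Suc i)) x - F (k i) x" for i x
  have [measurable]: "D i \<in> borel_measurable borel" for i
    unfolding D_def by measurable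
  have "(\<integral>\<^sup>+x. (\<Sum>i. ennreal (2^i * (norm (D i x))\<^sup>2)) \<partial>lborel) = (\<Sum>i. \<integral>\<^sup>+x. ennreal (2^i * (norm (D i x))\<^sup>2) \<partial>lborel)"
    by (rule nn_integral_suminf) measurable
  also have "\<dots> \<le> (\<Sum>i. ennreal ((1/4)^i))"
  proof (intro suminf_le summableI)
    fix i
    have "(\<integral>\<^sup>+x. ennreal (2^i * (norm (D i x))\<^sup>2) \<partial>lborel) = ennreal (2^i) * l2sq (D i)"
      by (simp add: ennreal_mult nn_integral_cmult l2sq_def)
    also have "l2sq (D i) \<le> a (k i)"
      unfolding D_def by (rule le[OF k_Suc])
    also have "a (k i) \<le> ennreal ((1/8)^i)"
      using N[OF k_N] by (rule less_imp_le)
    also have "ennreal (2^i) * ennreal ((1/8)^i) = ennreal ((1/4)^i)"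
      by (subst ennreal_mult[symmetric]) (simp_all flip: power_mult_distrib)
    finally show "(\<integral>\<^sup>+x. ennreal (2^i * (norm (D i x))\<^sup>2) \<partial>lborel) \<le> ennreal ((1/4)^i)"
      by (simp add: mult_left_mono)
  qed
  also have "\<dots> < \<infinity>"
    using summable_geometric[of "1/4::real"]
    by (subst suminf_ennreal2) auto
  finally have "AE x in lborel. (\<Sum>i. ennreal (2^i * (norm (D i x))\<^sup>2)) \<noteq> \<infinity>"
    by (intro nn_integral_PInf_AE) auto
  then have conv: "AE x in lborel. convergent (\<lambda>i. F (k i) x)"
  proof eventually_elim
    fix x assume "(\<Sum>i. ennreal (2^i * (norm (D i x))\<^sup>2)) \<noteq> \<infinity>"
    then have s: "summable (\<lambda>i. 2^i * (norm (D i x))\<^sup>2)"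
      by (intro summable_suminf_not_top) auto
    have "summable (\<lambda>i. (1/2)^i + 2^i * (norm (D i x))\<^sup>2)"
      by (intro summable_add s summable_geometric) auto
    then have "summable (\<lambda>i. D i x)"
    proof (rule summable_comparison_test')
      fix i :: nat assume "i \<ge> 0"
      \<comment> \<open>The weight 2^i trades square summability of the increments for summability:
        the arithmetic-geometric mean inequality splits off 2^(-i). The threshold (1/8)^i leaves
        (1/4)^i after weighting.\<close>
      have "2 * norm (D i x) * 1 \<le> (1/2)^i + 2^i * (norm (D i x))\<^sup>2"
      proof -
        have "0 \<le> 2^i * (norm (D i x) - (1/2)^i)\<^sup>2"
          by simp
        also have "\<dots> = (1/2)^i + 2^i * (norm (D i x))\<^sup>2 - 2 * norm (D i x)"
          by (simp add: power2_diff algebra_simps power_divide power2_eq_square)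
        finally show ?thesis by simp
      qed
      then show "norm (D i x) \<le> (1/2)^i + 2^i * (norm (D i x))\<^sup>2"
        using norm_ge_zero[of "D i x"] by linarith
    qed
    then have "convergent (\<lambda>i. F (k 0) x + (\<Sum>j<i. D j x))"
      by (intro convergent_add convergent_const) (simp add: summable_iff_convergent)
    also have "(\<lambda>i. F (k 0) x + (\<Sum>j<i. D j x)) = (\<lambda>i. F (k i) x)"
      unfolding D_def by (subst sum_lessThan_telescope) simp
    finally show "convergent (\<lambda>i. F (k i) x)" .
  qed
  define h where "h x = lim (\<lambda>i. F (k i) x)" for x
  have [measurable]: "h \<in> borel_measurable borel"
    unfolding h_def by measurable
  have "l2sq (\<lambda>x. h x - F n x) \<le> a n" for n
  proof -
    have "l2sq (\<lambda>x. h x - F n x) = (\<integral>\<^sup>+x. liminf (\<lambda>i. ennreal ((norm (F (k i) x - F n x))\<^sup>2)) \<partial>lborel)"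
      unfolding l2sq_def
    proof (rule nn_integral_cong_AE)
      show "AE x in lborel. ennreal ((norm (h x - F n x))\<^sup>2) = liminf (\<lambda>i. ennreal ((norm (F (k i) x - F n x))\<^sup>2))"
        using conv
      proof eventually_elim
        fix x assume "convergent (\<lambda>i. F (k i) x)"
        then have "(\<lambda>i. F (k i) x) \<longlonglongrightarrow> h x"
          by (simp add: h_def convergent_LIMSEQ_iff)
        then have "(\<lambda>i. ennreal ((norm (F (k i) x - F n x))\<^sup>2)) \<longlonglongrightarrow> ennreal ((norm (h x - F n x))\<^sup>2)"
          by (intro tendsto_ennrealI tendsto_intros)
        then show "ennreal ((norm (h x - F n x))\<^sup>2) = liminf (\<lambda>i. ennreal ((norm (F (k i) x - F n x))\<^sup>2))"
          by (metis lim_imp_Liminf sequentially_bot)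
      qed
    qed
    also have "\<dots> \<le> liminf (\<lambda>i. l2sq (\<lambda>x. F (k i) x - F n x))"
      unfolding l2sq_def by (rule nn_integral_liminf) measurable
    also have "\<dots> \<le> limsup (\<lambda>i. l2sq (\<lambda>x. F (k i) x - F n x))"
      by (rule Liminf_le_Limsup) simp
    also have "\<dots> \<le> a n"
    proof (rule Limsup_bounded)
      show "\<forall>\<^sub>F i in sequentially. l2sq (\<lambda>x. F (k i) x - F n x) \<le> a n"
        using eventually_ge_at_top[of n]
        by eventually_elim (intro le order_trans[OF _ k_i])
    qed
    finally show ?thesis .
  qed
  then show ?thesis
    using that[of h] by simp
qed

section \<open>Borel representatives and truncations\<close>

lemma lebesgue_borel_rep:
  fixes f :: "'a::euclidean_space \<Rightarrow> complex"
  assumes "f \<in> borel_measurable lebesgue"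
  obtains g where "g \<in> borel_measurable borel" "AE x in lborel. f x = g x"
proof -
  have "(\<lambda>x. Re (f x)) \<in> borel_measurable lebesgue" "(\<lambda>x. Im (f x)) \<in> borel_measurable lebesgue"
    using assms by measurable
  then obtain u v where [measurable]: "u \<in> borel_measurable borel" "v \<in> borel_measurable borel"
    and ae: "AE x in lborel. Re (f x) = u x" "AE x in lborel. Im (f x) = v x"
    using completion_ex_borel_measurable_real[of "\<lambda>x. Re (f x)" lborel]
      completion_ex_borel_measurable_real[of "\<lambda>x. Im (f x)" lborel] by auto
  show ?thesis
  proof (rule that[of "\<lambda>x. Complex (u x) (v x)"])
    show "(\<lambda>x. Complex (u x) (v x)) \<in> borel_measurable borel"
      unfolding Complex_eq by measurable
    show "AE x in lborel. f x = Complex (u x) (v x)"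
      using ae by eventually_elim (simp add: complex_eq_iff)
  qed
qed

lemma L2_iff: "f \<in> L2 \<longleftrightarrow> f \<in> borel_measurable lebesgue \<and> l2sq f < \<infinity>"
proof -
  have "integrable lebesgue (\<lambda>x. (norm (f x))\<^sup>2) \<longleftrightarrow> l2sq f < \<infinity>" if [measurable]: "f \<in> borel_measurable lebesgue"
    unfolding integrable_iff_bounded l2sq_def nn_integral_completion by simp
  then show ?thesis
    by (auto simp: L2_def)
qed

lemma L2_borel: "f \<in> borel_measurable borel \<Longrightarrow> l2sq f < \<infinity> \<Longrightarrow> f \<in> L2"
  by (auto simp: L2_iff intro: measurable_completion)

lemma L2_norm_eq: "f \<in> L2 \<Longrightarrow> (ennreal (L2_norm f))\<^sup>2 = l2sq f"
  unfolding L2_norm_def l2sq_def L2_def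
  by (subst nn_integral_completion[symmetric])
     (auto simp: ennreal_power nn_integral_eq_integral)

lemma L2_rep:
  assumes "f \<in> L2"
  obtains g where "g \<in> borel_measurable borel" "AE x in lborel. f x = g x" "l2sq g = l2sq f" "l2sq g < \<infinity>"
  using assms lebesgue_borel_rep[of f] l2sq_cong_AE[of f] by (metis L2_iff)

definition trunc :: "('a::euclidean_space \<Rightarrow> complex) \<Rightarrow> real \<Rightarrow> 'a \<Rightarrow> complex" where
  "trunc f r x = (if norm x < r then f x else 0)"

lemma trunc_measurable [measurable]:
  assumes [measurable]: "f \<in> borel_measurable borel"
  shows "trunc f r \<in> borel_measurable borel"
  unfolding trunc_def[abs_def] by measurable

lemma l2sq_mono: "(\<And>x. norm (f x) \<le> norm (g x)) \<Longrightarrow> l2sq f \<le> l2sq g"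
  unfolding l2sq_def by (intro nn_integral_mono ennreal_leI power_mono) auto

lemma l2sq_trunc_le: "l2sq (trunc f r) \<le> l2sq f"
  by (rule l2sq_mono) (simp add: trunc_def)

lemma l2sq_indicator_ball: "l2sq (indicator (ball (0::'a::euclidean_space) r)) < \<infinity>"
proof -
  have "l2sq (indicator (ball (0::'a) r)) = (\<integral>\<^sup>+x. indicator (ball (0::'a) r) x \<partial>lborel)"
    unfolding l2sq_def by (intro nn_integral_cong) (auto simp: indicator_def)
  also have "\<dots> = emeasure lborel (ball (0::'a) r)"
    by simp
  also have "\<dots> < \<infinity>"
    using emeasure_bounded_finite[of "ball (0::'a) r"] by simp
  finally show ?thesis .
qed

lemma integrable_trunc:
  assumes [measurable]: "f \<in> borel_measurable borel" and "l2sq f < \<infinity>"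
  shows "integrable lborel (trunc f r)"
proof -
  have "integrable lborel (\<lambda>x. f x * indicator (ball 0 r) x)"
    by (rule integrable_l2_mult) (use assms l2sq_indicator_ball in \<open>auto intro: borel_measurable_indicator\<close>)
  also have "(\<lambda>x. f x * indicator (ball 0 r) x) = trunc f r"
    by (auto simp: trunc_def indicator_def fun_eq_iff)
  finally show ?thesis .
qed

text \<open>Replaces an L2 element by a Borel representative. Measurability of the integrand
  containing f is recovered from a.e. equality, Lebesgue measure being complete.\<close>

lemma fourier_trunc_eq:
  assumes [measurable]: "g \<in> borel_measurable borel" and ae: "AE x in lborel. f x = g x"
  shows "fourier_trunc f r = fourier (trunc g r)"
proof
  fix \<xi>
  have "fourier_trunc f r \<xi> = (LINT x|lebesgue. indicator (ball 0 r) x *\<^sub>R (exp (- \<i> * of_real (x \<bullet> \<xi>)) * f x))"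
    by (simp add: fourier_trunc_def set_lebesgue_integral_def)
  also have "\<dots> = (LINT x|lebesgue. exp (- \<i> * of_real (x \<bullet> \<xi>)) * trunc g r x)"
  proof (rule integral_cong_AE)
    have m: "(\<lambda>x. indicator (ball 0 r) x *\<^sub>R (exp (- \<i> * of_real (x \<bullet> \<xi>)) * g x)) \<in> borel_measurable lebesgue"
      by (intro measurable_completion borel_measurable_scaleR borel_measurable_indicator) auto
    show e: "AE x in lebesgue. indicator (ball 0 r) x *\<^sub>R (exp (- \<i> * of_real (x \<bullet> \<xi>)) * f x)
       = exp (- \<i> * of_real (x \<bullet> \<xi>)) * trunc g r x"
      using AE_completion[OF ae] by eventually_elim (auto simp: trunc_def indicator_def)
    show m2: "(\<lambda>x. exp (- \<i> * of_real (x \<bullet> \<xi>)) * trunc g r x) \<in> borel_measurable lebesgue"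
      by (intro measurable_completion) simp
    show "(\<lambda>x. indicator (ball 0 r) x *\<^sub>R (exp (- \<i> * of_real (x \<bullet> \<xi>)) * f x)) \<in> borel_measurable lebesgue"
    proof -
      have "AE x in lebesgue. exp (- \<i> * of_real (x \<bullet> \<xi>)) * trunc g r x
        = indicator (ball 0 r) x *\<^sub>R (exp (- \<i> * of_real (x \<bullet> \<xi>)) * f x)"
        using e by eventually_elim simp
      then show ?thesis
        by (rule borel_measurable_AE[OF m2])
    qed
  qed
  also have "\<dots> = fourier (trunc g r) \<xi>"
    unfolding fourier_def by (rule integral_completion) simp
  finally show "fourier_trunc f r \<xi> = fourier (trunc g r) \<xi>" .
qed

section \<open>Existence, uniqueness and inversion for the L2 transform\<close>

lemma fourier_diff:
  assumes "integrable lborel f" "integrable lborel g"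
  shows "fourier (\<lambda>x. f x - g x) \<xi> = fourier f \<xi> - fourier g \<xi>"
  unfolding fourier_def right_diff_distrib
  by (intro Bochner_Integration.integral_diff integrable_fourier_kernel assms)

text \<open>The property under \<open>SOME\<close> in \<open>fourier_L2\<close>, with the error
  measured by \<open>l2sq\<close>, i.e. over \<open>lborel\<close>.\<close>

definition is_fourier_L2 :: "('a::euclidean_space \<Rightarrow> complex) \<Rightarrow> ('a \<Rightarrow> complex) \<Rightarrow> bool" where
  "is_fourier_L2 g h \<longleftrightarrow> h \<in> L2 \<and> (\<lambda>n. l2sq (\<lambda>\<xi>. h \<xi> - fourier_trunc g (real n) \<xi>)) \<longlonglongrightarrow> 0"

lemma fourier_L2_eq_SOME: "fourier_L2 g = (SOME h. is_fourier_L2 g h)"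
  unfolding fourier_L2_def is_fourier_L2_def l2sq_def nn_integral_completion ..

lemma l2sq_trunc_tendsto:
  assumes [measurable]: "g \<in> borel_measurable borel" and "l2sq g < \<infinity>"
  shows "(\<lambda>n. l2sq (\<lambda>x. g x - trunc g (real n) x)) \<longlonglongrightarrow> 0"
  unfolding trunc_def
proof (rule l2sq_cutoff_tendsto)
  show "\<forall>\<^sub>F n in sequentially. norm x < real n" for x :: 'a
    using eventually_gt_at_top[of "nat \<lceil>norm x\<rceil>"] by eventually_elim linarith
qed (use assms in measurable)

text \<open>Plancherel applied to differences of truncations shows that their transforms are Cauchy.
  The factor 2 in the bound is inherited from \<open>l2sq_add\<close>; only some constant depending
  on the dimension matters later.\<close>

lemma is_fourier_L2_exists:
  fixes f :: "'a::euclidean_space \<Rightarrow> complex"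
  assumes "f \<in> L2"
  obtains h where "is_fourier_L2 f h" "h \<in> borel_measurable borel" "l2sq h \<le> 2 * (ennreal ((2 * pi) ^ DIM('a)) * l2sq f)"
proof -
  obtain g where g[measurable]: "g \<in> borel_measurable borel" and ae: "AE x in lborel. f x = g x"
    and fin: "l2sq g < \<infinity>" and eq: "l2sq g = l2sq f"
    using L2_rep[OF assms] by metis
  let ?K = "ennreal ((2 * pi) ^ DIM('a))"
  define F where "F n = fourier (trunc g (real n))" for n
  have [measurable]: "F n \<in> borel_measurable borel" for n
    unfolding F_def by measurable
  have fint: "l2sq (trunc g r) < \<infinity>" for r
    using l2sq_trunc_le[of g r] fin by (rule le_less_trans)
  define a where "a n = ?K * l2sq (\<lambda>x. g x - trunc g (real n) x)" for n
  have "l2sq (\<lambda>\<xi>. F m \<xi> - F n \<xi>) \<le> a n" if "n \<le> m" for m n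
  proof -
    let ?d = "\<lambda>x. trunc g (real m) x - trunc g (real n) x"
    have le: "l2sq ?d \<le> l2sq (\<lambda>x. g x - trunc g (real n) x)"
      using that by (intro l2sq_mono) (auto simp: trunc_def)
    have "l2sq (\<lambda>\<xi>. F m \<xi> - F n \<xi>) = l2sq (fourier ?d)"
      unfolding F_def by (intro arg_cong[where f=l2sq] ext fourier_diff[symmetric] integrable_trunc g fin)
    also have "l2sq (fourier ?d) = ?K * l2sq ?d"
    proof (rule Plancherel)
      show "integrable lborel ?d"
        by (intro Bochner_Integration.integrable_diff integrable_trunc fin g)
      have "l2sq ?d \<le> l2sq g"
        by (intro l2sq_mono) (auto simp: trunc_def)
      then show "l2sq ?d < \<infinity>"
        using fin by (rule le_less_trans)
    qed
    finally show ?thesis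
      using le by (simp add: a_def mult_left_mono)
  qed
  moreover have "a \<longlonglongrightarrow> 0"
  proof -
    have "a \<longlonglongrightarrow> ?K * 0"
      unfolding a_def by (intro tendsto_mult_ennreal tendsto_const l2sq_trunc_tendsto g fin) auto
    then show ?thesis by simp
  qed
  ultimately obtain h where h[measurable]: "h \<in> borel_measurable borel" and le: "\<And>n. l2sq (\<lambda>x. h x - F n x) \<le> a n"
    by (rule l2_complete[rotated]) auto
  have lim: "(\<lambda>n. l2sq (\<lambda>x. h x - F n x)) \<longlonglongrightarrow> 0"
    by (rule tendsto_0_le_ennreal[OF \<open>a \<longlonglongrightarrow> 0\<close> le])
  have hle: "l2sq h \<le> 2 * l2sq (\<lambda>x. h x - F n x) + 2 * (?K * l2sq g)" for n
  proof -
    have "l2sq h = l2sq (\<lambda>x. (h x - F n x) + F n x)" by simp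
    also have "\<dots> \<le> 2 * l2sq (\<lambda>x. h x - F n x) + 2 * l2sq (F n)"
      by (rule l2sq_add) measurable
    also have "l2sq (F n) = ?K * l2sq (trunc g (real n))"
      unfolding F_def by (intro Plancherel integrable_trunc g fin fint)
    also have "\<dots> \<le> ?K * l2sq g"
      by (intro mult_left_mono l2sq_trunc_le) simp
    finally show ?thesis by (simp add: add_left_mono mult_left_mono)
  qed
  have "(\<lambda>n. 2 * l2sq (\<lambda>x. h x - F n x) + 2 * (?K * l2sq g)) \<longlonglongrightarrow> 2 * 0 + 2 * (?K * l2sq g)"
    by (intro tendsto_add tendsto_mult_ennreal tendsto_const lim) auto
  then have hb: "l2sq h \<le> 2 * (?K * l2sq g)"
    using LIMSEQ_le_const[of _ "2 * 0 + 2 * (?K * l2sq g)" "l2sq h"] hle by simp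
  also have "\<dots> < \<infinity>"
    using fin by (simp add: ennreal_mult_less_top)
  finally have "h \<in> L2"
    by (intro L2_borel) auto
  then have "is_fourier_L2 f h"
    using lim by (simp add: is_fourier_L2_def fourier_trunc_eq[OF g ae] F_def)
  then show ?thesis
    using that hb eq h by simp
qed

lemma is_fourier_L2_unique:
  assumes f: "f \<in> L2" and "is_fourier_L2 f h1" "is_fourier_L2 f h2"
  shows "AE x in lborel. h1 x = h2 x"
proof -
  obtain g where g[measurable]: "g \<in> borel_measurable borel" and ae: "AE x in lborel. f x = g x"
    using L2_rep[OF f] by metis
  define F where "F n = fourier (trunc g (real n))" for n
  have [measurable]: "F n \<in> borel_measurable borel" for n
    unfolding F_def by measurable
  have *: "\<exists>u. u \<in> borel_measurable borel \<and> (AE x in lborel. h x = u x) \<and> (\<lambda>n. l2sq (\<lambda>x. u x - F n x)) \<longlonglongrightarrow> 0"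
    if h: "is_fourier_L2 f h" for h
  proof -
    obtain u where u: "u \<in> borel_measurable borel" "AE x in lborel. h x = u x"
      using h L2_rep[of h] unfolding is_fourier_L2_def by metis
    moreover have "l2sq (\<lambda>x. h x - F n x) = l2sq (\<lambda>x. u x - F n x)" for n
      by (rule l2sq_cong_AE) (use u(2) in eventually_elim, simp)
    ultimately show ?thesis
      using h by (auto simp: is_fourier_L2_def fourier_trunc_eq[OF g ae] F_def)
  qed
  obtain u where u[measurable]: "u \<in> borel_measurable borel" "AE x in lborel. h1 x = u x"
    "(\<lambda>n. l2sq (\<lambda>x. u x - F n x)) \<longlonglongrightarrow> 0"
    using *[OF assms(2)] by auto
  obtain v where v[measurable]: "v \<in> borel_measurable borel" "AE x in lborel. h2 x = v x"
    "(\<lambda>n. l2sq (\<lambda>x. v x - F n x)) \<longlonglongrightarrow> 0"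
    using *[OF assms(3)] by auto
  have "l2sq (\<lambda>x. u x - v x) \<le> 2 * l2sq (\<lambda>x. u x - F n x) + 2 * l2sq (\<lambda>x. v x - F n x)" for n
  proof -
    have "l2sq (\<lambda>x. u x - v x) = l2sq (\<lambda>x. (u x - F n x) - (v x - F n x))" by simp
    also have "\<dots> \<le> 2 * l2sq (\<lambda>x. u x - F n x) + 2 * l2sq (\<lambda>x. v x - F n x)"
      by (rule l2sq_diff) measurable
    finally show ?thesis .
  qed
  moreover have "(\<lambda>n. 2 * l2sq (\<lambda>x. u x - F n x) + 2 * l2sq (\<lambda>x. v x - F n x)) \<longlonglongrightarrow> 2 * 0 + 2 * 0"
    by (intro tendsto_add tendsto_mult_ennreal tendsto_const u(3) v(3)) auto
  ultimately have "l2sq (\<lambda>x. u x - v x) \<le> 2 * 0 + 2 * 0"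
    by (intro LIMSEQ_le_const) auto
  then have "AE x in lborel. ennreal ((norm (u x - v x))\<^sup>2) = 0"
    unfolding l2sq_def by (subst nn_integral_0_iff_AE[symmetric]) auto
  with u(2) v(2) show ?thesis
    by eventually_elim simp
qed

text \<open>Makes \<open>SOME\<close> usable: any function with the defining limit property agrees
  a.e. with the chosen one.\<close>

lemma fourier_L2_eqI:
  assumes "f \<in> L2" "is_fourier_L2 f h"
  shows "AE x in lborel. fourier_L2 f x = h x"
  unfolding fourier_L2_eq_SOME
  by (rule is_fourier_L2_unique[OF assms(1) someI[of "is_fourier_L2 f"]]) (rule assms(2))+

corollary fourier_L2_rep:
  fixes f :: "'a::euclidean_space \<Rightarrow> complex"
  assumes "f \<in> L2"
  obtains h where "h \<in> borel_measurable borel" "AE x in lborel. fourier_L2 f x = h x"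
    "l2sq h \<le> 2 * (ennreal ((2 * pi) ^ DIM('a)) * l2sq f)"
  using is_fourier_L2_exists[OF assms] fourier_L2_eqI[OF assms] by metis

lemma
  assumes [measurable]: "f \<in> borel_measurable borel" and fin: "l2sq f < \<infinity>"
  shows integrable_norm_sq: "integrable lborel (\<lambda>x. (norm (f x))\<^sup>2)"
    and l2sq_eq_integral: "l2sq f = ennreal (\<integral>x. (norm (f x))\<^sup>2 \<partial>lborel)"
proof -
  show "integrable lborel (\<lambda>x. (norm (f x))\<^sup>2)"
    using fin by (simp add: integrable_iff_bounded l2sq_def)
  then show "l2sq f = ennreal (\<integral>x. (norm (f x))\<^sup>2 \<partial>lborel)"
    unfolding l2sq_def by (rule nn_integral_eq_integral) auto
qed

lemma norm_diff_sq: "(norm (a - b :: complex))\<^sup>2 = (norm a)\<^sup>2 + (norm b)\<^sup>2 - 2 * Re (b * cnj a)"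
  unfolding cmod_power2 by (simp add: power2_eq_square algebra_simps)

text \<open>The truncations converge because
  \<open>\<parallel>H - G\<^sub>n\<parallel>\<^sup>2 = \<parallel>H\<parallel>\<^sup>2 - (2\<pi>)\<^sup>d \<parallel>F 1\<^bsub>B(0,n)\<^esub>\<parallel>\<^sup>2\<close>, where \<open>G\<^sub>n\<close> is the transform of the
  truncation of \<open>F\<close>; the cross term is evaluated with the multiplication formula.\<close>

theorem fourier_L2_inversion:
  fixes H :: "'a::euclidean_space \<Rightarrow> complex"
  assumes H: "integrable lborel H" and fin: "l2sq H < \<infinity>"
  defines "F \<equiv> \<lambda>x. fourier H (- x) / of_real ((2 * pi) ^ DIM('a))"
  shows "F \<in> borel_measurable borel" "l2sq F \<le> l2sq H" "F \<in> L2" "AE x in lborel. fourier_L2 F x = H x"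
proof -
  have [measurable]: "H \<in> borel_measurable borel"
    using borel_measurable_integrable[OF H] by simp
  show F[measurable]: "F \<in> borel_measurable borel"
    unfolding F_def by measurable
  define K where "K = (2 * pi) ^ DIM('a)"
  have K: "K \<ge> 1"
    unfolding K_def using pi_ge_two by (intro one_le_power) simp
  have "l2sq (fourier H) = l2sq (\<lambda>x. fourier H (- x))"
    unfolding l2sq_def
    by (subst nn_integral_lborel_affine[where t=0 and c="-1"]) auto
  also have "\<dots> = l2sq (\<lambda>x. of_real K * F x)"
    using K by (simp add: F_def K_def)
  also have "\<dots> = ennreal (K\<^sup>2) * l2sq F"
    unfolding l2sq_def norm_mult norm_of_real power_mult_distrib
    by (simp add: ennreal_mult nn_integral_cmult)
  finally have "ennreal (K\<^sup>2) * l2sq F = ennreal K * l2sq H"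
    using Plancherel[OF H fin] by (simp add: K_def)
  then have "ennreal (1 / K) * (ennreal (K\<^sup>2) * l2sq F) = ennreal (1 / K) * (ennreal K * l2sq H)"
    by simp
  moreover have "1 / K * K\<^sup>2 = K" "1 / K * K = 1"
    using K by (simp_all add: power2_eq_square)
  ultimately have FH: "ennreal K * l2sq F = l2sq H"
    using K by (simp add: mult.assoc[symmetric] ennreal_mult[symmetric])
  \<comment> \<open>The exact relation has the factor K = (2 pi)^d; since K is at least 1, dropping
    it leaves a bound free of constants.\<close>
  show le: "l2sq F \<le> l2sq H"
  proof -
    have "1 * l2sq F \<le> ennreal K * l2sq F"
      using K by (intro mult_right_mono) auto
    then show ?thesis using FH by simp
  qed
  then have finF: "l2sq F < \<infinity>"
    using fin by (rule le_less_trans)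
  then show FL: "F \<in> L2"
    by (intro L2_borel F)
  define G where "G n = fourier (trunc F (real n))" for n
  have [measurable]: "G n \<in> borel_measurable borel" for n
    unfolding G_def by measurable
  have fint: "l2sq (trunc F r) < \<infinity>" for r
    using l2sq_trunc_le[of F r] finF by (rule le_less_trans)
  let ?N = "\<lambda>f. \<integral>x. (norm (f x))\<^sup>2 \<partial>lborel"
  have GK: "l2sq (G n) = ennreal K * l2sq (trunc F (real n))" for n
    unfolding G_def K_def by (intro Plancherel integrable_trunc F finF fint)
  have finG: "l2sq (G n) < \<infinity>" for n
    using fint[of "real n"] by (simp add: GK ennreal_mult_less_top)
  have N_G: "?N (G n) = K * ?N (trunc F (real n))" for n
  proof -
    have "ennreal (?N (G n)) = ennreal (K * ?N (trunc F (real n)))"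
      using GK[of n] l2sq_eq_integral[OF _ finG[of n]] l2sq_eq_integral[OF _ fint[of "real n"]] K
      by (simp add: ennreal_mult)
    then show ?thesis using K by (subst (asm) ennreal_inj) auto
  qed
  have N_F: "?N H = K * ?N F"
  proof -
    have "ennreal (?N H) = ennreal (K * ?N F)"
      using FH finF fin K by (simp add: l2sq_eq_integral ennreal_mult)
    then show ?thesis using K by (subst (asm) ennreal_inj) auto
  qed
  \<comment> \<open>Conjugating H under the transform conjugates and reflects the result, which up
    to the factor K is the conjugate of F. The truncation then leaves only the squared modulus of F
    on the ball.\<close>
  have GH: "(\<integral>\<xi>. G n \<xi> * cnj (H \<xi>) \<partial>lborel) = of_real (K * ?N (trunc F (real n)))" for n
  proof -
    have "(\<integral>\<xi>. G n \<xi> * cnj (H \<xi>) \<partial>lborel) = (\<integral>x. trunc F (real n) x * fourier (\<lambda>\<xi>. cnj (H \<xi>)) x \<partial>lborel)"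
      unfolding G_def using H by (intro fourier_multiplication_formula integrable_trunc F finF) simp
    also have "\<dots> = (\<integral>x. of_real (K * (norm (trunc F (real n) x))\<^sup>2) \<partial>lborel)"
    proof (intro Bochner_Integration.integral_cong refl)
      fix x
      have "fourier (\<lambda>\<xi>. cnj (H \<xi>)) x = cnj (fourier H (- x))"
        unfolding fourier_def by (subst Bochner_Integration.integral_cnj[symmetric]) (simp add: exp_cnj)
      also have "\<dots> = of_real K * cnj (F x)"
        using K by (simp add: F_def K_def)
      finally show "trunc F (real n) x * fourier (\<lambda>\<xi>. cnj (H \<xi>)) x = of_real (K * (norm (trunc F (real n) x))\<^sup>2)"
        by (simp only: of_real_mult complex_norm_square) (simp add: trunc_def)
    qed
    also have "\<dots> = of_real (K * ?N (trunc F (real n)))"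
      by (subst integral_complex_of_real) simp
    finally show ?thesis .
  qed
  \<comment> \<open>With N the squared norm and F_n the truncation, expanding the square gives K
    N(F) + K N(F_n) - 2 K N(F_n), using Plancherel for both H and G n.\<close>
  have main: "l2sq (\<lambda>\<xi>. H \<xi> - G n \<xi>) = ennreal (K * (?N F - ?N (trunc F (real n))))" for n
  proof -
    have iH: "integrable lborel (\<lambda>\<xi>. (norm (H \<xi>))\<^sup>2)" and iG: "integrable lborel (\<lambda>\<xi>. (norm (G n \<xi>))\<^sup>2)"
      using fin finG by (simp_all add: integrable_norm_sq)
    have iGH: "integrable lborel (\<lambda>\<xi>. G n \<xi> * cnj (H \<xi>))"
      by (rule integrable_l2_mult) (use fin finG in \<open>simp_all add: l2sq_cnj\<close>)
    have e: "(\<lambda>\<xi>. (norm (H \<xi> - G n \<xi>))\<^sup>2) = (\<lambda>\<xi>. (norm (H \<xi>))\<^sup>2 + (norm (G n \<xi>))\<^sup>2 - 2 * Re (G n \<xi> * cnj (H \<xi>)))"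
      unfolding norm_diff_sq ..
    have i: "integrable lborel (\<lambda>\<xi>. (norm (H \<xi> - G n \<xi>))\<^sup>2)"
      unfolding e by (intro Bochner_Integration.integrable_diff Bochner_Integration.integrable_add iH iG integrable_mult_right integrable_Re iGH)
    have "?N (\<lambda>\<xi>. H \<xi> - G n \<xi>) = ?N H + ?N (G n) - 2 * (\<integral>\<xi>. Re (G n \<xi> * cnj (H \<xi>)) \<partial>lborel)"
      unfolding e using iH iG iGH
      by (subst Bochner_Integration.integral_diff) (auto intro!: integrable_mult_right integrable_Re simp del: times_complex.simps)
    also have "(\<integral>\<xi>. Re (G n \<xi> * cnj (H \<xi>)) \<partial>lborel) = Re (of_real (K * ?N (trunc F (real n))))"
      unfolding GH[symmetric] by (rule integral_Re[OF iGH])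
    finally have "?N (\<lambda>\<xi>. H \<xi> - G n \<xi>) = K * (?N F - ?N (trunc F (real n)))"
      by (simp add: N_F N_G algebra_simps)
    then show ?thesis
      unfolding l2sq_def using i by (subst nn_integral_eq_integral) auto
  qed
  have "(\<lambda>n. ?N (trunc F (real n))) \<longlonglongrightarrow> ?N F"
  proof (rule integral_dominated_convergence[where w="\<lambda>x. (norm (F x))\<^sup>2"])
    show "integrable lborel (\<lambda>x. (norm (F x))\<^sup>2)"
      by (intro integrable_norm_sq F finF)
    show "AE x in lborel. (\<lambda>n. (norm (trunc F (real n) x))\<^sup>2) \<longlonglongrightarrow> (norm (F x))\<^sup>2"
    proof (rule AE_I2, rule tendsto_eventually)
      show "\<forall>\<^sub>F n in sequentially. (norm (trunc F (real n) x))\<^sup>2 = (norm (F x))\<^sup>2" for x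
        using eventually_gt_at_top[of "nat \<lceil>norm x\<rceil>"]
      proof eventually_elim
        case (elim n)
        then have "norm x < real n" by linarith
        then show ?case by (simp add: trunc_def)
      qed
    qed
  qed (auto simp: trunc_def)
  then have "(\<lambda>n. ennreal (K * (?N F - ?N (trunc F (real n))))) \<longlonglongrightarrow> ennreal (K * (?N F - ?N F))"
    by (intro tendsto_ennrealI tendsto_intros)
  then have "is_fourier_L2 F H"
    unfolding is_fourier_L2_def
    using L2_borel[of H] fin by (simp add: fourier_trunc_eq[OF F] main[unfolded G_def])
  then show "AE x in lborel. fourier_L2 F x = H x"
    by (rule fourier_L2_eqI[OF FL])
qed

section \<open>Finite differences of entire functions and a Bessel inequality\<close>

text \<open>An M-th difference annihilates polynomials of degree below M. Induction on M: for
  positive n the term k = 0 vanishes, and after absorbing one factor k into the binomial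
  coefficient, expanding (l + 1)^(n - 1) leaves smaller exponents for row M - 1.\<close>

lemma alternating_binomial_power_sum:
  "n < M \<Longrightarrow> (\<Sum>k\<le>M. (-1)^k * of_nat (M choose k) * of_nat k ^ n) = (0::complex)"
proof (induction M arbitrary: n)
  case (Suc m)
  show ?case
  proof (cases n)
    case 0
    then show ?thesis using choose_alternating_sum[of "Suc m", where 'a=complex] by simp
  next
    case (Suc n')
    have "(\<Sum>k\<le>Suc m. (-1)^k * of_nat (Suc m choose k) * of_nat k ^ n)
        = (\<Sum>l\<le>m. (-1)^Suc l * of_nat (Suc m choose Suc l) * (of_nat (Suc l) :: complex) ^ n)"
      by (subst sum.atMost_Suc_shift) (simp add: Suc)
    also have "\<dots> = (\<Sum>l\<le>m. \<Sum>i\<le>n'. - of_nat (Suc m) * of_nat (n' choose i) * ((-1)^l * of_nat (m choose l) * of_nat l ^ i))"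
    proof (intro sum.cong refl)
      fix l
      have c: "(of_nat (Suc l) :: complex) * of_nat (Suc m choose Suc l) = of_nat (Suc m) * of_nat (m choose l)"
        unfolding of_nat_mult[symmetric] by (simp only: Suc_times_binomial)
      have b: "(of_nat (Suc l) :: complex) ^ n' = (\<Sum>i\<le>n'. of_nat (n' choose i) * of_nat l ^ i)"
        using binomial_ring[of "of_nat l :: complex" 1 n'] by (simp add: add.commute)
      have "(-1)^Suc l * of_nat (Suc m choose Suc l) * (of_nat (Suc l) :: complex) ^ n
          = - ((-1)^l * (of_nat (Suc l) * of_nat (Suc m choose Suc l)) * of_nat (Suc l) ^ n')"
        by (simp only: Suc power_Suc mult_ac) simp
      also have "\<dots> = - of_nat (Suc m) * ((-1)^l * of_nat (m choose l)) * (\<Sum>i\<le>n'. of_nat (n' choose i) * of_nat l ^ i)"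
        unfolding c b by (simp only: mult_minus_left mult_minus_right mult_ac)
      also have "\<dots> = (\<Sum>i\<le>n'. - of_nat (Suc m) * of_nat (n' choose i) * ((-1)^l * of_nat (m choose l) * of_nat l ^ i))"
        unfolding sum_distrib_left by (intro sum.cong refl) (simp only: mult_ac)
      finally show "(-1)^Suc l * of_nat (Suc m choose Suc l) * (of_nat (Suc l) :: complex) ^ n
        = (\<Sum>i\<le>n'. - of_nat (Suc m) * of_nat (n' choose i) * ((-1)^l * of_nat (m choose l) * of_nat l ^ i))" .
    qed
    also have "\<dots> = (\<Sum>i\<le>n'. \<Sum>l\<le>m. - of_nat (Suc m) * of_nat (n' choose i) * ((-1)^l * of_nat (m choose l) * of_nat l ^ i))"
      by (rule sum.swap)
    also have "\<dots> = 0"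
      unfolding sum_distrib_left[symmetric]
      using Suc.prems Suc.IH Suc by (intro sum.neutral) auto
    finally show ?thesis .
  qed
qed simp

text \<open>Cauchy's estimates on the circle of radius r bound the coefficients; inside the half
  disc the tail is dominated by a geometric series of ratio 1/2, whence the factor 2.\<close>

lemma entire_Taylor_remainder:
  assumes g: "g holomorphic_on UNIV" and r: "r > 0"
    and B: "\<And>z. norm z = r \<Longrightarrow> norm (g z) \<le> B" and z: "norm z \<le> r / 2"
  shows "norm (g z - (\<Sum>n<M. (deriv ^^ n) g 0 / fact n * z ^ n)) \<le> 2 * B * (norm z / r) ^ M"
proof -
  define c where "c n = (deriv ^^ n) g 0 / fact n" for n
  have B0: "B \<ge> 0"
    by (rule order_trans[OF norm_ge_zero B[of "of_real r"]]) (use r in simp)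
  have c: "norm (c n) \<le> B / r ^ n" for n
  proof -
    have "norm ((deriv ^^ n) g 0) \<le> fact n * B / r ^ n"
      using g r B by (intro Cauchy_inequality) (auto intro: holomorphic_on_subset holomorphic_on_imp_continuous_on)
    then show ?thesis by (simp add: c_def norm_divide field_simps)
  qed
  have "(\<lambda>n. (deriv ^^ n) g 0 / fact n * (z - 0) ^ n) sums g z"
    using g z r by (intro holomorphic_power_series[where r=r]) (auto intro: holomorphic_on_subset)
  then have s: "(\<lambda>n. c n * z ^ n) sums g z"
    by (simp add: c_def)
  then have t: "(\<lambda>n. c (n + M) * z ^ (n + M)) sums (g z - (\<Sum>n<M. c n * z ^ n))"
    by (subst sums_iff_shift') 
  have b: "norm (c (n + M) * z ^ (n + M)) \<le> B * (norm z / r) ^ M * (1/2) ^ n" for n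
  proof -
    have "norm (c (n + M) * z ^ (n + M)) \<le> B / r ^ (n + M) * norm z ^ (n + M)"
      unfolding norm_mult norm_power by (intro mult_right_mono c) simp
    also have "\<dots> = B * (norm z / r) ^ M * (norm z / r) ^ n"
      by (simp add: power_add power_divide mult_ac)
    also have "\<dots> \<le> B * (norm z / r) ^ M * (1/2) ^ n"
      using z r B0 by (intro mult_left_mono power_mono) (auto simp: field_simps)
    finally show ?thesis .
  qed
  have gs: "(\<lambda>n. B * (norm z / r) ^ M * (1/2) ^ n) sums (B * (norm z / r) ^ M * 2)"
    using geometric_sums[of "1/2::real"] by (intro sums_mult) simp
  have "norm (g z - (\<Sum>n<M. c n * z ^ n)) \<le> B * (norm z / r) ^ M * 2"
    using norm_suminf_le[OF b sums_summable[OF gs]] t gs by (simp add: sums_iff)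
  then show ?thesis by (simp add: c_def mult_ac)
qed

text \<open>The Taylor polynomial of degree below M at 0 is annihilated, so g may be replaced by its
  remainder at each node. The condition on M x keeps all nodes in the half disc, and 2^M is the sum
  of the binomial coefficients.\<close>

lemma entire_finite_difference_bound:
  assumes g: "g holomorphic_on UNIV" and r: "r > 0"
    and B: "\<And>z. norm z = r \<Longrightarrow> norm (g z) \<le> B" and x: "0 \<le> x" "real M * x \<le> r / 2"
  shows "norm (\<Sum>k\<le>M. (-1)^k * of_nat (M choose k) * g (of_nat k * of_real x)) \<le> 2 ^ M * (2 * B * (real M * x / r) ^ M)"
proof -
  define c where "c n = (deriv ^^ n) g 0 / fact n" for n
  define T where "T z = (\<Sum>n<M. c n * z ^ n)" for z
  have B0: "B \<ge> 0"
    by (rule order_trans[OF norm_ge_zero B[of "of_real r"]]) (use r in simp)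
  have "(\<Sum>k\<le>M. (-1)^k * of_nat (M choose k) * T (of_nat k * of_real x))
      = (\<Sum>k\<le>M. \<Sum>n<M. (c n * of_real x ^ n) * ((-1)^k * of_nat (M choose k) * of_nat k ^ n))"
    unfolding T_def sum_distrib_left by (intro sum.cong refl) (simp add: power_mult_distrib mult_ac)
  also have "\<dots> = (\<Sum>n<M. \<Sum>k\<le>M. (c n * of_real x ^ n) * ((-1)^k * of_nat (M choose k) * of_nat k ^ n))"
    by (rule sum.swap)
  also have "\<dots> = 0"
    unfolding sum_distrib_left[symmetric] by (intro sum.neutral) (auto simp: alternating_binomial_power_sum)
  finally have T0: "(\<Sum>k\<le>M. (-1)^k * of_nat (M choose k) * T (of_nat k * of_real x)) = 0" .
  have "(\<Sum>k\<le>M. (-1)^k * of_nat (M choose k) * g (of_nat k * of_real x))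
      = (\<Sum>k\<le>M. (-1)^k * of_nat (M choose k) * (g (of_nat k * of_real x) - T (of_nat k * of_real x)))"
    using T0 by (simp add: right_diff_distrib sum_subtractf)
  also have "norm \<dots> \<le> (\<Sum>k\<le>M. real (M choose k) * (2 * B * (real M * x / r) ^ M))"
  proof (intro sum_norm_le)
    fix k assume k: "k \<in> {..M}"
    have kx: "norm (of_nat k * of_real x :: complex) = real k * x"
      using x by (simp add: norm_mult)
    have le: "real k * x \<le> real M * x"
      using k x by (intro mult_right_mono) auto
    have "norm (g (of_nat k * of_real x) - T (of_nat k * of_real x)) \<le> 2 * B * (real k * x / r) ^ M"
      unfolding T_def c_def kx[symmetric]
      by (intro entire_Taylor_remainder g r B) (use le x kx in auto)
    also have "\<dots> \<le> 2 * B * (real M * x / r) ^ M"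
      using le x r B0 by (intro mult_left_mono power_mono divide_right_mono) auto
    finally show "norm ((-1)^k * of_nat (M choose k) * (g (of_nat k * of_real x) - T (of_nat k * of_real x)))
        \<le> real (M choose k) * (2 * B * (real M * x / r) ^ M)"
      by (simp add: norm_mult norm_power mult_left_mono)
  qed
  also have "\<dots> = 2 ^ M * (2 * B * (real M * x / r) ^ M)"
    by (subst sum_distrib_right[symmetric], subst of_nat_sum[symmetric], subst choose_row_sum) simp
  finally show ?thesis .
qed

text \<open>A continuous large sieve: after dualising, the trigonometric polynomial \<open>P\<close> with
  coefficients \<open>a j\<close> is integrated over the range of the phase, which lies in one period.\<close>

lemma Bessel_phase_integral:
  fixes w :: "real \<Rightarrow> complex" and \<theta> \<theta>' :: "real \<Rightarrow> real"
  assumes w[measurable]: "w \<in> borel_measurable borel" and w0: "\<And>v. v \<notin> {0..1} \<Longrightarrow> w v = 0"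
    and d: "\<And>v. (\<theta> has_real_derivative \<theta>' v) (at v)" and c: "continuous_on UNIV \<theta>'"
    and m: "m > 0" "\<And>v. v \<in> {0..1} \<Longrightarrow> \<theta>' v \<ge> m" and per: "\<theta> 1 - \<theta> 0 \<le> 2 * pi"
  shows "(\<Sum>j\<le>J. ennreal ((norm (\<integral>v. exp (- \<i> * of_real (real j * \<theta> v)) * w v \<partial>lborel))\<^sup>2)) \<le> ennreal (2 * pi / m) * l2sq w"
proof (cases "l2sq w < \<infinity>")
  case False
  then have "l2sq w = \<infinity>"
    by (simp add: not_less top_unique)
  then have "ennreal (2 * pi / m) * l2sq w = \<infinity>"
    using m by (simp add: ennreal_mult_eq_top_iff)
  then show ?thesis by simp
next
  case fin: True
  have c\<theta>: "continuous_on UNIV \<theta>"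
    using d by (intro continuous_at_imp_continuous_on ballI DERIV_isCont) auto
  have [measurable]: "\<theta> \<in> borel_measurable borel" "\<theta>' \<in> borel_measurable borel"
    using c c\<theta> by (simp_all add: borel_measurable_continuous_onI)
  define a where "a j = (\<integral>v. exp (- \<i> * of_real (real j * \<theta> v)) * w v \<partial>lborel)" for j
  define S where "S = (\<Sum>j\<le>J. (norm (a j))\<^sup>2)"
  define P where "P t = (\<Sum>j\<le>J. a j * exp (\<i> * of_real (real j * t)))" for t
  \<comment> \<open>An antiderivative of exp(i (j - k) t), with the resonant case j = k separate.
    Hence \<open>Q\<close> is an explicit antiderivative of the squared modulus of
    \<open>P\<close>.\<close>
  define E where "E j k t = (if j = k then of_real t
      else exp (\<i> * of_real ((real j - real k) * t)) / (\<i> * of_real (real j - real k)))" for j k :: nat and t :: real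
  define Q where "Q t = (\<Sum>j\<le>J. \<Sum>k\<le>J. Re (a j * cnj (a k) * E j k t))" for t
  have S0: "S \<ge> 0" unfolding S_def by (intro sum_nonneg) auto
  have cP: "continuous_on UNIV P"
    unfolding P_def by (intro continuous_intros)
  have [measurable]: "P \<in> borel_measurable borel"
    using cP by (rule borel_measurable_continuous_onI)
  have P2: "(norm (P t))\<^sup>2 = (\<Sum>j\<le>J. \<Sum>k\<le>J. Re (a j * cnj (a k) * exp (\<i> * of_real ((real j - real k) * t))))" for t
  proof -
    have "complex_of_real ((norm (P t))\<^sup>2) = P t * cnj (P t)"
      by (rule complex_norm_square)
    also have "\<dots> = (\<Sum>j\<le>J. \<Sum>k\<le>J. (a j * exp (\<i> * of_real (real j * t))) * cnj (a k * exp (\<i> * of_real (real k * t))))"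
      unfolding P_def cnj_sum sum_product ..
    also have "\<dots> = (\<Sum>j\<le>J. \<Sum>k\<le>J. a j * cnj (a k) * exp (\<i> * of_real ((real j - real k) * t)))"
    proof (intro sum.cong refl)
      fix j k
      have "exp (\<i> * of_real (real j * t)) * cnj (exp (\<i> * of_real (real k * t))) = exp (\<i> * of_real ((real j - real k) * t))"
        unfolding exp_cnj exp_add[symmetric] by (simp add: algebra_simps)
      then show "(a j * exp (\<i> * of_real (real j * t))) * cnj (a k * exp (\<i> * of_real (real k * t)))
          = a j * cnj (a k) * exp (\<i> * of_real ((real j - real k) * t))"
        by (metis (no_types, opaque_lifting) complex_cnj_mult mult.assoc mult.left_commute)
    qed
    finally have "Re (complex_of_real ((norm (P t))\<^sup>2)) = Re (\<Sum>j\<le>J. \<Sum>k\<le>J. a j * cnj (a k) * exp (\<i> * of_real ((real j - real k) * t)))"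
      by (rule arg_cong)
    then show ?thesis by (simp only: Re_complex_of_real Re_sum)
  qed
  have dQ: "(Q has_real_derivative (norm (P t))\<^sup>2) (at t)" for t
  proof -
    have dE: "(E j k has_vector_derivative exp (\<i> * of_real ((real j - real k) * t))) (at t)" for j k
    proof (cases "j = k")
      case True
      have "((\<lambda>t. of_real t) has_vector_derivative (1::complex)) (at t)"
        by (auto intro!: derivative_eq_intros)
      then show ?thesis using True by (simp add: E_def[abs_def])
    next
      case False
      have "((\<lambda>z. exp (b * z) / b) has_field_derivative exp (b * z)) (at z)" if "b \<noteq> 0" for b z :: complex
        using that by (auto intro!: derivative_eq_intros)
      from this[of "\<i> * of_real (real j - real k)" "of_real t"]
      have "((\<lambda>z. exp (\<i> * of_real (real j - real k) * z) / (\<i> * of_real (real j - real k)))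
          has_field_derivative exp (\<i> * of_real (real j - real k) * of_real t)) (at (of_real t))"
        using False by simp
      from has_vector_derivative_real_field[OF this] show ?thesis
        using False by (simp add: E_def[abs_def] mult.assoc)
    qed
    have "((\<lambda>t. Re (a j * cnj (a k) * E j k t)) has_vector_derivative
        Re (a j * cnj (a k) * exp (\<i> * of_real ((real j - real k) * t)))) (at t)" for j k
      by (intro bounded_linear.has_vector_derivative[OF bounded_linear_Re]
          bounded_linear.has_vector_derivative[OF bounded_linear_mult_right] dE)
    then show ?thesis
      unfolding has_real_derivative_iff_has_vector_derivative Q_def P2
      by (intro has_vector_derivative_sum)
  qed
  have Qmono: "Q s \<le> Q t" if "s \<le> t" for s t
    using that by (rule DERIV_nonneg_imp_nondecreasing) (use dQ zero_le_power2 in blast)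
  \<comment> \<open>Orthogonality over a full period: the oscillating terms have integer frequencies
    and return to their values, and only the diagonal grows.\<close>
  have Qper: "Q (t + 2 * pi) - Q t = 2 * pi * S" for t
  proof -
    have E: "Re (a j * cnj (a k) * E j k (t + 2 * pi)) - Re (a j * cnj (a k) * E j k t) = (if j = k then 2 * pi * (norm (a j))\<^sup>2 else 0)" for j k
    proof (cases "j = k")
      case True
      have "a j * cnj (a j) * E j j (t + 2 * pi) - a j * cnj (a j) * E j j t = of_real (2 * pi * (norm (a j))\<^sup>2)"
        unfolding E_def of_real_mult complex_norm_square by (simp add: algebra_simps)
      from arg_cong[OF this, of Re] show ?thesis using True by simp
    next
      case False
      have "exp (\<i> * of_real ((real j - real k) * (t + 2 * pi))) = exp (\<i> * of_real ((real j - real k) * t) + 2 * of_int (int j - int k) * of_real pi * \<i>)"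
        by (intro arg_cong[where f=exp]) (simp add: algebra_simps)
      also have "\<dots> = exp (\<i> * of_real ((real j - real k) * t))"
        by (subst exp_eq) (auto intro!: exI[of _ "int j - int k"])
      finally show ?thesis using False by (simp add: E_def)
    qed
    have "Q (t + 2 * pi) - Q t = (\<Sum>j\<le>J. \<Sum>k\<le>J. if j = k then 2 * pi * (norm (a j))\<^sup>2 else 0)"
      unfolding Q_def sum_subtractf[symmetric] E ..
    also have "\<dots> = 2 * pi * S"
      by (simp add: S_def sum_distrib_left sum.delta)
    finally show ?thesis .
  qed
  \<comment> \<open>The dual test function: pairing it with w yields the sum of squares
    \<open>S\<close> exactly, so only its own norm needs an estimate.\<close>
  define u where "u v = indicator {0..1} v * cnj (P (\<theta> v))" for v
  have [measurable]: "u \<in> borel_measurable borel"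
    unfolding u_def by measurable
  have "l2sq u \<le> (\<integral>\<^sup>+v. ennreal (1 / m * ((norm (P (\<theta> v)))\<^sup>2 * \<theta>' v)) * indicator {0..1} v \<partial>lborel)"
    unfolding l2sq_def
  proof (intro nn_integral_mono)
    fix v
    have "(norm (P (\<theta> v)))\<^sup>2 \<le> 1 / m * ((norm (P (\<theta> v)))\<^sup>2 * \<theta>' v)" if "v \<in> {0..1}"
      using m(2)[OF that] m(1) mult_left_mono[of m "\<theta>' v" "(norm (P (\<theta> v)))\<^sup>2"] by (simp add: field_simps)
    then show "ennreal ((norm (u v))\<^sup>2) \<le> ennreal (1 / m * ((norm (P (\<theta> v)))\<^sup>2 * \<theta>' v)) * indicator {0..1} v"
      by (auto simp: u_def indicator_def intro!: ennreal_leI)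
  qed
  also have "\<dots> = ennreal (1 / m * Q (\<theta> 1) - 1 / m * Q (\<theta> 0))"
  proof (rule nn_integral_FTC_Icc)
    show "((\<lambda>v. 1 / m * Q (\<theta> v)) has_real_derivative 1 / m * ((norm (P (\<theta> v)))\<^sup>2 * \<theta>' v)) (at v)" for v
      by (rule DERIV_cmult[OF DERIV_chain2[OF dQ d]])
    show "0 \<le> 1 / m * ((norm (P (\<theta> v)))\<^sup>2 * \<theta>' v)" if "v \<in> {0..1}" for v
      using m(1) m(2)[of v] that by (intro mult_nonneg_nonneg) auto
  qed auto
  \<comment> \<open>The bound \<theta>' \<ge> m has changed variables from v to the phase; the
    phases cover at most one period, and \<open>Q\<close> is monotone.\<close>
  also have "1 / m * Q (\<theta> 1) - 1 / m * Q (\<theta> 0) \<le> 1 / m * (2 * pi * S)"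
    using Qmono[of "\<theta> 1" "\<theta> 0 + 2 * pi"] per Qper[of "\<theta> 0"] m(1)
    by (simp only: right_diff_distrib[symmetric]) (intro mult_left_mono, auto)
  finally have lu: "l2sq u \<le> ennreal (1 / m * (2 * pi * S))"
    by (simp add: ennreal_leI)
  have SI: "(\<integral>v. w v * u v \<partial>lborel) = of_real S"
  proof -
    have Iw: "integrable lborel w"
    proof -
      have "l2sq (indicator {0..1::real}) < \<infinity>"
      proof -
        have "l2sq (indicator {0..1::real}) = (\<integral>\<^sup>+x. indicator {0..1::real} x \<partial>lborel)"
          unfolding l2sq_def by (intro nn_integral_cong) (auto simp: indicator_def)
        then show ?thesis by simp
      qed
      then have "integrable lborel (\<lambda>v. w v * indicator {0..1} v)"
        using fin by (intro integrable_l2_mult) auto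
      also have "(\<lambda>v. w v * indicator {0..1} v) = w"
        using w0 by (auto simp: fun_eq_iff indicator_def)
      finally show ?thesis .
    qed
    have I: "integrable lborel (\<lambda>v. exp (- \<i> * of_real (real j * \<theta> v)) * w v)" for j
      by (rule Bochner_Integration.integrable_bound[OF Iw]) (auto simp: norm_mult)
    have "w v * u v = (\<Sum>j\<le>J. cnj (a j) * (exp (- \<i> * of_real (real j * \<theta> v)) * w v))" for v
    proof (cases "v \<in> {0..1}")
      case True
      then have "w v * u v = (\<Sum>j\<le>J. w v * cnj (a j * exp (\<i> * of_real (real j * \<theta> v))))"
        by (simp add: u_def P_def cnj_sum sum_distrib_left)
      also have "\<dots> = (\<Sum>j\<le>J. cnj (a j) * (exp (- \<i> * of_real (real j * \<theta> v)) * w v))"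
        by (intro sum.cong refl) (simp add: exp_cnj mult_ac)
      finally show ?thesis .
    qed (simp add: w0)
    then have "(\<integral>v. w v * u v \<partial>lborel) = (\<Sum>j\<le>J. cnj (a j) * a j)"
      using I by (simp add: a_def Bochner_Integration.integral_sum)
    also have "\<dots> = of_real S"
      unfolding S_def of_real_sum complex_norm_square by (simp add: mult.commute)
    finally show ?thesis .
  qed
  have "ennreal (S\<^sup>2) \<le> l2sq w * l2sq u"
  proof -
    have "l2sq u < \<infinity>" using lu by (rule le_less_trans) simp
    then have "ennreal ((norm (\<integral>v. w v * u v \<partial>lborel))\<^sup>2) \<le> l2sq w * l2sq u"
      using fin by (intro l2_Cauchy_Schwarz) auto
    then show ?thesis by (simp add: SI)
  qed
  also have "\<dots> \<le> l2sq w * ennreal (1 / m * (2 * pi * S))"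
    by (intro mult_left_mono lu) simp
  also have "\<dots> = ennreal (enn2real (l2sq w) * (1 / m * (2 * pi * S)))"
    using fin m S0 by (subst ennreal_mult) auto
  finally have "S\<^sup>2 \<le> enn2real (l2sq w) * (1 / m * (2 * pi * S))"
    using m S0 by (subst (asm) ennreal_le_iff) auto
  then have "S * S \<le> (2 * pi / m * enn2real (l2sq w)) * S"
    by (simp add: power2_eq_square mult_ac)
  \<comment> \<open>Cauchy-Schwarz gave a quadratic inequality in \<open>S\<close>; one factor is
    cancelled unless \<open>S\<close> is 0.\<close>
  then have "S \<le> 2 * pi / m * enn2real (l2sq w)"
    using S0 m by (cases "S = 0") (simp, metis mult_right_le_imp_le order_le_less)
  then have "ennreal S \<le> ennreal (2 * pi / m * enn2real (l2sq w))"
    by (rule ennreal_leI)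
  also have "\<dots> = ennreal (2 * pi / m) * l2sq w"
    using fin m by (subst ennreal_mult) auto
  finally show ?thesis
    by (simp add: S_def a_def sum_ennreal)
qed

section \<open>Averages over dilations\<close>

text \<open>The exponential weight is the Jacobian of the dilation. Every dilate keeps its integral,
  and the adjoint is the unweighted average of m(exp(\<sigma> v) \<xi>).\<close>

definition dil_avg :: "real \<Rightarrow> ('a::euclidean_space \<Rightarrow> complex) \<Rightarrow> 'a \<Rightarrow> complex" where
  "dil_avg \<sigma> p \<xi> = (\<integral>v. indicator {0..1} v * (of_real (exp (- (real DIM('a) * \<sigma> * v))) * p (exp (- (\<sigma> * v)) *\<^sub>R \<xi>)) \<partial>lborel)"

lemma dil_avg_measurable [measurable]:
  assumes [measurable]: "p \<in> borel_measurable borel"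
  shows "dil_avg \<sigma> p \<in> borel_measurable borel"
  unfolding dil_avg_def[abs_def] by measurable

lemma nn_integral_dilate:
  fixes F :: "'a::euclidean_space \<Rightarrow> ennreal"
  assumes [measurable]: "F \<in> borel_measurable borel"
  shows "(\<integral>\<^sup>+\<xi>. F (exp (- s) *\<^sub>R \<xi>) \<partial>lborel) = ennreal (exp (real DIM('a) * s)) * (\<integral>\<^sup>+\<xi>. F \<xi> \<partial>lborel)"
  by (subst nn_integral_lborel_affine[where t=0 and c="exp s"])
     (simp_all add: exp_of_nat_mult exp_minus)

text \<open>Moves the dilation from p, which is merely integrable, to the multiplier m, which in the
  application is an explicit smooth wave. Fubini is applied on both sides of a change of variables
  in \<xi> for fixed v.\<close>

lemma
  fixes p m :: "'a::euclidean_space \<Rightarrow> complex"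
  assumes p: "integrable lborel p" and [measurable]: "m \<in> borel_measurable borel"
    and B: "\<And>\<xi>. norm (m \<xi>) \<le> B"
  shows integrable_mult_dil_avg: "integrable lborel (\<lambda>\<xi>. m \<xi> * dil_avg \<sigma> p \<xi>)" (is ?I)
    and integrable_dil_avg_dual:
      "integrable lborel (\<lambda>\<xi>. p \<xi> * (\<integral>v. indicator {0..1} v * m (exp (\<sigma> * v) *\<^sub>R \<xi>) \<partial>lborel))" (is ?J)
    and integral_mult_dil_avg: "(\<integral>\<xi>. m \<xi> * dil_avg \<sigma> p \<xi> \<partial>lborel)
      = (\<integral>\<xi>. p \<xi> * (\<integral>v. indicator {0..1} v * m (exp (\<sigma> * v) *\<^sub>R \<xi>) \<partial>lborel) \<partial>lborel)" (is ?E)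
proof -
  have [measurable]: "p \<in> borel_measurable borel"
    using borel_measurable_integrable[OF p] by simp
  let ?d = "real DIM('a)"
  define N where "N = (\<integral>\<^sup>+\<xi>. ennreal (norm (p \<xi>)) \<partial>lborel)"
  have N: "N < \<infinity>" using p by (simp add: N_def integrable_iff_bounded)
  have B0: "B \<ge> 0" using order_trans[OF norm_ge_zero B] .
  \<comment> \<open>The integrands before and after \<xi> is replaced by exp(\<sigma> v) \<xi>; they
    have equal integrals in \<xi> for each v, though not pointwise equal values.\<close>
  define G where "G v \<xi> = indicator {0..1} v * (m \<xi> * (of_real (exp (- (?d * \<sigma> * v))) * p (exp (- (\<sigma> * v)) *\<^sub>R \<xi>)))" for v :: real and \<xi>
  define G' where "G' v \<xi> = indicator {0..1} v * (m (exp (\<sigma> * v) *\<^sub>R \<xi>) * p \<xi>)" for v :: real and \<xi>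
  have fin: "(\<integral>\<^sup>+v. ennreal B * N * indicator {0..1::real} v \<partial>lborel) < \<infinity>"
    using N by (subst nn_integral_cmult) (auto simp: ennreal_mult_less_top)
  have IG: "integrable (lborel \<Otimes>\<^sub>M lborel) (\<lambda>(v, \<xi>). G v \<xi>)"
  proof (rule integrable_lborel_pair)
    have "(\<integral>\<^sup>+\<xi>. ennreal (norm (G v \<xi>)) \<partial>lborel) \<le> ennreal B * N * indicator {0..1} v" for v
    proof -
      have "(\<integral>\<^sup>+\<xi>. ennreal (norm (G v \<xi>)) \<partial>lborel)
          \<le> (\<integral>\<^sup>+\<xi>. (indicator {0..1} v * ennreal B * ennreal (exp (- (?d * (\<sigma> * v))))) * ennreal (norm (p (exp (- (\<sigma> * v)) *\<^sub>R \<xi>))) \<partial>lborel)"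
      proof (intro nn_integral_mono)
        fix \<xi>
        have "norm (m \<xi>) * (exp (- (?d * \<sigma> * v)) * norm (p (exp (- (\<sigma> * v)) *\<^sub>R \<xi>)))
            \<le> B * (exp (- (?d * \<sigma> * v)) * norm (p (exp (- (\<sigma> * v)) *\<^sub>R \<xi>)))"
          by (intro mult_right_mono B) simp
        then have "ennreal (norm (m \<xi>) * (exp (- (?d * \<sigma> * v)) * norm (p (exp (- (\<sigma> * v)) *\<^sub>R \<xi>))))
            \<le> ennreal B * ennreal (exp (- (?d * (\<sigma> * v)))) * ennreal (norm (p (exp (- (\<sigma> * v)) *\<^sub>R \<xi>)))"
          using B0 by (simp add: ennreal_mult[symmetric] ennreal_leI mult.assoc)
        then show "ennreal (norm (G v \<xi>)) \<le> (indicator {0..1} v * ennreal B * ennreal (exp (- (?d * (\<sigma> * v))))) * ennreal (norm (p (exp (- (\<sigma> * v)) *\<^sub>R \<xi>)))"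
          by (auto simp: G_def norm_mult indicator_def)
      qed
      also have "\<dots> = indicator {0..1} v * ennreal B * (ennreal (exp (- (?d * (\<sigma> * v)))) * (ennreal (exp (?d * (\<sigma> * v))) * N))"
        by (simp add: nn_integral_cmult nn_integral_dilate[of "\<lambda>\<xi>. ennreal (norm (p \<xi>))"] N_def mult.assoc)
      also have "\<dots> = ennreal B * N * indicator {0..1} v"
      proof -
        have "ennreal (exp (- (?d * (\<sigma> * v)))) * (ennreal (exp (?d * (\<sigma> * v))) * N) = N"
          by (subst mult.assoc[symmetric], subst ennreal_mult[symmetric]) (auto simp flip: exp_add)
        then show ?thesis by (simp only: mult_ac)
      qed
      finally show ?thesis .
    qed
    then have "(\<integral>\<^sup>+v. \<integral>\<^sup>+\<xi>. ennreal (norm (G v \<xi>)) \<partial>lborel \<partial>lborel) \<le> (\<integral>\<^sup>+v. ennreal B * N * indicator {0..1::real} v \<partial>lborel)"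
      by (intro nn_integral_mono) auto
    also note fin
    finally show "(\<integral>\<^sup>+v. \<integral>\<^sup>+\<xi>. ennreal (norm (case (v, \<xi>) of (v, \<xi>) \<Rightarrow> G v \<xi>)) \<partial>lborel \<partial>lborel) < \<infinity>"
      by simp
  qed (unfold G_def, measurable)
  have IG': "integrable (lborel \<Otimes>\<^sub>M lborel) (\<lambda>(v, \<xi>). G' v \<xi>)"
  proof (rule integrable_lborel_pair)
    have "(\<integral>\<^sup>+\<xi>. ennreal (norm (G' v \<xi>)) \<partial>lborel) \<le> ennreal B * N * indicator {0..1} v" for v
    proof -
      have "(\<integral>\<^sup>+\<xi>. ennreal (norm (G' v \<xi>)) \<partial>lborel)
          \<le> (\<integral>\<^sup>+\<xi>. (indicator {0..1} v * ennreal B) * ennreal (norm (p \<xi>)) \<partial>lborel)"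
      proof (intro nn_integral_mono)
        fix \<xi>
        have "norm (m (exp (\<sigma> * v) *\<^sub>R \<xi>)) * norm (p \<xi>) \<le> B * norm (p \<xi>)"
          by (intro mult_right_mono B) simp
        then have "ennreal (norm (m (exp (\<sigma> * v) *\<^sub>R \<xi>)) * norm (p \<xi>)) \<le> ennreal B * ennreal (norm (p \<xi>))"
          using B0 by (simp add: ennreal_mult[symmetric] ennreal_leI)
        then show "ennreal (norm (G' v \<xi>)) \<le> (indicator {0..1} v * ennreal B) * ennreal (norm (p \<xi>))"
          by (auto simp: G'_def norm_mult indicator_def)
      qed
      also have "\<dots> = ennreal B * N * indicator {0..1} v"
        by (subst nn_integral_cmult) (auto simp: N_def mult_ac)
      finally show ?thesis .
    qed
    then have "(\<integral>\<^sup>+v. \<integral>\<^sup>+\<xi>. ennreal (norm (G' v \<xi>)) \<partial>lborel \<partial>lborel) \<le> (\<integral>\<^sup>+v. ennreal B * N * indicator {0..1::real} v \<partial>lborel)"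
      by (intro nn_integral_mono) auto
    also note fin
    finally show "(\<integral>\<^sup>+v. \<integral>\<^sup>+\<xi>. ennreal (norm (case (v, \<xi>) of (v, \<xi>) \<Rightarrow> G' v \<xi>)) \<partial>lborel \<partial>lborel) < \<infinity>"
      by simp
  qed (unfold G'_def, measurable)
  have eqG: "(\<integral>v. G v \<xi> \<partial>lborel) = m \<xi> * dil_avg \<sigma> p \<xi>" for \<xi>
    unfolding G_def dil_avg_def integral_mult_right_zero[symmetric]
    by (intro Bochner_Integration.integral_cong refl) (simp add: mult_ac)
  have eqG': "(\<integral>v. G' v \<xi> \<partial>lborel) = p \<xi> * (\<integral>v. indicator {0..1} v * m (exp (\<sigma> * v) *\<^sub>R \<xi>) \<partial>lborel)" for \<xi>
    unfolding G'_def integral_mult_right_zero[symmetric]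
    by (intro Bochner_Integration.integral_cong refl) (simp add: mult_ac)
  show ?I
    using lborel_pair.integrable_snd[OF IG] by (simp add: eqG)
  show ?J
    using lborel_pair.integrable_snd[OF IG'] by (simp add: eqG')
  have "(\<integral>\<xi>. G v \<xi> \<partial>lborel) = (\<integral>\<xi>. G' v \<xi> \<partial>lborel)" for v
  proof -
    have "integrable lborel (\<lambda>\<xi>. m \<xi> * p (0 + exp (- (\<sigma> * v)) *\<^sub>R \<xi>))"
      by (rule Bochner_Integration.integrable_bound[OF integrable_mult_right[OF integrable_lborel_affine[OF p, of "exp (- (\<sigma> * v))" 0], of "of_real B"]])
         (use B B0 in \<open>auto simp: norm_mult intro!: mult_right_mono\<close>)
    from integral_lborel_affine[OF this, of "exp (\<sigma> * v)" 0]
    have "(\<integral>\<xi>. m \<xi> * p (exp (- (\<sigma> * v)) *\<^sub>R \<xi>) \<partial>lborel) = exp (\<sigma> * v) ^ DIM('a) *\<^sub>R (\<integral>\<xi>. m (exp (\<sigma> * v) *\<^sub>R \<xi>) * p \<xi> \<partial>lborel)"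
      by (simp add: exp_minus)
    then have "of_real (exp (- (?d * \<sigma> * v))) * (\<integral>\<xi>. m \<xi> * p (exp (- (\<sigma> * v)) *\<^sub>R \<xi>) \<partial>lborel) = (\<integral>\<xi>. m (exp (\<sigma> * v) *\<^sub>R \<xi>) * p \<xi> \<partial>lborel)"
      by (simp add: exp_of_nat_mult[symmetric] scaleR_conv_of_real mult.assoc[symmetric] exp_of_real[symmetric] flip: exp_add)
    then show ?thesis
      unfolding G_def G'_def
      by (simp add: mult.left_commute[of "m _"])
  qed
  then have "(\<integral>v. \<integral>\<xi>. G v \<xi> \<partial>lborel \<partial>lborel) = (\<integral>v. \<integral>\<xi>. G' v \<xi> \<partial>lborel \<partial>lborel)"
    by simp
  then show ?E
    using lborel_pair.Fubini_integral[OF IG] lborel_pair.Fubini_integral[OF IG']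
    by (simp add: eqG eqG')
qed

text \<open>For fixed \<xi> the averages over j are Fourier coefficients, in a distorted variable,
  of one function of v; \<open>Bessel_phase_integral\<close> applies. The denominator is the least
  phase speed and \<open>small\<close> confines the phase to one period.\<close>

lemma sum_l2sq_dil_avg:
  fixes h :: "'a::euclidean_space \<Rightarrow> complex"
  assumes h[measurable]: "h \<in> borel_measurable borel"
    and supp: "\<And>\<xi>. h \<xi> \<noteq> 0 \<Longrightarrow> 1/2 \<le> norm \<xi> \<and> norm \<xi> \<le> 2"
    and pos: "\<sigma> > 0" "R > 0" "\<alpha> > 0"
    and small: "R * \<sigma> * \<alpha> * 2 powr \<alpha> * exp (\<alpha> * \<sigma>) \<le> 2 * pi"
  shows "(\<Sum>j\<le>J. l2sq (dil_avg \<sigma> (\<lambda>\<xi>. exp (\<i> * of_real (real j * R * norm \<xi> powr \<alpha>)) * h \<xi>)))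
    \<le> ennreal (2 * pi / (R * \<alpha> * \<sigma> * exp (- (\<alpha> * \<sigma>)) * (1/2) powr \<alpha>)) * l2sq h"
proof -
  let ?d = "real DIM('a)"
  define m where "m = R * \<alpha> * \<sigma> * exp (- (\<alpha> * \<sigma>)) * (1/2) powr \<alpha>"
  define w where "w \<xi> v = indicator {0..1} v * (of_real (exp (- (?d * \<sigma> * v))) * h (exp (- (\<sigma> * v)) *\<^sub>R \<xi>))" for \<xi> and v :: real
  define p where "p j \<xi> = exp (\<i> * of_real (real j * R * norm \<xi> powr \<alpha>)) * h \<xi>" for j :: nat and \<xi>
  have [measurable]: "w \<xi> \<in> borel_measurable borel" for \<xi>
    unfolding w_def by measurable
  have [measurable]: "p j \<in> borel_measurable borel" for j
    unfolding p_def by measurable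
  have mpos: "m > 0" unfolding m_def using pos by simp
  have pt: "(\<Sum>j\<le>J. ennreal ((norm (dil_avg \<sigma> (p j) \<xi>))\<^sup>2)) \<le> ennreal (2 * pi / m) * l2sq (w \<xi>)" for \<xi>
  \<comment> \<open>If the ray segment misses the support of h, all averages vanish. Otherwise \<xi>
    itself lies in a slightly enlarged annulus, which gives the two-sided bounds on the phase
    speed.\<close>
  proof (cases "\<forall>v\<in>{0..1}. h (exp (- (\<sigma> * v)) *\<^sub>R \<xi>) = 0")
    case True
    then have "dil_avg \<sigma> (p j) \<xi> = 0" for j
      unfolding dil_avg_def by (intro integral_eq_zero_AE AE_I2) (auto simp: p_def indicator_def)
    then show ?thesis by simp
  next
    case False
    then obtain v where v: "0 \<le> v" "v \<le> 1" "h (exp (- (\<sigma> * v)) *\<^sub>R \<xi>) \<noteq> 0" by auto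
    have le: "1/2 \<le> exp (- (\<sigma> * v)) * norm \<xi>" "exp (- (\<sigma> * v)) * norm \<xi> \<le> 2"
      using supp[OF v(3)] by simp_all
    have sv: "0 \<le> \<sigma> * v" "\<sigma> * v \<le> \<sigma>"
      using pos v by (auto intro: mult_left_le)
    have n1: "1/2 \<le> norm \<xi>"
    proof -
      have "exp (- (\<sigma> * v)) * norm \<xi> \<le> 1 * norm \<xi>"
        using sv by (intro mult_right_mono) auto
      with le(1) show ?thesis by simp
    qed
    have n2: "norm \<xi> \<le> 2 * exp \<sigma>"
    proof -
      have "norm \<xi> = exp (\<sigma> * v) * (exp (- (\<sigma> * v)) * norm \<xi>)"
        by (simp add: exp_minus)
      also have "\<dots> \<le> exp \<sigma> * 2"
        using le sv by (intro mult_mono) auto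
      finally show ?thesis by simp
    qed
    define f where "f = norm \<xi> powr \<alpha>"
    have f1: "(1/2) powr \<alpha> \<le> f" unfolding f_def using n1 pos by (intro powr_mono2) auto
    have f2: "f \<le> 2 powr \<alpha> * exp (\<alpha> * \<sigma>)"
    proof -
      have "f \<le> (2 * exp \<sigma>) powr \<alpha>" unfolding f_def using n2 pos by (intro powr_mono2) auto
      also have "\<dots> = 2 powr \<alpha> * exp (\<alpha> * \<sigma>)" by (simp add: powr_mult exp_powr_real mult.commute)
      finally show ?thesis .
    qed
    have f0: "f \<ge> 0" by (simp add: f_def)
    \<comment> \<open>The phase decreases along the inward dilation; the minus sign makes \<theta>
      increasing and matches the kernel exp(-i j \<theta>).\<close>
    define \<theta> where "\<theta> v = - (R * f) * exp (- (\<alpha> * \<sigma>) * v)" for v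
    define \<theta>' where "\<theta>' v = (R * \<alpha> * \<sigma>) * exp (- (\<alpha> * \<sigma>) * v) * f" for v
    have phase: "norm (exp (- (\<sigma> * v)) *\<^sub>R \<xi>) powr \<alpha> = exp (- (\<alpha> * \<sigma>) * v) * f" for v
      by (simp add: powr_mult exp_powr_real f_def mult_ac)
    have le: "(\<Sum>j\<le>J. ennreal ((norm (\<integral>v. exp (- \<i> * of_real (real j * \<theta> v)) * w \<xi> v \<partial>lborel))\<^sup>2)) \<le> ennreal (2 * pi / m) * l2sq (w \<xi>)"
    proof (rule Bessel_phase_integral[where \<theta>'=\<theta>'])
      show "(\<theta> has_real_derivative \<theta>' v) (at v)" for v
        unfolding \<theta>_def \<theta>'_def by (auto intro!: derivative_eq_intros)
      show "continuous_on UNIV \<theta>'" unfolding \<theta>'_def by (intro continuous_intros)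
      show "m \<le> \<theta>' v" if "v \<in> {0..1}" for v
        unfolding m_def \<theta>'_def
        using that pos f1 by (intro mult_mono) (auto simp: mult_left_le)
      have "\<theta> 1 - \<theta> 0 = R * f * (1 - exp (- (\<alpha> * \<sigma>)))"
        by (simp add: \<theta>_def algebra_simps)
      also have "\<dots> \<le> R * (2 powr \<alpha> * exp (\<alpha> * \<sigma>)) * (\<alpha> * \<sigma>)"
        using pos f2 f0 exp_ge_add_one_self[of "- (\<alpha> * \<sigma>)"] by (intro mult_mono) auto
      also have "\<dots> \<le> 2 * pi" using small by (simp add: mult_ac)
      finally show "\<theta> 1 - \<theta> 0 \<le> 2 * pi" .
      show "w \<xi> v = 0" if "v \<notin> {0..1}" for v using that by (auto simp: w_def indicator_def)
    qed (use mpos in auto)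
    have "(\<integral>v. exp (- \<i> * of_real (real j * \<theta> v)) * w \<xi> v \<partial>lborel) = dil_avg \<sigma> (p j) \<xi>" for j
      unfolding dil_avg_def w_def p_def phase \<theta>_def
      by (intro Bochner_Integration.integral_cong refl) (simp add: mult_ac)
    with le show ?thesis by simp
  qed
  have "(\<Sum>j\<le>J. l2sq (dil_avg \<sigma> (p j))) = (\<integral>\<^sup>+\<xi>. (\<Sum>j\<le>J. ennreal ((norm (dil_avg \<sigma> (p j) \<xi>))\<^sup>2)) \<partial>lborel)"
    unfolding l2sq_def by (subst nn_integral_sum) auto
  also have "\<dots> \<le> (\<integral>\<^sup>+\<xi>. ennreal (2 * pi / m) * l2sq (w \<xi>) \<partial>lborel)"
    by (intro nn_integral_mono pt)
  also have "\<dots> = ennreal (2 * pi / m) * (\<integral>\<^sup>+\<xi>. l2sq (w \<xi>) \<partial>lborel)"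
    unfolding l2sq_def w_def by (intro nn_integral_cmult) measurable
  also have "(\<integral>\<^sup>+\<xi>. l2sq (w \<xi>) \<partial>lborel) = (\<integral>\<^sup>+v. \<integral>\<^sup>+\<xi>. ennreal ((norm (w \<xi> v))\<^sup>2) \<partial>lborel \<partial>lborel)"
    unfolding l2sq_def w_def by (intro lborel_pair.Fubini') measurable
  also have "\<dots> \<le> (\<integral>\<^sup>+v. l2sq h * indicator {0..1::real} v \<partial>lborel)"
  proof (intro nn_integral_mono)
    fix v :: real
    have "(\<integral>\<^sup>+\<xi>. ennreal ((norm (w \<xi> v))\<^sup>2) \<partial>lborel) = (\<integral>\<^sup>+\<xi>. (indicator {0..1} v * ennreal ((exp (- (?d * \<sigma> * v)))\<^sup>2)) * ennreal ((norm (h (exp (- (\<sigma> * v)) *\<^sub>R \<xi>)))\<^sup>2) \<partial>lborel)"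
      by (intro nn_integral_cong) (auto simp: w_def indicator_def norm_mult power_mult_distrib ennreal_mult)
    also have "\<dots> = indicator {0..1} v * ennreal ((exp (- (?d * \<sigma> * v)))\<^sup>2) * (ennreal (exp (?d * (\<sigma> * v))) * l2sq h)"
      by (simp add: nn_integral_cmult nn_integral_dilate[of "\<lambda>\<xi>. ennreal ((norm (h \<xi>))\<^sup>2)"] l2sq_def)
    also have "\<dots> \<le> l2sq h * indicator {0..1} v"
    proof (cases "v \<in> {0..1}")
      case True
      \<comment> \<open>The Jacobian enters squared but the dilated integral produces only one
        inverse Jacobian; what remains is at most 1.\<close>
      have "(exp (- (?d * \<sigma> * v)))\<^sup>2 * exp (?d * (\<sigma> * v)) = exp (- (?d * (\<sigma> * v)))"
        by (simp add: power2_eq_square mult.assoc flip: exp_add)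
      moreover have "exp (- (?d * (\<sigma> * v))) \<le> 1"
        using True pos by simp
      ultimately have "ennreal ((exp (- (?d * \<sigma> * v)))\<^sup>2) * ennreal (exp (?d * (\<sigma> * v))) \<le> 1"
        by (subst ennreal_mult[symmetric]) auto
      then have "(ennreal ((exp (- (?d * \<sigma> * v)))\<^sup>2) * ennreal (exp (?d * (\<sigma> * v)))) * l2sq h \<le> 1 * l2sq h"
        by (intro mult_right_mono) auto
      then show ?thesis using True by (simp add: mult.assoc)
    qed simp
    finally show "(\<integral>\<^sup>+\<xi>. ennreal ((norm (w \<xi> v))\<^sup>2) \<partial>lborel) \<le> l2sq h * indicator {0..1} v" .
  qed
  also have "\<dots> = l2sq h" by (subst nn_integral_cmult) auto
  finally show ?thesis
    unfolding p_def m_def by (simp add: mult_left_mono)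
qed

section \<open>The spectral cutoff for the dilation generator\<close>

text \<open>The \<open>k = 0\<close> term is left out: \<open>p - dil_cutoff M r p\<close> is the full alternating sum, i.e. an
  \<open>M\<close>-th finite difference of dilates.\<close>

definition dil_cutoff :: "nat \<Rightarrow> real \<Rightarrow> ('a::euclidean_space \<Rightarrow> complex) \<Rightarrow> 'a \<Rightarrow> complex" where
  "dil_cutoff M r p \<xi> = (\<Sum>k=1..M. (-1)^(k+1) * of_nat (M choose k) * dil_avg (real k * r) p \<xi>)"

lemma dil_cutoff_measurable [measurable]:
  assumes [measurable]: "p \<in> borel_measurable borel"
  shows "dil_cutoff M r p \<in> borel_measurable borel"
  unfolding dil_cutoff_def[abs_def] by measurable

text \<open>The duality of \<open>integral_mult_dil_avg\<close>, summed over k, turns the error of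
  the cutoff into a finite difference of the multiplier along the ray through \<xi>.\<close>

lemma
  fixes p m :: "'a::euclidean_space \<Rightarrow> complex"
  assumes p: "integrable lborel p" and m[measurable]: "m \<in> borel_measurable borel"
    and B: "\<And>\<xi>. norm (m \<xi>) \<le> B"
  shows integrable_mult_dil_cutoff: "integrable lborel (\<lambda>\<xi>. m \<xi> * dil_cutoff M r p \<xi>)" (is ?I)
    and integral_diff_dil_cutoff: "(\<integral>\<xi>. m \<xi> * p \<xi> \<partial>lborel) - (\<integral>\<xi>. m \<xi> * dil_cutoff M r p \<xi> \<partial>lborel)
      = (\<integral>\<xi>. p \<xi> * (\<integral>v. indicator {0..1} v * (\<Sum>k\<le>M. (-1)^k * of_nat (M choose k) * m (exp (real k * r * v) *\<^sub>R \<xi>)) \<partial>lborel) \<partial>lborel)" (is ?E)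
proof -
  let ?c = "\<lambda>k. (-1)^k * of_nat (M choose k) :: complex"
  define A where "A k \<xi> = (\<integral>v. indicator {0..1} v * m (exp (real k * r * v) *\<^sub>R \<xi>) \<partial>lborel)" for k \<xi>
  have eq: "m \<xi> * dil_cutoff M r p \<xi> = (\<Sum>k=1..M. - ?c k * (m \<xi> * dil_avg (real k * r) p \<xi>))" for \<xi>
    unfolding dil_cutoff_def sum_distrib_left by (intro sum.cong refl) (simp add: mult_ac)
  have I: "integrable lborel (\<lambda>\<xi>. m \<xi> * dil_avg (real k * r) p \<xi>)" for k
    by (rule integrable_mult_dil_avg[OF p m B])
  have J: "integrable lborel (\<lambda>\<xi>. p \<xi> * A k \<xi>)" for k
    unfolding A_def by (rule integrable_dil_avg_dual[OF p m B])
  show ?I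
    unfolding eq by (intro Bochner_Integration.integrable_sum integrable_mult_right I)
  \<comment> \<open>For k = 0 there is no dilation and the averaging interval has length 1, so the
    undisturbed pairing with p supplies the missing term of the alternating sum.\<close>
  have A0: "A 0 \<xi> = m \<xi>" for \<xi>
  proof -
    have "(\<integral>v. indicator {0..1::real} v \<partial>lborel) = (\<integral>v. complex_of_real (indicator {0..1::real} v) \<partial>lborel)"
      by (intro Bochner_Integration.integral_cong) (auto simp: indicator_def)
    also have "\<dots> = 1"
      by (subst integral_complex_of_real) simp
    finally show ?thesis unfolding A_def by simp
  qed
  have "(\<integral>\<xi>. m \<xi> * dil_cutoff M r p \<xi> \<partial>lborel) = (\<Sum>k=1..M. - ?c k * (\<integral>\<xi>. p \<xi> * A k \<xi> \<partial>lborel))"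
    unfolding eq A_def
    by (subst Bochner_Integration.integral_sum)
       (auto intro!: integrable_mult_right I simp: integral_mult_dil_avg[OF p m B])
  moreover have "(\<integral>\<xi>. m \<xi> * p \<xi> \<partial>lborel) = ?c 0 * (\<integral>\<xi>. p \<xi> * A 0 \<xi> \<partial>lborel)"
    by (simp add: A0 mult.commute)
  moreover have "{..M} = insert 0 {1..M}" by auto
  ultimately have "(\<integral>\<xi>. m \<xi> * p \<xi> \<partial>lborel) - (\<integral>\<xi>. m \<xi> * dil_cutoff M r p \<xi> \<partial>lborel) = (\<Sum>k\<le>M. ?c k * (\<integral>\<xi>. p \<xi> * A k \<xi> \<partial>lborel))"
    by (simp add: sum_negf)
  also have "\<dots> = (\<integral>\<xi>. (\<Sum>k\<le>M. ?c k * (p \<xi> * A k \<xi>)) \<partial>lborel)"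
    using J by (subst Bochner_Integration.integral_sum) auto
  also have "\<dots> = (\<integral>\<xi>. p \<xi> * (\<integral>v. indicator {0..1} v * (\<Sum>k\<le>M. ?c k * m (exp (real k * r * v) *\<^sub>R \<xi>)) \<partial>lborel) \<partial>lborel)"
  proof (intro Bochner_Integration.integral_cong refl)
    fix \<xi>
    have int: "integrable lborel (\<lambda>v. indicator {0..1::real} v * m (exp (real k * r * v) *\<^sub>R \<xi>))" for k
    proof (rule Bochner_Integration.integrable_bound)
      show "integrable lborel (\<lambda>v. indicator {0..1::real} v * B)"
        by (intro integrable_mult_left integrable_real_indicator) auto
      have B0: "B \<ge> 0" using order_trans[OF norm_ge_zero B] .
      show "AE v in lborel. norm (indicator {0..1::real} v * m (exp (real k * r * v) *\<^sub>R \<xi>)) \<le> norm (indicator {0..1} v * B)"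
        using B B0 by (intro AE_I2) (auto simp: indicator_def norm_mult)
    qed measurable
    have "(\<integral>v. indicator {0..1} v * (\<Sum>k\<le>M. ?c k * m (exp (real k * r * v) *\<^sub>R \<xi>)) \<partial>lborel)
        = (\<integral>v. (\<Sum>k\<le>M. ?c k * (indicator {0..1} v * m (exp (real k * r * v) *\<^sub>R \<xi>))) \<partial>lborel)"
      by (intro Bochner_Integration.integral_cong refl) (simp add: sum_distrib_left mult_ac)
    also have "\<dots> = (\<Sum>k\<le>M. ?c k * A k \<xi>)"
      unfolding A_def using int by (subst Bochner_Integration.integral_sum) auto
    finally have e: "(\<integral>v. indicator {0..1} v * (\<Sum>k\<le>M. ?c k * m (exp (real k * r * v) *\<^sub>R \<xi>)) \<partial>lborel) = (\<Sum>k\<le>M. ?c k * A k \<xi>)" .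
    show "(\<Sum>k\<le>M. ?c k * (p \<xi> * A k \<xi>)) = p \<xi> * (\<integral>v. indicator {0..1} v * (\<Sum>k\<le>M. ?c k * m (exp (real k * r * v) *\<^sub>R \<xi>)) \<partial>lborel)"
      unfolding e unfolding sum_distrib_left by (intro sum.cong refl) (simp only: mult_ac)
  qed
  finally show ?E .
qed

text \<open>Values at \<xi> depend on p only along the segment from \<xi> inward to exp(-M r) \<xi>;
  supports therefore spread outward only, by a factor of at most exp(M r).\<close>

lemma dil_cutoff_eq_0:
  fixes \<xi> :: "'a::euclidean_space"
  assumes "\<And>s. 0 \<le> s \<Longrightarrow> s \<le> real M * r \<Longrightarrow> p (exp (- s) *\<^sub>R \<xi>) = 0" and r: "r \<ge> 0"
  shows "dil_cutoff M r p \<xi> = 0"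
proof -
  have "dil_avg (real k * r) p \<xi> = 0" if k: "k \<in> {1..M}" for k
    unfolding dil_avg_def
  proof (intro integral_eq_zero_AE AE_I2)
    fix v :: real
    have "real k * r * v \<le> real M * r" if "v \<in> {0..1}"
    proof -
      have "(real k * r) * v \<le> real k * r" using that r by (intro mult_left_le) auto
      also have "\<dots> \<le> real M * r" using k r by (intro mult_right_mono) auto
      finally show ?thesis .
    qed
    then show "indicator {0..1} v * (of_real (exp (- (real DIM('a) * (real k * r) * v))) * p (exp (- (real k * r * v)) *\<^sub>R \<xi>)) = 0"
      using assms(1)[of "real k * r * v"] r by (auto simp: indicator_def)
  qed
  then show ?thesis
    unfolding dil_cutoff_def by (intro sum.neutral) auto
qed

lemma l2sq_cmult:
  assumes [measurable]: "f \<in> borel_measurable borel"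
  shows "l2sq (\<lambda>x. c * f x) = ennreal ((norm c)\<^sup>2) * l2sq f"
  unfolding l2sq_def by (simp add: norm_mult power_mult_distrib ennreal_mult nn_integral_cmult)

lemma l2sq_sum:
  assumes [measurable]: "\<And>k. u k \<in> borel_measurable borel" and fin: "finite A"
  shows "l2sq (\<lambda>x. \<Sum>k\<in>A. u k x) \<le> ennreal (real (card A)) * (\<Sum>k\<in>A. l2sq (u k))"
proof -
  have "l2sq (\<lambda>x. \<Sum>k\<in>A. u k x) \<le> (\<integral>\<^sup>+x. ennreal (real (card A)) * (\<Sum>k\<in>A. ennreal ((norm (u k x))\<^sup>2)) \<partial>lborel)"
    unfolding l2sq_def
  proof (intro nn_integral_mono)
    fix x
    have "(norm (\<Sum>k\<in>A. u k x))\<^sup>2 \<le> (\<Sum>k\<in>A. norm (u k x))\<^sup>2"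
      by (intro power_mono norm_sum) simp
    also have "\<dots> \<le> real (card A) * (\<Sum>k\<in>A. (norm (u k x))\<^sup>2)"
      using Cauchy_Schwarz_ineq_sum[of "\<lambda>_. 1" "\<lambda>k. norm (u k x)" A] by simp
    finally have "ennreal ((norm (\<Sum>k\<in>A. u k x))\<^sup>2) \<le> ennreal (real (card A) * (\<Sum>k\<in>A. (norm (u k x))\<^sup>2))"
      by (rule ennreal_leI)
    also have "\<dots> = ennreal (real (card A)) * (\<Sum>k\<in>A. ennreal ((norm (u k x))\<^sup>2))"
      by (subst ennreal_mult) (auto simp: sum_nonneg)
    finally show "ennreal ((norm (\<Sum>k\<in>A. u k x))\<^sup>2) \<le> ennreal (real (card A)) * (\<Sum>k\<in>A. ennreal ((norm (u k x))\<^sup>2))" .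
  qed
  also have "\<dots> = ennreal (real (card A)) * (\<Sum>k\<in>A. l2sq (u k))"
    unfolding l2sq_def by (subst nn_integral_cmult) (auto simp: nn_integral_sum simp del: sum_ennreal)
  finally show ?thesis .
qed

text \<open>Each k satisfies the hypotheses of \<open>sum_l2sq_dil_avg\<close> with \<sigma> = k r.
  Cauchy-Schwarz over k costs M, the squared binomials at most 4^M, and the final sum over k another
  M.\<close>

lemma sum_l2sq_dil_cutoff:
  fixes h :: "'a::euclidean_space \<Rightarrow> complex"
  assumes h[measurable]: "h \<in> borel_measurable borel"
    and supp: "\<And>\<xi>. h \<xi> \<noteq> 0 \<Longrightarrow> 1/2 \<le> norm \<xi> \<and> norm \<xi> \<le> 2"
    and pos: "r > 0" "R > 0" "\<alpha> > 0" and Mr: "real M * r \<le> 1"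
    and small: "R * (real M * r) * \<alpha> * 2 powr \<alpha> * exp \<alpha> \<le> 2 * pi"
  shows "(\<Sum>j\<le>J. l2sq (dil_cutoff M r (\<lambda>\<xi>. exp (\<i> * of_real (real j * R * norm \<xi> powr \<alpha>)) * h \<xi>)))
    \<le> ennreal ((real M)\<^sup>2 * 4 ^ M * (2 * pi / (R * \<alpha> * r * exp (- \<alpha>) * (1/2) powr \<alpha>))) * l2sq h"
proof -
  define p where "p j \<xi> = exp (\<i> * of_real (real j * R * norm \<xi> powr \<alpha>)) * h \<xi>" for j :: nat and \<xi>
  have [measurable]: "p j \<in> borel_measurable borel" for j
    unfolding p_def by measurable
  define D where "D = 2 * pi / (R * \<alpha> * r * exp (- \<alpha>) * (1/2) powr \<alpha>)"
  have D0: "D \<ge> 0" unfolding D_def using pos by simp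
  \<comment> \<open>The extreme cases differ: k = M has the largest phase range and dictates
    \<open>small\<close>, while k = 1 has the least speed and dictates \<open>D\<close>.\<close>
  have one: "(\<Sum>j\<le>J. l2sq (dil_avg (real k * r) (p j))) \<le> ennreal D * l2sq h" if k: "k \<in> {1..M}" for k
  proof -
    have kr: "r \<le> real k * r" "real k * r \<le> real M * r"
      using k pos by auto
    then have kr1: "real k * r \<le> 1" using Mr by linarith
    have "(\<Sum>j\<le>J. l2sq (dil_avg (real k * r) (p j)))
      \<le> ennreal (2 * pi / (R * \<alpha> * (real k * r) * exp (- (\<alpha> * (real k * r))) * (1/2) powr \<alpha>)) * l2sq h"
      unfolding p_def
    proof (rule sum_l2sq_dil_avg[OF h supp])
      have "\<alpha> * (real k * r) \<le> \<alpha> * 1" using kr1 pos by (intro mult_left_mono) auto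
      then have "R * (real k * r) * \<alpha> * 2 powr \<alpha> * exp (\<alpha> * (real k * r)) \<le> R * (real M * r) * \<alpha> * 2 powr \<alpha> * exp \<alpha>"
        using kr pos by (intro mult_mono) auto
      with small show "R * (real k * r) * \<alpha> * 2 powr \<alpha> * exp (\<alpha> * (real k * r)) \<le> 2 * pi" by simp
    qed (use k pos in auto)
    also have "\<dots> \<le> ennreal D * l2sq h"
    proof (intro mult_right_mono ennreal_leI)
      have "\<alpha> * (real k * r) \<le> \<alpha> * 1" using kr1 pos by (intro mult_left_mono) auto
      then have "R * \<alpha> * r * exp (- \<alpha>) * (1/2) powr \<alpha> \<le> R * \<alpha> * (real k * r) * exp (- (\<alpha> * (real k * r))) * (1/2) powr \<alpha>"
        using kr pos by (intro mult_mono) auto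
      then show "2 * pi / (R * \<alpha> * (real k * r) * exp (- (\<alpha> * (real k * r))) * (1/2) powr \<alpha>) \<le> D"
        unfolding D_def using pos k by (intro divide_left_mono) auto
    qed simp
    finally show ?thesis .
  qed
  have "l2sq (dil_cutoff M r (p j)) \<le> ennreal (real M * 4 ^ M) * (\<Sum>k=1..M. l2sq (dil_avg (real k * r) (p j)))" for j
  proof -
    have "l2sq (dil_cutoff M r (p j)) \<le> ennreal (real (card {1..M})) * (\<Sum>k=1..M. l2sq (\<lambda>\<xi>. ((-1)^(k+1) * of_nat (M choose k)) * dil_avg (real k * r) (p j) \<xi>))"
      unfolding dil_cutoff_def[abs_def] by (rule l2sq_sum) auto
    also have "\<dots> \<le> ennreal (real M) * (\<Sum>k=1..M. ennreal (4 ^ M) * l2sq (dil_avg (real k * r) (p j)))"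
    proof (simp only: card_atLeastAtMost diff_Suc_1, intro mult_left_mono sum_mono)
      fix k assume "k \<in> {1..M}"
      have "real (M choose k) \<le> 2 ^ M"
        using binomial_le_pow2[of M k] by (metis of_nat_le_iff of_nat_numeral of_nat_power)
      then have "(real (M choose k))\<^sup>2 \<le> (2 ^ M)\<^sup>2"
        by (intro power_mono) auto
      also have "\<dots> = 4 ^ M"
        by (simp add: power_mult[symmetric] mult.commute[of M] power_mult)
      finally have "(norm ((-1)^(k+1) * of_nat (M choose k) :: complex))\<^sup>2 \<le> 4 ^ M"
        by (simp add: norm_mult norm_power)
      then show "l2sq (\<lambda>\<xi>. ((-1)^(k+1) * of_nat (M choose k)) * dil_avg (real k * r) (p j) \<xi>) \<le> ennreal (4 ^ M) * l2sq (dil_avg (real k * r) (p j))"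
        by (subst l2sq_cmult) (auto intro!: mult_right_mono ennreal_leI)
    qed auto
    also have "\<dots> = ennreal (real M * 4 ^ M) * (\<Sum>k=1..M. l2sq (dil_avg (real k * r) (p j)))"
      by (simp add: sum_distrib_left[symmetric] ennreal_mult mult.assoc)
    finally show ?thesis .
  qed
  then have "(\<Sum>j\<le>J. l2sq (dil_cutoff M r (p j))) \<le> (\<Sum>j\<le>J. ennreal (real M * 4 ^ M) * (\<Sum>k=1..M. l2sq (dil_avg (real k * r) (p j))))"
    by (intro sum_mono)
  also have "\<dots> = ennreal (real M * 4 ^ M) * (\<Sum>k=1..M. \<Sum>j\<le>J. l2sq (dil_avg (real k * r) (p j)))"
    unfolding sum_distrib_left[symmetric] by (subst sum.swap) simp
  also have "\<dots> \<le> ennreal (real M * 4 ^ M) * (\<Sum>k=1..M. ennreal D * l2sq h)"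
    by (intro mult_left_mono sum_mono one) auto
  also have "\<dots> = ennreal ((real M)\<^sup>2 * 4 ^ M * D) * l2sq h"
  proof -
    have "(\<Sum>k=1..M. ennreal D * l2sq h) = ennreal (real M) * (ennreal D * l2sq h)"
      by (simp add: ennreal_of_nat_eq_real_of_nat)
    moreover have "ennreal (real M * 4 ^ M) * (ennreal (real M) * ennreal D) = ennreal ((real M)\<^sup>2 * 4 ^ M * D)"
      using D0 by (simp add: ennreal_mult[symmetric] power2_eq_square mult_ac del: ennreal_of_nat_eq_real_of_nat)
    ultimately show ?thesis
      by (simp only: mult.assoc[symmetric])
  qed
  finally show ?thesis
    unfolding p_def D_def .
qed

text \<open>exp is real on the real line, so its imaginary part is of first order in z. This lets a
  phase of size R stay bounded on a disc of radius 1/R.\<close>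

lemma abs_Im_exp_le: "norm z \<le> c \<Longrightarrow> \<bar>Im (exp z)\<bar> \<le> c * exp c"
proof -
  assume c: "norm z \<le> c"
  have "\<bar>Im (exp z)\<bar> = exp (Re z) * \<bar>sin (Im z)\<bar>"
    by (simp add: Im_exp abs_mult)
  also have "\<dots> \<le> exp c * c"
    using c abs_Re_le_cmod[of z] abs_Im_le_cmod[of z] abs_sin_x_le_abs_x[of "Im z"]
    by (intro mult_mono) auto
  finally show ?thesis by (simp add: mult.commute)
qed

text \<open>Along a ray the phase extends to an entire function of the logarithm of the dilation
  factor, which stays bounded on a disc of radius \<open>1 / R\<close>.\<close>

lemma phase_difference_bound:
  fixes x \<xi> :: "'a::euclidean_space"
  assumes "\<alpha> > 0" "R \<ge> 1" "r \<ge> 0" and Mr: "real M * r \<le> 1 / (2 * R)"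
    and x: "norm x \<le> 2 * R" and s: "0 \<le> s" "s \<le> R" and \<xi>: "norm \<xi> \<le> 2" and v: "v \<in> {0..1}"
  shows "norm (\<Sum>k\<le>M. (-1)^k * of_nat (M choose k) *
      exp (\<i> * of_real (x \<bullet> (exp (real k * r * v) *\<^sub>R \<xi>) + s * norm (exp (real k * r * v) *\<^sub>R \<xi>) powr \<alpha>)))
    \<le> 2 ^ M * (2 * exp (4 * exp 1 + \<alpha> * 2 powr \<alpha> * exp \<alpha>) * (real M * r * R) ^ M)"
proof -
  define a where "a = x \<bullet> \<xi>"
  define b where "b = norm \<xi> powr \<alpha>"
  have a: "\<bar>a\<bar> \<le> 4 * R"
  proof -
    have "\<bar>a\<bar> \<le> norm x * norm \<xi>" unfolding a_def by (rule Cauchy_Schwarz_ineq2)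
    also have "\<dots> \<le> (2 * R) * 2" using x \<xi> assms by (intro mult_mono) auto
    finally show ?thesis by simp
  qed
  have b: "0 \<le> b" "b \<le> 2 powr \<alpha>"
    unfolding b_def using \<xi> assms by (auto intro: powr_mono2)
  \<comment> \<open>The wave along the ray through \<xi>, with the logarithm of the dilation factor
    as complex variable; the power |\<xi>|^\<alpha> becomes exp(\<alpha> z), hence entire.\<close>
  define g where "g z = exp (\<i> * (of_real a * exp z + of_real (s * b) * exp (of_real \<alpha> * z)))" for z
  define B where "B = exp (4 * exp 1 + \<alpha> * 2 powr \<alpha> * exp \<alpha>)"
  \<comment> \<open>On |z| = 1/R the coefficients a and s b are O(R) and the imaginary parts O(1/R).
    The product is bounded independently of R: 4 R bounds |a|, and R 2^\<alpha> bounds s b.\<close>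
  have gB: "norm (g z) \<le> B" if z: "norm z = 1 / R" for z
  proof -
    have i1: "\<bar>Im (exp z)\<bar> \<le> 1 / R * exp 1"
    proof -
      have "\<bar>Im (exp z)\<bar> \<le> 1 / R * exp (1 / R)" using z by (intro abs_Im_exp_le) simp
      also have "\<dots> \<le> 1 / R * exp 1" using assms by (intro mult_left_mono) auto
      finally show ?thesis .
    qed
    have i2: "\<bar>Im (exp (of_real \<alpha> * z))\<bar> \<le> \<alpha> / R * exp \<alpha>"
    proof -
      have "\<bar>Im (exp (of_real \<alpha> * z))\<bar> \<le> \<alpha> / R * exp (\<alpha> / R)"
        using z assms by (intro abs_Im_exp_le) (simp add: norm_mult)
      also have "\<dots> \<le> \<alpha> / R * exp \<alpha>" using assms by (intro mult_left_mono) (auto simp: field_simps)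
      finally show ?thesis .
    qed
    have "norm (g z) = exp (- (a * Im (exp z) + s * b * Im (exp (of_real \<alpha> * z))))"
      by (simp add: g_def)
    also have "\<dots> \<le> B"
      unfolding B_def
    proof (subst exp_le_cancel_iff)
      have "- (a * Im (exp z)) \<le> \<bar>a\<bar> * \<bar>Im (exp z)\<bar>"
        by (simp add: abs_mult[symmetric] abs_ge_minus_self)
      also have "\<dots> \<le> (4 * R) * (1 / R * exp 1)" using a i1 by (intro mult_mono) auto
      also have "\<dots> = 4 * exp 1" using assms by simp
      finally have 1: "- (a * Im (exp z)) \<le> 4 * exp 1" .
      have "- (s * b * Im (exp (of_real \<alpha> * z))) \<le> (s * b) * \<bar>Im (exp (of_real \<alpha> * z))\<bar>"
        using s b by (metis abs_ge_minus_self abs_mult abs_of_nonneg mult_nonneg_nonneg)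
      also have "\<dots> \<le> (R * 2 powr \<alpha>) * (\<alpha> / R * exp \<alpha>)"
        using s b i2 assms by (intro mult_mono) auto
      also have "\<dots> = \<alpha> * 2 powr \<alpha> * exp \<alpha>" using assms by simp
      finally show "- (a * Im (exp z) + s * b * Im (exp (of_real \<alpha> * z))) \<le> 4 * exp 1 + \<alpha> * 2 powr \<alpha> * exp \<alpha>"
        using 1 by simp
    qed
    finally show ?thesis .
  qed
  have rv: "real M * (r * v) \<le> real M * r"
    using assms v by (intro mult_left_mono mult_left_le) auto
  have "norm (\<Sum>k\<le>M. (-1)^k * of_nat (M choose k) * g (of_nat k * of_real (r * v)))
      \<le> 2 ^ M * (2 * B * (real M * (r * v) / (1 / R)) ^ M)"
  proof (rule entire_finite_difference_bound[OF _ _ gB])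
    show "g holomorphic_on UNIV" unfolding g_def by (intro holomorphic_intros)
    show "real M * (r * v) \<le> 1 / R / 2" using rv Mr by simp
  qed (use assms v in auto)
  also have "\<dots> \<le> 2 ^ M * (2 * B * (real M * r * R) ^ M)"
  proof (intro mult_left_mono power_mono)
    show "real M * (r * v) / (1 / R) \<le> real M * r * R"
      using rv assms by (simp add: mult_right_mono)
    show "0 \<le> real M * (r * v) / (1 / R)" using assms v by simp
  qed (auto simp: B_def)
  finally have main: "norm (\<Sum>k\<le>M. (-1)^k * of_nat (M choose k) * g (of_nat k * of_real (r * v)))
      \<le> 2 ^ M * (2 * B * (real M * r * R) ^ M)" .
  have "g (of_nat k * of_real (r * v)) = exp (\<i> * of_real (x \<bullet> (exp (real k * r * v) *\<^sub>R \<xi>) + s * norm (exp (real k * r * v) *\<^sub>R \<xi>) powr \<alpha>))" for k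
  proof -
    have e1: "exp (of_nat k * of_real (r * v) :: complex) = of_real (exp (real k * r * v))"
      unfolding of_real_of_nat_eq[where 'a=complex, symmetric] of_real_mult[symmetric] exp_of_real by (simp add: mult.assoc)
    have e2: "exp (of_real \<alpha> * (of_nat k * of_real (r * v)) :: complex) = of_real (exp (\<alpha> * (real k * r * v)))"
      unfolding of_real_of_nat_eq[where 'a=complex, symmetric] of_real_mult[symmetric] exp_of_real by (simp add: mult.assoc)
    have e3: "norm (exp (real k * r * v) *\<^sub>R \<xi>) powr \<alpha> = exp (\<alpha> * (real k * r * v)) * b"
      by (simp add: powr_mult exp_powr_real b_def mult_ac)
    show ?thesis
      unfolding g_def e1 e2 e3 by (simp add: a_def mult_ac)
  qed
  with main show ?thesis unfolding B_def by simp
qed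

section \<open>Essential supports, representatives in \<open>T_op\<close>, time intervals\<close>

text \<open>The complement of the essential support is a union of possibly uncountably many open
  sets, each good only up to a null set; Lindelof reduces it to a countable union.\<close>

lemma ess_supp_subsetD:
  assumes "ess_supp h \<subseteq> A"
  shows "AE \<xi> in lborel. \<xi> \<notin> A \<longrightarrow> h \<xi> = 0"
proof -
  let ?U = "{U. open U \<and> (AE \<xi> in lebesgue. \<xi> \<in> U \<longrightarrow> h \<xi> = 0)}"
  obtain V where V: "V \<subseteq> ?U" "countable V" "\<Union>V = \<Union>?U"
    using Lindelof[of ?U] by auto
  have "AE \<xi> in lebesgue. \<forall>U\<in>V. \<xi> \<in> U \<longrightarrow> h \<xi> = 0"
    using V by (subst AE_ball_countable) auto
  then have "AE \<xi> in lborel. \<forall>U\<in>V. \<xi> \<in> U \<longrightarrow> h \<xi> = 0"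
    by (simp add: AE_completion_iff)
  then show ?thesis
  proof eventually_elim
    case (elim \<xi>)
    then show ?case
      using assms V(3) unfolding ess_supp_def by blast
  qed
qed

lemma ess_supp_subsetI:
  assumes "closed A" "AE \<xi> in lborel. \<xi> \<notin> A \<longrightarrow> h \<xi> = 0"
  shows "ess_supp h \<subseteq> A"
  using assms unfolding ess_supp_def by (auto simp: AE_completion_iff intro: exI[of _ "- A"])

lemma T_op_eq:
  fixes h :: "'a::euclidean_space \<Rightarrow> complex"
  assumes [measurable]: "h \<in> borel_measurable borel" and ae: "AE \<xi> in lborel. fourier_L2 g \<xi> = h \<xi>"
  shows "T_op \<alpha> g (x, t) = (\<integral>\<xi>. exp (\<i> * of_real (x \<bullet> \<xi> + t * norm \<xi> powr \<alpha>)) * h \<xi> \<partial>lborel)"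
proof -
  have m: "(\<lambda>\<xi>. exp (\<i> * of_real (x \<bullet> \<xi> + t * norm \<xi> powr \<alpha>)) * h \<xi>) \<in> borel_measurable lebesgue"
    by (intro measurable_completion) simp
  have e: "AE \<xi> in lebesgue. exp (\<i> * of_real (x \<bullet> \<xi> + t * norm \<xi> powr \<alpha>)) * h \<xi> = exp (\<i> * of_real (x \<bullet> \<xi> + t * norm \<xi> powr \<alpha>)) * fourier_L2 g \<xi>"
    using AE_completion[OF ae] by eventually_elim simp
  have "T_op \<alpha> g (x, t) = (LINT \<xi>|lebesgue. exp (\<i> * of_real (x \<bullet> \<xi> + t * norm \<xi> powr \<alpha>)) * fourier_L2 g \<xi>)"
    by (simp add: T_op_def)
  also have "\<dots> = (LINT \<xi>|lebesgue. exp (\<i> * of_real (x \<bullet> \<xi> + t * norm \<xi> powr \<alpha>)) * h \<xi>)"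
    by (rule integral_cong_AE[symmetric, OF m borel_measurable_AE[OF m e] e])
  also have "\<dots> = (\<integral>\<xi>. exp (\<i> * of_real (x \<bullet> \<xi> + t * norm \<xi> powr \<alpha>)) * h \<xi> \<partial>lborel)"
    by (rule integral_completion) simp
  finally show ?thesis .
qed

text \<open>Needed for \<open>SUP y. norm (\<phi> y)\<close> to be an actual upper bound, since a
  supremum of an unbounded real set carries no information.\<close>

lemma test_function_bdd_above:
  fixes \<phi> :: "'a::euclidean_space \<Rightarrow> complex"
  assumes "\<phi> \<in> test_functions U"
  shows "bdd_above (range (\<lambda>y. norm (\<phi> y)))"
proof -
  let ?S = "closure {x. \<phi> x \<noteq> 0}"
  have "Ck 0 \<phi>" and c: "compact ?S" using assms by (auto simp: test_functions_def)
  then have "compact (\<phi> ` ?S)"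
    by (intro compact_continuous_image) (auto intro: continuous_on_subset)
  then obtain b where b: "\<And>y. y \<in> ?S \<Longrightarrow> norm (\<phi> y) \<le> b"
    by (meson bounded_iff compact_imp_bounded imageI)
  have "norm (\<phi> y) \<le> max b 0" for y
    using b[of y] closure_subset[of "{x. \<phi> x \<noteq> 0}"] by (cases "\<phi> y = 0") auto
  then show ?thesis by (intro bdd_aboveI2)
qed

lemma time_interval_bounds:
  assumes R: "R \<ge> 1" and j: "j \<le> last_index \<alpha> R" and t: "t \<in> time_interval \<alpha> R j"
  shows "0 \<le> t - time_node R j" "t - time_node R j \<le> R"
proof -
  show "0 \<le> t - time_node R j"
    using t by (auto simp: time_interval_def split: if_splits)
  show "t - time_node R j \<le> R"
  proof (cases "j < last_index \<alpha> R")
    case True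
    then show ?thesis using t by (simp add: time_interval_def time_node_def algebra_simps)
  next
    case False
    then have "t < R powr \<alpha>" using t by (simp add: time_interval_def)
    also have "R powr \<alpha> = R powr (\<alpha> - 1) * R"
      using R by (simp add: powr_diff)
    \<comment> \<open>In the last interval j is the integer part of R^(\<alpha> - 1), so the
      endpoint R^\<alpha> comes no later than the next node would.\<close>
    also have "\<dots> \<le> (real j + 1) * R"
    proof (intro mult_right_mono)
      have "j = nat \<lfloor>R powr (\<alpha> - 1)\<rfloor>" using False j by (simp add: last_index_def)
      then show "R powr (\<alpha> - 1) \<le> real j + 1" by linarith
    qed (use R in simp)
    finally show ?thesis by (simp add: time_node_def algebra_simps)
  qed
qed

section \<open>The localized pieces\<close>

text \<open>Cauchy-Schwarz against the indicator of the ball. It converts the natural L1 bound on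
  the frequency side into the L2 norm of f.\<close>

lemma integral_norm_le_L2_norm:
  fixes h :: "'a::euclidean_space \<Rightarrow> complex"
  assumes [measurable]: "h \<in> borel_measurable borel" and fin: "l2sq h < \<infinity>"
    and supp: "\<And>\<xi>. h \<xi> \<noteq> 0 \<Longrightarrow> norm \<xi> < r"
  shows "integrable lborel h"
    and "(\<integral>\<xi>. norm (h \<xi>) \<partial>lborel) \<le> sqrt (enn2real (l2sq h) * enn2real (l2sq (indicator (ball (0::'a) r))))"
proof -
  let ?i = "indicator (ball (0::'a) r) :: 'a \<Rightarrow> complex"
  have [measurable]: "?i \<in> borel_measurable borel"
    by (intro borel_measurable_indicator) simp
  have hi: "h \<xi> * ?i \<xi> = h \<xi>" for \<xi>
    using supp[of \<xi>] by (cases "h \<xi> = 0") (auto simp: indicator_def)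
  show I: "integrable lborel h"
    using integrable_l2_mult[of h ?i] fin l2sq_indicator_ball[of r, where 'a='a] by (simp add: hi)
  define n where "n \<xi> = complex_of_real (norm (h \<xi>))" for \<xi>
  have [measurable]: "n \<in> borel_measurable borel"
    unfolding n_def by measurable
  have ln: "l2sq n = l2sq h" by (simp add: l2sq_def n_def)
  have ni: "n \<xi> * ?i \<xi> = n \<xi>" for \<xi>
    using supp[of \<xi>] by (cases "h \<xi> = 0") (auto simp: indicator_def n_def)
  have "ennreal ((norm (\<integral>\<xi>. n \<xi> * ?i \<xi> \<partial>lborel))\<^sup>2) \<le> l2sq n * l2sq ?i"
    by (rule l2_Cauchy_Schwarz) (use fin l2sq_indicator_ball[of r, where 'a='a] in \<open>auto simp: ln\<close>)
  also have "l2sq n * l2sq ?i = ennreal (enn2real (l2sq h) * enn2real (l2sq ?i))"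
    using fin l2sq_indicator_ball[of r, where 'a='a] by (subst ennreal_mult) (auto simp: ln)
  finally have "(norm (\<integral>\<xi>. n \<xi> \<partial>lborel))\<^sup>2 \<le> enn2real (l2sq h) * enn2real (l2sq ?i)"
    unfolding ni by (subst (asm) ennreal_le_iff) auto
  moreover have "(\<integral>\<xi>. n \<xi> \<partial>lborel) = of_real (\<integral>\<xi>. norm (h \<xi>) \<partial>lborel)"
    unfolding n_def by (rule integral_complex_of_real)
  ultimately show "(\<integral>\<xi>. norm (h \<xi>) \<partial>lborel) \<le> sqrt (enn2real (l2sq h) * enn2real (l2sq ?i))"
    by (intro real_le_rsqrt) simp
qed

text \<open>Tonelli for a finite sum. If the sum is infinite, both sides are 0 by the conventions
  for divergent integrals and for \<open>enn2real\<close>.\<close>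

lemma L2_norm_square_function:
  fixes F :: "nat \<Rightarrow> 'a::euclidean_space \<Rightarrow> complex"
  assumes [measurable]: "\<And>j. F j \<in> borel_measurable borel"
  shows "L2_norm (\<lambda>x. sqrt (\<Sum>j\<le>J. (norm (F j x))\<^sup>2)) = sqrt (enn2real (\<Sum>j\<le>J. l2sq (F j)))"
proof -
  have "(LINT x|lebesgue. (norm (sqrt (\<Sum>j\<le>J. (norm (F j x))\<^sup>2)))\<^sup>2) = (\<integral>x. (\<Sum>j\<le>J. (norm (F j x))\<^sup>2) \<partial>lborel)"
    by (subst integral_completion) (auto simp: sum_nonneg)
  also have "\<dots> = enn2real (\<integral>\<^sup>+x. ennreal (\<Sum>j\<le>J. (norm (F j x))\<^sup>2) \<partial>lborel)"
    by (rule integral_eq_nn_integral) (auto simp: sum_nonneg)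
  also have "(\<integral>\<^sup>+x. ennreal (\<Sum>j\<le>J. (norm (F j x))\<^sup>2) \<partial>lborel) = (\<Sum>j\<le>J. l2sq (F j))"
    unfolding l2sq_def by (subst nn_integral_sum[symmetric]) auto
  finally show ?thesis by (simp add: L2_norm_def)
qed

lemma exp_le_1_plus_2: "0 \<le> x \<Longrightarrow> x \<le> 1 \<Longrightarrow> exp x \<le> 1 + 2 * (x::real)"
proof -
  assume x: "0 \<le> x" "x \<le> 1"
  have "exp x \<le> 1 + x + x\<^sup>2" by (rule exp_bound[OF x])
  also have "x\<^sup>2 \<le> x" using x by (simp add: power2_eq_square mult_left_le)
  finally show ?thesis by simp
qed

text \<open>The construction for arbitrary M and r. The first smallness condition governs the
  support and the half disc for the phase, the second the single period in the Bessel inequality;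
  \<open>C0\<close> is the constant bounding the squared norm of the transform.\<close>

theorem localized_pieces_exist:
  fixes f :: "'a::euclidean_space \<Rightarrow> complex"
  assumes al: "\<alpha> > 0" and M: "M \<ge> 1" and R: "R \<ge> 1" and r: "r > 0"
    and small1: "4 * (real M * r) \<le> 1 / R"
    and small2: "R * (real M * r) * \<alpha> * 2 powr \<alpha> * exp \<alpha> \<le> 2 * pi"
    and f: "f \<in> L2" and supp: "ess_supp (fourier_L2 f) \<subseteq> {\<xi>. 1/2 \<le> norm \<xi> \<and> norm \<xi> \<le> 2}"
  defines "C0 \<equiv> 2 * (2 * pi) ^ DIM('a)"
  obtains F :: "nat \<Rightarrow> 'a \<Rightarrow> complex" where
    "\<And>j. F j \<in> borel_measurable borel" "\<And>j. F j \<in> L2"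
    "\<And>j. ess_supp (fourier_L2 (F j)) \<subseteq> {\<xi>. 1/2 - 1/R \<le> norm \<xi> \<and> norm \<xi> \<le> 2 + 1/R}"
    "\<And>j x s. norm x \<le> 2 * R \<Longrightarrow> 0 \<le> s \<Longrightarrow> s \<le> R \<Longrightarrow>
      norm (T_op \<alpha> f (x, real j * R + s) - T_op \<alpha> (F j) (x, s))
      \<le> 2 ^ M * (2 * exp (4 * exp 1 + \<alpha> * 2 powr \<alpha> * exp \<alpha>) * (real M * r * R) ^ M)
        * (sqrt (C0 * enn2real (l2sq (indicator (ball (0::'a) 3)))) * L2_norm f)"
    "\<And>J. (\<Sum>j\<le>J. l2sq (F j))
      \<le> ennreal ((real M)\<^sup>2 * 4 ^ M * (2 * pi / (R * \<alpha> * r * exp (- \<alpha>) * (1/2) powr \<alpha>)) * C0 * (L2_norm f)\<^sup>2)"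
proof -
  let ?Ann = "{\<xi>::'a. 1/2 \<le> norm \<xi> \<and> norm \<xi> \<le> 2}"
  let ?Ann' = "{\<xi>::'a. 1/2 - 1/R \<le> norm \<xi> \<and> norm \<xi> \<le> 2 + 1/R}"
  obtain h0 where h0[measurable]: "h0 \<in> borel_measurable borel" and ae0: "AE \<xi> in lborel. fourier_L2 f \<xi> = h0 \<xi>"
    and le0: "l2sq h0 \<le> 2 * (ennreal ((2 * pi) ^ DIM('a)) * l2sq f)"
    using fourier_L2_rep[OF f] by metis
  \<comment> \<open>Setting the representative to 0 off the annulus turns an a.e. support condition
    into a pointwise one, as required along individual rays.\<close>
  define h where "h \<xi> = (if 1/2 \<le> norm \<xi> \<and> norm \<xi> \<le> 2 then h0 \<xi> else 0)" for \<xi>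
  have h[measurable]: "h \<in> borel_measurable borel"
    unfolding h_def by measurable
  have hs: "1/2 \<le> norm \<xi> \<and> norm \<xi> \<le> 2" if "h \<xi> \<noteq> 0" for \<xi>
    using that by (auto simp: h_def split: if_splits)
  have ae: "AE \<xi> in lborel. fourier_L2 f \<xi> = h \<xi>"
    using ae0 ess_supp_subsetD[OF supp] by eventually_elim (auto simp: h_def)
  have C0: "C0 \<ge> 0" by (simp add: C0_def)
  have lh: "l2sq h \<le> ennreal (C0 * (L2_norm f)\<^sup>2)"
  proof -
    have nf: "L2_norm f \<ge> 0" by (simp add: L2_norm_def)
    have "l2sq h \<le> l2sq h0" by (intro l2sq_mono) (simp add: h_def)
    also note le0
    also have "2 * (ennreal ((2 * pi) ^ DIM('a)) * l2sq f) = ennreal (C0 * (L2_norm f)\<^sup>2)"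
      using nf L2_norm_eq[OF f]
      by (simp add: C0_def ennreal_mult ennreal_power mult.assoc)
    finally show ?thesis .
  qed
  then have finh: "l2sq h < \<infinity>" by (rule le_less_trans) simp
  \<comment> \<open>The transform of the solution at time j R; evolving it for a further time s
    gives Tf at time j R + s.\<close>
  define p where "p j \<xi> = exp (\<i> * of_real (real j * R * norm \<xi> powr \<alpha>)) * h \<xi>" for j :: nat and \<xi>
  have [measurable]: "p j \<in> borel_measurable borel" for j
    unfolding p_def by measurable
  have np: "norm (p j \<xi>) = norm (h \<xi>)" for j \<xi>
    by (simp add: p_def norm_mult)
  have Ih: "integrable lborel h"
    by (rule integral_norm_le_L2_norm(1)[OF h finh, of 3]) (use hs in fastforce)
  have Ip: "integrable lborel (p j)" for j
    by (rule Bochner_Integration.integrable_bound[OF Ih]) (auto simp: np)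
  define H where "H j = dil_cutoff M r (p j)" for j
  have [measurable]: "H j \<in> borel_measurable borel" for j
    unfolding H_def by measurable
  have IH: "integrable lborel (H j)" for j
    using integrable_mult_dil_cutoff[OF Ip[of j], of "\<lambda>_. 1" 1 M r] by (simp add: H_def)
  define D where "D = (real M)\<^sup>2 * 4 ^ M * (2 * pi / (R * \<alpha> * r * exp (- \<alpha>) * (1/2) powr \<alpha>))"
  have D0: "D \<ge> 0" unfolding D_def using al R r by simp
  have Mr: "0 \<le> real M * r" "real M * r \<le> 1"
  proof -
    have "1 / R \<le> 1" using R by simp
    then show "real M * r \<le> 1" using small1 by linarith
  qed (use r in simp)
  have sumH: "(\<Sum>j\<le>J. l2sq (H j)) \<le> ennreal (D * C0 * (L2_norm f)\<^sup>2)" for J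
  proof -
    have "(\<Sum>j\<le>J. l2sq (H j)) \<le> ennreal D * l2sq h"
      unfolding H_def p_def D_def using al R r Mr small2
      by (intro sum_l2sq_dil_cutoff h hs) auto
    also have "\<dots> \<le> ennreal D * ennreal (C0 * (L2_norm f)\<^sup>2)"
      by (intro mult_left_mono lh) simp
    also have "\<dots> = ennreal (D * C0 * (L2_norm f)\<^sup>2)"
      using D0 C0 by (subst ennreal_mult[symmetric]) (auto simp: mult.assoc)
    finally show ?thesis .
  qed
  have finH: "l2sq (H j) < \<infinity>" for j
  proof -
    have "l2sq (H j) \<le> (\<Sum>i\<le>j. l2sq (H i))" by (rule member_le_sum) auto
    also note sumH
    also have "ennreal (D * C0 * (L2_norm f)\<^sup>2) < \<infinity>" by simp
    finally show ?thesis .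
  qed
  \<comment> \<open>The inverse transform of \<open>H j\<close>; \<open>fourier_L2_inversion\<close>
    gives back \<open>H j\<close> a.e. as its L2 transform.\<close>
  define F where "F j x = fourier (H j) (- x) / of_real ((2 * pi) ^ DIM('a))" for j x
  note inv = fourier_L2_inversion[OF IH finH, folded F_def]
  have Hsupp: "H j \<xi> = 0" if "\<xi> \<notin> ?Ann'" for j \<xi>
    unfolding H_def
  proof (rule dil_cutoff_eq_0)
    fix s assume s: "0 \<le> s" "s \<le> real M * r"
    show "p j (exp (- s) *\<^sub>R \<xi>) = 0"
    proof (rule ccontr)
      assume "p j (exp (- s) *\<^sub>R \<xi>) \<noteq> 0"
      then have "h (exp (- s) *\<^sub>R \<xi>) \<noteq> 0" by (auto simp: p_def)
      then have b: "1/2 \<le> exp (- s) * norm \<xi>" "exp (- s) * norm \<xi> \<le> 2"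
        using hs by fastforce+
      have e: "norm \<xi> = exp s * (exp (- s) * norm \<xi>)"
        by (simp add: exp_minus)
      have "1 * (1/2) \<le> exp s * (exp (- s) * norm \<xi>)"
        using b s by (intro mult_mono) auto
      then have "1/2 \<le> norm \<xi>" using e by simp
      moreover have "norm \<xi> \<le> 2 + 1 / R"
      proof -
        have "exp s * (exp (- s) * norm \<xi>) \<le> exp s * 2"
          using b by (intro mult_left_mono) auto
        \<comment> \<open>The outer radius becomes at most 2 (1 + 2 s) = 2 + 4 s with s up to M r;
          this is the origin of the factor 4 in \<open>small1\<close>.\<close>
        moreover have "exp s \<le> 1 + 2 * s"
          using s Mr by (intro exp_le_1_plus_2) auto
        ultimately show ?thesis using e s small1 by linarith
      qed
      moreover have "1 / R \<ge> 0" using R by simp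
      ultimately have "1/2 - 1/R \<le> norm \<xi>" "norm \<xi> \<le> 2 + 1/R" by linarith+
      then have "\<xi> \<in> ?Ann'" by simp
      with that show False ..
    qed
  qed (use r in simp)
  have suppF: "ess_supp (fourier_L2 (F j)) \<subseteq> ?Ann'" for j
  proof (rule ess_supp_subsetI)
    have "?Ann' = {\<xi>. 1/2 - 1/R \<le> norm \<xi>} \<inter> {\<xi>. norm \<xi> \<le> 2 + 1/R}" by auto
    then show "closed ?Ann'"
      by (simp only:) (intro closed_Int closed_Collect_le continuous_intros)
    show "AE \<xi> in lborel. \<xi> \<notin> ?Ann' \<longrightarrow> fourier_L2 (F j) \<xi> = 0"
      using inv(4)[of j] by eventually_elim (use Hsupp in auto)
  qed
  define E where "E = 2 ^ M * (2 * exp (4 * exp 1 + \<alpha> * 2 powr \<alpha> * exp \<alpha>) * (real M * r * R) ^ M)"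
  have E0: "E \<ge> 0" unfolding E_def using r R by simp
  define V where "V = enn2real (l2sq (indicator (ball (0::'a) 3)))"
  have hV: "(\<integral>\<xi>. norm (h \<xi>) \<partial>lborel) \<le> sqrt (C0 * V) * L2_norm f"
  proof -
    have "(\<integral>\<xi>. norm (h \<xi>) \<partial>lborel) \<le> sqrt (enn2real (l2sq h) * V)"
      unfolding V_def by (rule integral_norm_le_L2_norm(2)[OF h finh]) (use hs in fastforce)
    also have "\<dots> \<le> sqrt (C0 * (L2_norm f)\<^sup>2 * V)"
      using lh C0 by (intro real_sqrt_le_mono mult_right_mono enn2real_leI) (auto simp: V_def)
    also have "\<dots> = sqrt (C0 * V) * L2_norm f"
      by (simp add: real_sqrt_mult L2_norm_def)
    finally show ?thesis .
  qed
  have T: "norm (T_op \<alpha> f (x, real j * R + s) - T_op \<alpha> (F j) (x, s)) \<le> E * (sqrt (C0 * V) * L2_norm f)"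
    if x: "norm x \<le> 2 * R" and s: "0 \<le> s" "s \<le> R" for j x s
  proof -
    define m where "m \<xi> = exp (\<i> * of_real (x \<bullet> \<xi> + s * norm \<xi> powr \<alpha>))" for \<xi>
    have m[measurable]: "m \<in> borel_measurable borel" unfolding m_def by measurable
    have nm: "norm (m \<xi>) \<le> 1" for \<xi> unfolding m_def norm_exp_ii by simp
    have "T_op \<alpha> f (x, real j * R + s) = (\<integral>\<xi>. exp (\<i> * of_real (x \<bullet> \<xi> + (real j * R + s) * norm \<xi> powr \<alpha>)) * h \<xi> \<partial>lborel)"
      by (rule T_op_eq[OF h ae])
    also have "\<dots> = (\<integral>\<xi>. m \<xi> * p j \<xi> \<partial>lborel)"
      unfolding m_def p_def mult.assoc[symmetric] exp_add[symmetric]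
      by (intro Bochner_Integration.integral_cong refl) (simp add: algebra_simps)
    finally have Tf: "T_op \<alpha> f (x, real j * R + s) = (\<integral>\<xi>. m \<xi> * p j \<xi> \<partial>lborel)" .
    have TF: "T_op \<alpha> (F j) (x, s) = (\<integral>\<xi>. m \<xi> * dil_cutoff M r (p j) \<xi> \<partial>lborel)"
      using T_op_eq[OF _ inv(4)[of j], of \<alpha> x s] by (simp add: m_def H_def)
    define A where "A \<xi> = (\<integral>v. indicator {0..1} v * (\<Sum>k\<le>M. (-1)^k * of_nat (M choose k) * m (exp (real k * r * v) *\<^sub>R \<xi>)) \<partial>lborel)" for \<xi>
    have [measurable]: "A \<in> borel_measurable borel"
      unfolding A_def by measurable
    have A: "norm (A \<xi>) \<le> E" if "norm \<xi> \<le> 2" for \<xi>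
    proof -
      have "norm (A \<xi>) \<le> (\<integral>v. norm (indicator {0..1::real} v * (\<Sum>k\<le>M. (-1)^k * of_nat (M choose k) * m (exp (real k * r * v) *\<^sub>R \<xi>))) \<partial>lborel)"
        unfolding A_def by (rule integral_norm_bound)
      also have "\<dots> \<le> (\<integral>v. indicator {0..1::real} v * E \<partial>lborel)"
      proof (rule integral_mono_AE')
        show "integrable lborel (\<lambda>v. indicator {0..1::real} v * E)"
          by (intro integrable_mult_left integrable_real_indicator) auto
        show "AE v in lborel. norm (indicator {0..1::real} v * (\<Sum>k\<le>M. (-1)^k * of_nat (M choose k) * m (exp (real k * r * v) *\<^sub>R \<xi>))) \<le> indicator {0..1} v * E"
        proof (rule AE_I2)
          fix v :: real
          show "norm (indicator {0..1::real} v * (\<Sum>k\<le>M. (-1)^k * of_nat (M choose k) * m (exp (real k * r * v) *\<^sub>R \<xi>))) \<le> indicator {0..1} v * E"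
          proof (cases "v \<in> {0..1}")
            case v: True
            have "norm (\<Sum>k\<le>M. (-1)^k * of_nat (M choose k) * m (exp (real k * r * v) *\<^sub>R \<xi>)) \<le> E"
              unfolding m_def E_def
              by (rule phase_difference_bound[OF al R _ _ x s that v]) (use small1 r R in \<open>auto simp: field_simps\<close>)
            then show ?thesis using v by (simp add: norm_mult)
          qed simp
        qed
      qed (simp add: E0)
      also have "\<dots> = E" by simp
      finally show ?thesis .
    qed
    have "norm (T_op \<alpha> f (x, real j * R + s) - T_op \<alpha> (F j) (x, s)) = norm (\<integral>\<xi>. p j \<xi> * A \<xi> \<partial>lborel)"
      unfolding Tf TF A_def integral_diff_dil_cutoff[OF Ip m nm] ..
    also have "\<dots> \<le> (\<integral>\<xi>. norm (p j \<xi> * A \<xi>) \<partial>lborel)"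
      by (rule integral_norm_bound)
    also have "\<dots> \<le> (\<integral>\<xi>. E * norm (h \<xi>) \<partial>lborel)"
    proof (rule integral_mono_AE')
      show "integrable lborel (\<lambda>\<xi>. E * norm (h \<xi>))"
        by (intro integrable_mult_right integrable_norm Ih)
      show "AE \<xi> in lborel. norm (p j \<xi> * A \<xi>) \<le> E * norm (h \<xi>)"
      proof (rule AE_I2)
        fix \<xi>
        show "norm (p j \<xi> * A \<xi>) \<le> E * norm (h \<xi>)"
        proof (cases "h \<xi> = 0")
          case False
          then have "norm (A \<xi>) \<le> E" using A hs by auto
          then show ?thesis by (simp add: norm_mult np mult.commute mult_right_mono)
        qed (simp add: p_def)
      qed
    qed (simp add: E0)
    also have "\<dots> = E * (\<integral>\<xi>. norm (h \<xi>) \<partial>lborel)" by simp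
    also have "\<dots> \<le> E * (sqrt (C0 * V) * L2_norm f)"
      using hV E0 by (rule mult_left_mono)
    finally show ?thesis .
  qed
  show ?thesis
  proof (rule that[of F])
    show "(\<Sum>j\<le>J. l2sq (F j)) \<le> ennreal ((real M)\<^sup>2 * 4 ^ M * (2 * pi / (R * \<alpha> * r * exp (- \<alpha>) * (1/2) powr \<alpha>)) * C0 * (L2_norm f)\<^sup>2)" for J
      using order_trans[OF sum_mono[of "{..J}", OF inv(2)] sumH[of J]] by (simp add: D_def)
  qed (use inv suppF T in \<open>auto simp: E_def V_def\<close>)
qed

text \<open>What remains is the choice of parameters. The sum of squares carries the factor 1/(R r)
  = R^\<epsilon>, and taking its square root gives \<open>c_d\<close> = 1/2.\<close>

theorem lemma2p5:
  shows "\<exists>c_d::real. c_d > 0 \<and> (\<forall>\<alpha> > (1::real). \<forall>\<epsilon> > (0::real).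
    \<exists>(R0::real) (C::real) (K::real \<Rightarrow> real). C > 0 \<and>
    (\<forall>R \<ge> R0. \<forall>(f :: real ^ 'd \<Rightarrow> complex) (\<phi> :: real ^ 'd \<Rightarrow> complex).
       f \<in> L2 \<longrightarrow>
       ess_supp (fourier_L2 f) \<subseteq> {\<xi>. 1/2 \<le> norm \<xi> \<and> norm \<xi> \<le> 2} \<longrightarrow>
       \<phi> \<in> test_functions (ball 0 (2 * R)) \<longrightarrow>
       (\<forall>x' \<in> ball 0 R. \<phi> x' = 1) \<longrightarrow>
       (\<exists>F :: nat \<Rightarrow> real ^ 'd \<Rightarrow> complex.
          (\<forall>j \<le> last_index \<alpha> R. F j \<in> L2 \<and>
             ess_supp (fourier_L2 (F j)) \<subseteq> {\<xi>. 1/2 - 1/R \<le> norm \<xi> \<and> norm \<xi> \<le> 2 + 1/R}) \<and>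
          (\<forall>j \<le> last_index \<alpha> R. \<forall>x'. \<forall>t \<in> time_interval \<alpha> R j.
             norm (\<phi> x' * T_op \<alpha> f (x', t)
                   - \<phi> x' * indicator (time_interval \<alpha> R j) t * T_op \<alpha> (F j) (x', t - time_node R j))
               \<le> K (SUP y. norm (\<phi> y)) * (R powr (- 99 * real CARD('d)) * L2_norm f)) \<and>
          L2_norm (\<lambda>x. sqrt (\<Sum>j \<le> last_index \<alpha> R. (norm (F j x))\<^sup>2))
            \<le> C * R powr (\<epsilon> * c_d) * L2_norm f)))"
proof (rule exI[of _ "1/2"], intro conjI allI impI)
  fix \<alpha> \<epsilon> :: real assume al: "\<alpha> > 1" and eps: "\<epsilon> > 0"
  define d where "d = real CARD('d)"
  \<comment> \<open>Ensures \<epsilon> M \<ge> 99 d, so that (R^(-\<epsilon>))^M is at most R^(-99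
    d); the added 1 keeps M positive.\<close>
  define M where "M = nat \<lceil>99 * d / \<epsilon>\<rceil> + 1"
  have M1: "M \<ge> 1" by (simp add: M_def)
  have Me: "99 * d \<le> \<epsilon> * real M"
  proof -
    have "99 * d / \<epsilon> \<le> real M" unfolding M_def by linarith
    then show ?thesis using eps by (simp add: field_simps)
  qed
  \<comment> \<open>The largest value of M r R to be allowed: 1/4 serves \<open>small1\<close>, and
    the second entry bounds the phase range by 1, hence by a period, in
    \<open>small2\<close>.\<close>
  define \<kappa> where "\<kappa> = min (1/4) (1 / (\<alpha> * 2 powr \<alpha> * exp \<alpha>))"
  have kap: "\<kappa> > 0" "\<kappa> \<le> 1/4" "\<kappa> * (\<alpha> * 2 powr \<alpha> * exp \<alpha>) \<le> 1"
  proof -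
    show "\<kappa> > 0" "\<kappa> \<le> 1/4" unfolding \<kappa>_def using al by auto
    have "\<kappa> * (\<alpha> * 2 powr \<alpha> * exp \<alpha>) \<le> 1 / (\<alpha> * 2 powr \<alpha> * exp \<alpha>) * (\<alpha> * 2 powr \<alpha> * exp \<alpha>)"
      using al by (intro mult_right_mono) (auto simp: \<kappa>_def)
    also have "\<dots> = 1" using al by simp
    finally show "\<kappa> * (\<alpha> * 2 powr \<alpha> * exp \<alpha>) \<le> 1" .
  qed
  \<comment> \<open>Equivalent to R \<ge> 1 together with M R^(-\<epsilon>) \<le> \<kappa>.\<close>
  define R0 where "R0 = max 1 ((real M / \<kappa>) powr (1 / \<epsilon>))"
  define C0 where "C0 = 2 * (2 * pi) ^ DIM(real ^ 'd)"
  define D where "D = (real M)\<^sup>2 * 4 ^ M * (2 * pi / (\<alpha> * exp (- \<alpha>) * (1/2) powr \<alpha>)) * C0"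
  have C0: "C0 > 0" by (simp add: C0_def)
  have D: "D > 0" unfolding D_def using C0 al M1 by simp
  define B where "B = 2 ^ M * (2 * exp (4 * exp 1 + \<alpha> * 2 powr \<alpha> * exp \<alpha>) * real M ^ M)
      * sqrt (C0 * enn2real (l2sq (indicator (ball (0::real ^ 'd) 3))))"
  have B0: "B \<ge> 0" unfolding B_def using C0 by simp
  show "\<exists>(R0::real) (C::real) (K::real \<Rightarrow> real). C > 0 \<and>
    (\<forall>R \<ge> R0. \<forall>(f :: real ^ 'd \<Rightarrow> complex) (\<phi> :: real ^ 'd \<Rightarrow> complex).
       f \<in> L2 \<longrightarrow>
       ess_supp (fourier_L2 f) \<subseteq> {\<xi>. 1/2 \<le> norm \<xi> \<and> norm \<xi> \<le> 2} \<longrightarrow>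
       \<phi> \<in> test_functions (ball 0 (2 * R)) \<longrightarrow>
       (\<forall>x' \<in> ball 0 R. \<phi> x' = 1) \<longrightarrow>
       (\<exists>F :: nat \<Rightarrow> real ^ 'd \<Rightarrow> complex.
          (\<forall>j \<le> last_index \<alpha> R. F j \<in> L2 \<and>
             ess_supp (fourier_L2 (F j)) \<subseteq> {\<xi>. 1/2 - 1/R \<le> norm \<xi> \<and> norm \<xi> \<le> 2 + 1/R}) \<and>
          (\<forall>j \<le> last_index \<alpha> R. \<forall>x'. \<forall>t \<in> time_interval \<alpha> R j.
             norm (\<phi> x' * T_op \<alpha> f (x', t)
                   - \<phi> x' * indicator (time_interval \<alpha> R j) t * T_op \<alpha> (F j) (x', t - time_node R j))
               \<le> K (SUP y. norm (\<phi> y)) * (R powr (- 99 * real CARD('d)) * L2_norm f)) \<and>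
          L2_norm (\<lambda>x. sqrt (\<Sum>j \<le> last_index \<alpha> R. (norm (F j x))\<^sup>2))
            \<le> C * R powr (\<epsilon> * (1/2)) * L2_norm f))"
  \<comment> \<open>The error constant is linear in the supremum of |\<phi>|, because \<phi> only
    multiplies a pointwise estimate.\<close>
  proof (rule exI[of _ R0], rule exI[of _ "sqrt D"], rule exI[of _ "\<lambda>s. B * s"], intro conjI allI impI)
    show "sqrt D > 0" using D by simp
    fix R :: real and f \<phi> :: "real ^ 'd \<Rightarrow> complex"
    assume RR: "R0 \<le> R" and f: "f \<in> L2"
      and supp: "ess_supp (fourier_L2 f) \<subseteq> {\<xi>. 1/2 \<le> norm \<xi> \<and> norm \<xi> \<le> 2}"
      and phi: "\<phi> \<in> test_functions (ball 0 (2 * R))"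
    have R: "R \<ge> 1" using RR by (simp add: R0_def)
    define r where "r = R powr (- 1 - \<epsilon>)"
    have r: "r > 0" using R by (simp add: r_def)
    have rR: "r * R = R powr (- \<epsilon>)"
    proof -
      have "r * R powr 1 = R powr (- 1 - \<epsilon> + 1)" unfolding r_def by (rule powr_add[symmetric])
      then show ?thesis using R by simp
    qed
    have MrR: "real M * r * R \<le> \<kappa>"
    proof -
      have "real M / \<kappa> = ((real M / \<kappa>) powr (1 / \<epsilon>)) powr \<epsilon>"
        using kap eps M1 by (simp add: powr_powr)
      also have "\<dots> \<le> R powr \<epsilon>"
        using RR eps by (intro powr_mono2) (auto simp: R0_def)
      finally have "real M \<le> R powr \<epsilon> * \<kappa>" using kap by (simp add: field_simps)
      then have "real M * R powr (- \<epsilon>) \<le> \<kappa>"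
        using R by (simp add: powr_minus field_simps)
      then show ?thesis by (simp add: mult.assoc rR)
    qed
    have small1: "4 * (real M * r) \<le> 1 / R"
      using MrR kap(2) R by (simp add: field_simps)
    have small2: "R * (real M * r) * \<alpha> * 2 powr \<alpha> * exp \<alpha> \<le> 2 * pi"
    proof -
      have "R * (real M * r) * \<alpha> * 2 powr \<alpha> * exp \<alpha> = (real M * r * R) * (\<alpha> * 2 powr \<alpha> * exp \<alpha>)"
        by (simp add: mult_ac)
      also have "\<dots> \<le> \<kappa> * (\<alpha> * 2 powr \<alpha> * exp \<alpha>)"
        using MrR al by (intro mult_right_mono) auto
      also have "\<dots> \<le> 2 * pi" using kap(3) pi_ge_two by linarith
      finally show ?thesis .
    qed
    obtain F :: "nat \<Rightarrow> real ^ 'd \<Rightarrow> complex" where F: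
      "\<And>j. F j \<in> borel_measurable borel" "\<And>j. F j \<in> L2"
      "\<And>j. ess_supp (fourier_L2 (F j)) \<subseteq> {\<xi>. 1/2 - 1/R \<le> norm \<xi> \<and> norm \<xi> \<le> 2 + 1/R}"
      "\<And>j x s. norm x \<le> 2 * R \<Longrightarrow> 0 \<le> s \<Longrightarrow> s \<le> R \<Longrightarrow>
        norm (T_op \<alpha> f (x, real j * R + s) - T_op \<alpha> (F j) (x, s))
        \<le> 2 ^ M * (2 * exp (4 * exp 1 + \<alpha> * 2 powr \<alpha> * exp \<alpha>) * (real M * r * R) ^ M)
          * (sqrt (C0 * enn2real (l2sq (indicator (ball (0::real ^ 'd) 3)))) * L2_norm f)"
      "\<And>J. (\<Sum>j\<le>J. l2sq (F j))
        \<le> ennreal ((real M)\<^sup>2 * 4 ^ M * (2 * pi / (R * \<alpha> * r * exp (- \<alpha>) * (1/2) powr \<alpha>)) * C0 * (L2_norm f)\<^sup>2)"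
      unfolding C0_def
      by (rule localized_pieces_exist[OF _ M1 R r small1 small2 f supp]) (use al in auto)
    have nf: "L2_norm f \<ge> 0" by (simp add: L2_norm_def)
    have pw: "(real M * r * R) ^ M \<le> real M ^ M * R powr (- 99 * d)"
    proof -
      have "(real M * r * R) ^ M = real M ^ M * (R powr (- \<epsilon>)) ^ M"
        by (simp add: mult.assoc rR power_mult_distrib)
      also have "(R powr (- \<epsilon>)) ^ M = R powr (- (\<epsilon> * real M))"
        using R by (simp add: powr_power mult.commute)
      also have "\<dots> \<le> R powr (- 99 * d)"
        using R Me by (intro powr_mono) auto
      finally show ?thesis by (simp add: mult_left_mono)
    qed
    have err: "norm (T_op \<alpha> f (x, real j * R + s) - T_op \<alpha> (F j) (x, s)) \<le> B * (R powr (- 99 * d) * L2_norm f)"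
      if "norm x \<le> 2 * R" "0 \<le> s" "s \<le> R" for j x s
    proof -
      let ?e = "exp (4 * exp 1 + \<alpha> * 2 powr \<alpha> * exp \<alpha>)" and ?q = "sqrt (C0 * enn2real (l2sq (indicator (ball (0::real ^ 'd) 3))))"
      have "norm (T_op \<alpha> f (x, real j * R + s) - T_op \<alpha> (F j) (x, s))
          \<le> 2 ^ M * (2 * ?e * (real M * r * R) ^ M) * (?q * L2_norm f)"
        by (rule F(4)[OF that])
      also have "\<dots> \<le> 2 ^ M * (2 * ?e * (real M ^ M * R powr (- 99 * d))) * (?q * L2_norm f)"
        using pw nf C0 by (intro mult_right_mono mult_left_mono) auto
      also have "\<dots> = B * (R powr (- 99 * d) * L2_norm f)"
        by (simp add: B_def mult_ac)
      finally show ?thesis .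
    qed
    show "\<exists>F :: nat \<Rightarrow> real ^ 'd \<Rightarrow> complex.
          (\<forall>j \<le> last_index \<alpha> R. F j \<in> L2 \<and>
             ess_supp (fourier_L2 (F j)) \<subseteq> {\<xi>. 1/2 - 1/R \<le> norm \<xi> \<and> norm \<xi> \<le> 2 + 1/R}) \<and>
          (\<forall>j \<le> last_index \<alpha> R. \<forall>x'. \<forall>t \<in> time_interval \<alpha> R j.
             norm (\<phi> x' * T_op \<alpha> f (x', t)
                   - \<phi> x' * indicator (time_interval \<alpha> R j) t * T_op \<alpha> (F j) (x', t - time_node R j))
               \<le> B * (SUP y. norm (\<phi> y)) * (R powr (- 99 * real CARD('d)) * L2_norm f)) \<and>
          L2_norm (\<lambda>x. sqrt (\<Sum>j \<le> last_index \<alpha> R. (norm (F j x))\<^sup>2))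
            \<le> sqrt D * R powr (\<epsilon> * (1/2)) * L2_norm f"
    proof (rule exI[of _ F], intro conjI allI impI ballI)
      fix j x' t assume j: "j \<le> last_index \<alpha> R" and t: "t \<in> time_interval \<alpha> R j"
      let ?s = "t - time_node R j" and ?S = "SUP y. norm (\<phi> y)"
      have S: "norm (\<phi> x') \<le> ?S"
        by (rule cSUP_upper[OF _ test_function_bdd_above[OF phi]]) simp
      have rhs: "0 \<le> B * (R powr (- 99 * d) * L2_norm f)"
        using B0 nf by simp
      have eq: "\<phi> x' * T_op \<alpha> f (x', t) - \<phi> x' * indicator (time_interval \<alpha> R j) t * T_op \<alpha> (F j) (x', ?s)
        = \<phi> x' * (T_op \<alpha> f (x', real j * R + ?s) - T_op \<alpha> (F j) (x', ?s))"
        using t by (simp add: time_node_def right_diff_distrib)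
      have "norm (\<phi> x' * (T_op \<alpha> f (x', real j * R + ?s) - T_op \<alpha> (F j) (x', ?s))) \<le> ?S * (B * (R powr (- 99 * d) * L2_norm f))"
      \<comment> \<open>Where \<phi> is nonzero, x' lies in the ball of radius 2R, which is exactly
        the range of the error estimate; elsewhere the left side vanishes.\<close>
      proof (cases "\<phi> x' = 0")
        case True
        then show ?thesis using rhs order_trans[OF norm_ge_zero S] by simp
      next
        case False
        then have "x' \<in> closure {x. \<phi> x \<noteq> 0}" by (intro closure_subset[THEN subsetD]) simp
        then have "x' \<in> ball 0 (2 * R)" using phi by (auto simp: test_functions_def)
        then have x: "norm x' \<le> 2 * R" by simp
        show ?thesis
          unfolding norm_mult
          by (intro mult_mono S err x time_interval_bounds[OF R j t] order_trans[OF norm_ge_zero S]) auto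
      qed
      then show "norm (\<phi> x' * T_op \<alpha> f (x', t) - \<phi> x' * indicator (time_interval \<alpha> R j) t * T_op \<alpha> (F j) (x', ?s))
          \<le> B * ?S * (R powr (- 99 * real CARD('d)) * L2_norm f)"
        unfolding eq d_def by (simp only: mult_ac)
    next
      have "enn2real (\<Sum>j\<le>last_index \<alpha> R. l2sq (F j)) \<le> D * R powr \<epsilon> * (L2_norm f)\<^sup>2"
      proof (rule enn2real_leI)
        have e: "2 * pi / (R * \<alpha> * r * exp (- \<alpha>) * (1/2) powr \<alpha>) = 2 * pi / (\<alpha> * exp (- \<alpha>) * (1/2) powr \<alpha>) * R powr \<epsilon>"
        proof -
          have "R * \<alpha> * r * exp (- \<alpha>) * (1/2) powr \<alpha> = (r * R) * (\<alpha> * exp (- \<alpha>) * (1/2) powr \<alpha>)"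
            by (simp only: mult_ac)
          also have "\<dots> = (\<alpha> * exp (- \<alpha>) * (1/2) powr \<alpha>) / R powr \<epsilon>"
            unfolding rR powr_minus divide_inverse by (rule mult.commute)
          finally show ?thesis by simp
        qed
        show "(\<Sum>j\<le>last_index \<alpha> R. l2sq (F j)) \<le> ennreal (D * R powr \<epsilon> * (L2_norm f)\<^sup>2)"
          using F(5)[of "last_index \<alpha> R"] unfolding e D_def by (simp add: mult_ac)
      qed (use D in simp)
      then have "sqrt (enn2real (\<Sum>j\<le>last_index \<alpha> R. l2sq (F j))) \<le> sqrt (D * R powr \<epsilon> * (L2_norm f)\<^sup>2)"
        by (rule real_sqrt_le_mono)
      also have "\<dots> = sqrt D * R powr (\<epsilon> * (1/2)) * L2_norm f"
      proof -
        have "sqrt (R powr \<epsilon>) = R powr (\<epsilon> * (1/2))"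
          using R by (simp add: powr_half_sqrt[symmetric] powr_powr)
        then show ?thesis using nf by (simp add: real_sqrt_mult)
      qed
      finally show "L2_norm (\<lambda>x. sqrt (\<Sum>j \<le> last_index \<alpha> R. (norm (F j x))\<^sup>2)) \<le> sqrt D * R powr (\<epsilon> * (1/2)) * L2_norm f"
        unfolding L2_norm_square_function[OF F(1)] .
    qed (use F in auto)
  qed
qed simp

end
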